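(* Let $p\ge 1$ and $n\ge 1$. The $\tfrac12 np(p+1)$-dimensional volume of the real moment space $\mathcal{M}_n(\mathbb{R})$ is $$\mathcal{V}(\mathcal{M}_n(\mathbb{R}))=\int_{\mathcal{M}_n(\mathbb{R})}dS_1\cdots dS_n=\prod_{k=1}^n B_p\!\left(\tfrac12 k(p+1),\tfrac12 k(p+1)\right).$$
   Context: $\mathcal{S}_p(\mathbb{R})$ is the space of real symmetric $p\times p$ matrices, with Lebesgue measure $dX=\prod_{i\le j}dx_{i,j}$ (product Lebesgue measure on the independent entries). A real matrix measure on $[0,1]$ is a $p\times p$ matrix $\mu=(\mu_{i,j})$ of signed Borel measures such that $\mu(A)$ is symmetric nonnegative definite for every Borel $A\subset[0,1]$, normalized by $\mu([0,1])=I_p$. Its moments are $S_k=\int_0^1x^k\,d\mu(x)$. The $n$th moment space is $\mathcal{M}_n(\mathbb{R})=\{(S_1,\dots,S_n)^T: S_j=\int_0^1x^jd\mu(x),\ j=1,\dots,n,\ \mu \text{ a real matrix measure on }[0,1]\}\subset(\mathcal{S}_p(\mathbb{R}))^n$. The multivariate Gamma function is $\Gamma_p(a)=\pi^{p(p-1)/4}\prod_{i=1}^p\Gamma(a-\tfrac12(i-1))$ for $a>\tfrac12(p-1)$, and the multivariate Beta function is $B_p(a,b)=\Gamma_p(a)\Gamma_p(b)/\Gamma_p(a+b)$ for $a,b>\tfrac12(p-1)$. *)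

theory Defs
  imports "HOL-Analysis.Analysis"
begin

text \<open>A finite signed Borel measure on [0,1] is represented as a pair (M1, M2) of finite
  (nonnegative) Borel measures on [0,1]; the signed measure is A \<mapsto> M1(A) - M2(A).
  Every finite signed measure arises this way (Jordan decomposition).\<close>

definition signed_borel_measure01 :: "real measure \<times> real measure \<Rightarrow> bool" where
  "signed_borel_measure01 m \<longleftrightarrow>
     finite_measure (fst m) \<and> sets (fst m) = sets (restrict_space borel {0..1::real}) \<and>
     finite_measure (snd m) \<and> sets (snd m) = sets (restrict_space borel {0..1::real})"

definition sbm_val :: "real measure \<times> real measure \<Rightarrow> real set \<Rightarrow> real" where
  "sbm_val m A = measure (fst m) A - measure (snd m) A"

definition sbm_integral :: "real measure \<times> real measure \<Rightarrow> (real \<Rightarrow> real) \<Rightarrow> real" where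
  "sbm_integral m f = integral\<^sup>L (fst m) f - integral\<^sup>L (snd m) f"

definition sym_nonneg_def :: "nat \<Rightarrow> (nat \<Rightarrow> nat \<Rightarrow> real) \<Rightarrow> bool" where
  "sym_nonneg_def p A \<longleftrightarrow>
     (\<forall>i<p. \<forall>j<p. A i j = A j i) \<and>
     (\<forall>v :: nat \<Rightarrow> real. (\<Sum>i<p. \<Sum>j<p. v i * A i j * v j) \<ge> 0)"

definition real_matrix_measure :: "nat \<Rightarrow> (nat \<Rightarrow> nat \<Rightarrow> real measure \<times> real measure) \<Rightarrow> bool" where
  "real_matrix_measure p \<mu> \<longleftrightarrow>
     (\<forall>i<p. \<forall>j<p. signed_borel_measure01 (\<mu> i j)) \<and>
     (\<forall>A \<in> sets (restrict_space borel {0..1::real}). sym_nonneg_def p (\<lambda>i j. sbm_val (\<mu> i j) A)) \<and>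
     (\<forall>i<p. \<forall>j<p. sbm_val (\<mu> i j) {0..1} = (if i = j then 1 else 0))"

text \<open>Coordinates of (S_1,...,S_n) in (S_p(R))^n: the independent entries (k,i,j),
  1 <= k <= n, 0 <= i <= j < p.\<close>
definition moment_index :: "nat \<Rightarrow> nat \<Rightarrow> (nat \<times> nat \<times> nat) set" where
  "moment_index p n = {(k, i, j). 1 \<le> k \<and> k \<le> n \<and> i \<le> j \<and> j < p}"

definition moment_space :: "nat \<Rightarrow> nat \<Rightarrow> (nat \<times> nat \<times> nat \<Rightarrow> real) set" where
  "moment_space p n =
     {s \<in> PiE (moment_index p n) (\<lambda>_. UNIV).
        \<exists>\<mu>. real_matrix_measure p \<mu> \<and>
            (\<forall>k i j. (k, i, j) \<in> moment_index p n \<longrightarrow>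
                 s (k, i, j) = sbm_integral (\<mu> i j) (\<lambda>x. x ^ k))}"

definition multi_gamma :: "nat \<Rightarrow> real \<Rightarrow> real" where
  "multi_gamma p a = pi powr (real p * (real p - 1) / 4) * (\<Prod>i=1..p. Gamma (a - (real i - 1) / 2))"

definition multi_beta :: "nat \<Rightarrow> real \<Rightarrow> real \<Rightarrow> real" where
  "multi_beta p a b = multi_gamma p a * multi_gamma p b / multi_gamma p (a + b)"

end

theory Submission
  imports Defs "HOL-Computational_Algebra.Polynomial"
begin

text \<open>
  Substitute \<open>x = (1 + cos t) / 2\<close>. The moments of \<open>\<mu>\<close> up to order \<open>n\<close> then correspond, by a triangular
  affine map, to the blocks \<open>C 0, \<dots>, C n\<close> of a block Toeplitz matrix \<open>T = (C \<bar>b - c\<bar>)\<close> with symmetric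
  blocks, and the moment space is the set where \<open>T\<close> is nonnegative definite. Given a positive definite
  \<open>T\<close> of order \<open>n\<close>, the Schur complement of the middle blocks of the next one has the form
  \<open>[L, E; E, L]\<close> with \<open>E\<close> affine in the new block, since \<open>T\<close> is invariant under reversing the order of the
  blocks. So it is positive definite iff \<open>L + E\<close> and \<open>L - E\<close> are: the new moment ranges over a matrix
  interval. If \<open>R\<close> is the length of this interval and \<open>Y\<close> the distance of the new moment from its lower
  end, then the next interval has length of determinant \<open>det Y det (R - Y) / det R\<close>. Hence the integral
  of a power of this determinant over the last moment is a matrix-variate beta integral, and it
  reproduces the same kind of integrand for one moment less, with a larger exponent.

  Nonnegative \<open>T\<close> are limits of positive definite ones. For these, the Hankel form of the moments
  (after extending the sequence) and its shift are diagonalized simultaneously, which gives a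
  representing measure with a bounded number of atoms; hence the moment space is closed.
\<close>

section \<open>Positive pivots and Schur complements\<close>

text \<open>The volume is an integral over independent entries, so determinants are organized as
  products of Gaussian pivots: eliminating an index matches integrating out the row of coordinates
  that carries it. Only one-dimensional substitutions and Fubini are needed, and no Jacobian of a
  matrix factorization. Each integration raises the exponent by \<open>(p + 1) / 2\<close>; since
  the plain volume starts from exponent 0, the factor number \<open>k\<close> of the product comes
  from the moment of order \<open>n + 1 - k\<close>. Pivots describe only the open set of positive
  definite Toeplitz matrices, whereas the moment space is closed. The boundary is not shown to be
  null directly. Instead, the moment space is exactly the intersection of the preimages of the open
  set under homotheties towards an interior point, with ratios tending to 1. This gives its
  measurability, and the scaling of Lebesgue measure squeezes its volume.\<close>

type_synonym 'a kernel = "'a \<Rightarrow> 'a \<Rightarrow> real"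

text \<open>One step of Gaussian elimination. If the pivot \<open>A x x\<close> is zero, then \<open>schur x A = A\<close> by
  \<open>x / 0 = 0\<close>, but then \<open>pd\<close> fails at \<open>x\<close> anyway. For symmetric
  \<open>A\<close>, \<open>pd xs A\<close> is positive definiteness on \<open>xs\<close>, and \<open>pdet xs A\<close> is then the determinant.\<close>
definition schur :: "'a \<Rightarrow> 'a kernel \<Rightarrow> 'a \<Rightarrow> 'a \<Rightarrow> real" where
  "schur x A i j = A i j - A i x * A x j / A x x"

fun schurs :: "'a list \<Rightarrow> 'a kernel \<Rightarrow> 'a \<Rightarrow> 'a \<Rightarrow> real" where
  "schurs [] A = A"
| "schurs (x # xs) A = schurs xs (schur x A)"

fun pd :: "'a list \<Rightarrow> 'a kernel \<Rightarrow> bool" where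
  "pd [] A \<longleftrightarrow> True"
| "pd (x # xs) A \<longleftrightarrow> A x x > 0 \<and> pd xs (schur x A)"

fun pdet :: "'a list \<Rightarrow> 'a kernel \<Rightarrow> real" where
  "pdet [] A = 1"
| "pdet (x # xs) A = A x x * pdet xs (schur x A)"

definition symm :: "'a kernel \<Rightarrow> bool" where
  "symm A \<longleftrightarrow> (\<forall>i j. A i j = A j i)"

lemma symmD: "symm A \<Longrightarrow> A i j = A j i"
  by (simp add: symm_def)

lemma symm_schur: "symm A \<Longrightarrow> symm (schur x A)"
  unfolding symm_def schur_def by (metis mult.commute)

lemma symm_schurs: "symm A \<Longrightarrow> symm (schurs xs A)"
  by (induction xs arbitrary: A) (auto simp: symm_schur)

lemma pd_append: "pd (xs @ ys) A \<longleftrightarrow> pd xs A \<and> pd ys (schurs xs A)"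
  by (induction xs arbitrary: A) auto

lemma pdet_append: "pdet (xs @ ys) A = pdet xs A * pdet ys (schurs xs A)"
  by (induction xs arbitrary: A) auto

lemma pdet_pos: "pd xs A \<Longrightarrow> pdet xs A > 0"
  by (induction xs arbitrary: A) auto

lemma pd_cong: "(\<And>i j. i \<in> set xs \<Longrightarrow> j \<in> set xs \<Longrightarrow> A i j = B i j) \<Longrightarrow> pd xs A = pd xs B"
proof (induction xs arbitrary: A B)
  case (Cons x xs)
  have "pd xs (schur x A) = pd xs (schur x B)"
    by (rule Cons.IH) (auto simp: schur_def Cons.prems)
  then show ?case using Cons.prems by simp
qed simp

lemma pdet_cong: "(\<And>i j. i \<in> set xs \<Longrightarrow> j \<in> set xs \<Longrightarrow> A i j = B i j) \<Longrightarrow> pdet xs A = pdet xs B"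
proof (induction xs arbitrary: A B)
  case (Cons x xs)
  have "pdet xs (schur x A) = pdet xs (schur x B)"
    by (rule Cons.IH) (auto simp: schur_def Cons.prems)
  then show ?case using Cons.prems by simp
qed simp

lemma schur_map: "(\<lambda>i j. schur (f x) A (f i) (f j)) = schur x (\<lambda>i j. A (f i) (f j))"
  by (simp add: schur_def fun_eq_iff)

lemma pd_map: "pd (map f xs) A = pd xs (\<lambda>i j. A (f i) (f j))"
  by (induction xs arbitrary: A) (auto simp: schur_map)

lemma pdet_map: "pdet (map f xs) A = pdet xs (\<lambda>i j. A (f i) (f j))"
  by (induction xs arbitrary: A) (auto simp: schur_map)

lemma schurs_map: "schurs (map f xs) A (f i) (f j) = schurs xs (\<lambda>i j. A (f i) (f j)) i j"
  by (induction xs arbitrary: A) (auto simp: schur_map)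

lemma schur_scale: "c \<noteq> 0 \<Longrightarrow> schur x (\<lambda>i j. c * A i j) = (\<lambda>i j. c * schur x A i j)"
  by (auto simp: schur_def fun_eq_iff field_simps)

lemma pd_scale: "c > 0 \<Longrightarrow> pd xs (\<lambda>i j. c * A i j) = pd xs A"
  by (induction xs arbitrary: A) (auto simp: schur_scale zero_less_mult_iff)

lemma pdet_scale: "c > 0 \<Longrightarrow> pdet xs (\<lambda>i j. c * A i j) = c ^ length xs * pdet xs A"
  by (induction xs arbitrary: A) (auto simp: schur_scale)

text \<open>Both sides eliminate the pair \<open>x\<close>, \<open>y\<close> at once: over the 2 by
  2 minor \<open>d\<close> as denominator, the result is symmetric in the two pivots.\<close>

lemma schur_swap:
  assumes "symm A" "A x x > 0" "A y y > 0" "A x x * A y y - A x y * A x y > 0"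
  shows "schur y (schur x A) = schur x (schur y A)"
proof (intro ext)
  fix i j
  have s: "A y x = A x y" using assms(1) by (rule symmD)
  define a b c d where "a = A x x" "b = A y y" "c = A x y" "d = a * b - c * c"
  have nz: "a \<noteq> 0" "b \<noteq> 0" "d \<noteq> 0" using assms a_b_c_d_def by auto
  have e1: "b - c * c / a = d / a" and e2: "a - c * c / b = d / b"
    using nz by (auto simp: a_b_c_d_def(4) field_simps)
  have bd: "b = (d + c * c) / a" using nz by (simp add: a_b_c_d_def(4))
  show "schur y (schur x A) i j = schur x (schur y A) i j"
    unfolding schur_def s a_b_c_d_def(1-3)[symmetric] e1 e2
    using nz by (simp add: field_simps) (simp add: a_b_c_d_def(4) algebra_simps)
qed

text \<open>The second pivot is the 2 by 2 minor divided by the first. For symmetric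
  \<open>A\<close> the right-hand side does not change when \<open>x\<close> and \<open>y\<close>
  trade places, which yields \<open>swap_front\<close>.\<close>

lemma pd_swap2:
  assumes "symm A"
  shows "A x x > 0 \<and> schur x A y y > 0 \<longleftrightarrow> A x x > 0 \<and> A y y > 0 \<and> A x x * A y y - A x y * A x y > 0"
proof -
  have s: "A y x = A x y" using assms(1) by (rule symmD)
  have "schur x A y y = (A x x * A y y - A x y * A x y) / A x x" if "A x x > 0"
    using that by (simp add: schur_def s field_simps)
  moreover have "A y y > 0" if "A x x > 0" "A x x * A y y - A x y * A x y > 0"
  proof -
    have "A x x * A y y > 0" using that(2) zero_le_square[of "A x y"] by linarith
    then show ?thesis using that(1) by (simp add: zero_less_mult_iff)
  qed
  ultimately show ?thesis by (auto simp: zero_less_divide_iff)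
qed

lemma swap_front:
  assumes "symm A"
  shows "pd (x # y # zs) A = pd (y # x # zs) A"
    and "pd (x # y # zs) A \<Longrightarrow> pdet (x # y # zs) A = pdet (y # x # zs) A"
    and "pd [x, y] A \<Longrightarrow> schurs (x # y # zs) A = schurs (y # x # zs) A"
proof -
  have s: "A y x = A x y" using assms(1) by (rule symmD)
  let ?c = "A x x > 0 \<and> A y y > 0 \<and> A x x * A y y - A x y * A x y > 0"
  have 1: "A x x > 0 \<and> schur x A y y > 0 \<longleftrightarrow> ?c"
    using pd_swap2[OF assms] .
  have 2: "A y y > 0 \<and> schur y A x x > 0 \<longleftrightarrow> ?c"
    using pd_swap2[OF assms, of y x] by (auto simp: s mult.commute)
  have 3: "schur y (schur x A) = schur x (schur y A)" if ?c
    using schur_swap[OF assms] that by blast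
  show "pd (x # y # zs) A = pd (y # x # zs) A" using 1 2 3 by auto
  show "pdet (x # y # zs) A = pdet (y # x # zs) A" if "pd (x # y # zs) A"
  proof -
    have c: ?c using 1 that by auto
    have "A x x * schur x A y y = A y y * schur y A x x"
      using c by (simp add: schur_def s field_simps)
    then show ?thesis using 3[OF c] by (simp add: mult.assoc[symmetric])
  qed
  show "schurs (x # y # zs) A = schurs (y # x # zs) A" if "pd [x, y] A"
    using 1 3 that by auto
qed

lemma move_front:
  assumes "symm A"
  shows "pd (us @ x # vs) A = pd (x # us @ vs) A \<and>
    (pd (us @ x # vs) A \<longrightarrow> pdet (us @ x # vs) A = pdet (x # us @ vs) A \<and>
       schurs (us @ x # vs) A = schurs (x # us @ vs) A)"
  using assms
proof (induction us arbitrary: A)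
  case (Cons u us)
  note IH = Cons.IH[OF symm_schur[OF Cons.prems, of u]]
  have "pd (u # us @ x # vs) A = pd (u # x # us @ vs) A" using IH by auto
  then have 1: "pd (u # us @ x # vs) A = pd (x # u # us @ vs) A"
    using swap_front(1)[OF Cons.prems, of u x] by blast
  { assume p: "pd (u # us @ x # vs) A"
    then have q: "pd (u # x # us @ vs) A" "pd [u, x] A" using IH by auto
    have "pdet (u # us @ x # vs) A = pdet (u # x # us @ vs) A"
      "schurs (u # us @ x # vs) A = schurs (u # x # us @ vs) A" using IH p by auto
    then have "pdet (u # us @ x # vs) A = pdet (x # u # us @ vs) A"
      "schurs (u # us @ x # vs) A = schurs (x # u # us @ vs) A"
      using swap_front(2,3)[OF Cons.prems, of u x "us @ vs"] q by metis+ }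
  with 1 show ?case by simp
qed simp

text \<open>Moving one index to the front at a time reaches every order. This freedom is used to
  eliminate the middle blocks first, to reverse the blocks and to interleave the two outer
  ones.\<close>

lemma perm_invariant:
  assumes "symm A" "mset xs = mset ys"
  shows "pd xs A = pd ys A"
    and "pd xs A \<Longrightarrow> pdet xs A = pdet ys A"
    and "pd xs A \<Longrightarrow> schurs xs A = schurs ys A"
proof -
  have "pd xs A = pd ys A \<and> (pd xs A \<longrightarrow> pdet xs A = pdet ys A \<and> schurs xs A = schurs ys A)"
    using assms
  proof (induction xs arbitrary: A ys)
    case (Cons x xs)
    have "x \<in> set ys" using Cons.prems(2) by (metis list.set_intros(1) mset_eq_setD)
    then obtain us vs where ys: "ys = us @ x # vs" by (meson split_list)
    then have m: "mset xs = mset (us @ vs)" using Cons.prems(2) by simp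
    note IH = Cons.IH[OF symm_schur[OF Cons.prems(1), of x] m]
    show ?case using IH move_front[OF Cons.prems(1), of us x vs] unfolding ys by auto
  qed auto
  then show "pd xs A = pd ys A"
    and "pd xs A \<Longrightarrow> pdet xs A = pdet ys A"
    and "pd xs A \<Longrightarrow> schurs xs A = schurs ys A" by auto
qed

definition qform :: "'a set \<Rightarrow> 'a kernel \<Rightarrow> ('a \<Rightarrow> real) \<Rightarrow> real" where
  "qform I A v = (\<Sum>i\<in>I. \<Sum>j\<in>I. v i * A i j * v j)"

text \<open>Completing the square in the coordinate \<open>x\<close>; the remainder no longer
  involves \<open>v x\<close>.\<close>

lemma qform_schur:
  assumes "finite I" "x \<notin> I" "symm A" "A x x \<noteq> 0"
  shows "qform (insert x I) A v =
    A x x * (v x + (\<Sum>j\<in>I. A x j * v j) / A x x)\<^sup>2 + qform I (schur x A) v"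
proof -
  define s where "s = (\<Sum>j\<in>I. A x j * v j)"
  have s': "(\<Sum>i\<in>I. v i * A i x) = s"
    unfolding s_def by (intro sum.cong) (simp_all add: symmD[OF assms(3), of _ x])
  have "qform (insert x I) A v = v x * A x x * v x + v x * s + s * v x + qform I A v"
    using assms(1,2) unfolding qform_def
    by (simp add: sum.distrib s'[symmetric] sum_distrib_right sum_distrib_left mult_ac s_def[symmetric])
       (simp add: sum_distrib_left mult_ac symmD[OF assms(3), of _ x])
  moreover have "qform I (schur x A) v = qform I A v - s * s / A x x"
  proof -
    have "qform I (schur x A) v = qform I A v - (\<Sum>i\<in>I. \<Sum>j\<in>I. (v i * A i x) * (A x j * v j) / A x x)"
      unfolding qform_def schur_def by (simp add: algebra_simps sum_subtractf)
    also have "(\<Sum>i\<in>I. \<Sum>j\<in>I. (v i * A i x) * (A x j * v j) / A x x) =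
        (\<Sum>i\<in>I. v i * A i x) * (\<Sum>j\<in>I. A x j * v j) / A x x"
      by (simp add: sum_product sum_divide_distrib)
    finally show ?thesis by (simp add: s_def s'[unfolded s_def])
  qed
  moreover have "A x x * (v x + s / A x x)\<^sup>2 = v x * A x x * v x + v x * s + s * v x + s * s / A x x"
    using assms(4) by (simp add: field_simps power2_eq_square)
  ultimately show ?thesis unfolding s_def[symmetric] by simp
qed

lemma qform_cong: "(\<And>i. i \<in> I \<Longrightarrow> v i = w i) \<Longrightarrow> qform I A v = qform I A w"
  by (simp add: qform_def)

lemma pd_iff_qform:
  fixes A :: "'a kernel"
  assumes "distinct xs" "symm A"
  shows "pd xs A \<longleftrightarrow> (\<forall>v :: 'a \<Rightarrow> real. (\<exists>i\<in>set xs. v i \<noteq> 0) \<longrightarrow> qform (set xs) A v > 0)"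
  using assms
proof (induction xs arbitrary: A)
  case (Cons x xs)
  have x: "x \<notin> set xs" "distinct xs" using Cons.prems by auto
  note IH = Cons.IH[OF x(2) symm_schur[OF Cons.prems(2), of x]]
  note Q = qform_schur[OF finite_set x(1) Cons.prems(2)]
  show ?case
  proof
    assume p: "pd (x # xs) A"
    show "\<forall>v :: 'a \<Rightarrow> real. (\<exists>i\<in>set (x # xs). v i \<noteq> 0) \<longrightarrow> qform (set (x # xs)) A v > 0"
    proof (intro allI impI)
      fix v :: "'a \<Rightarrow> real" assume v: "\<exists>i\<in>set (x # xs). v i \<noteq> 0"
      show "qform (set (x # xs)) A v > 0"
      proof (cases "\<exists>i\<in>set xs. v i \<noteq> 0")
        case True
        then have q: "qform (set xs) (schur x A) v > 0" using IH p by auto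
        have "A x x * (v x + (\<Sum>j\<in>set xs. A x j * v j) / A x x)\<^sup>2 \<ge> 0" using p by simp
        have nz: "A x x \<noteq> 0" using p by auto
        show ?thesis unfolding list.set Q[OF nz] by (rule add_nonneg_pos) fact+
      next
        case False
        then have "v x \<noteq> 0" "(\<Sum>j\<in>set xs. A x j * v j) = 0" "qform (set xs) (schur x A) v = 0"
          using v by (auto simp: qform_def)
        then show ?thesis using p Q[of v] by simp
      qed
    qed
  next
    assume q: "\<forall>v :: 'a \<Rightarrow> real. (\<exists>i\<in>set (x # xs). v i \<noteq> 0) \<longrightarrow> qform (set (x # xs)) A v > 0"
    let ?e = "\<lambda>i. if i = x then 1 else 0 :: real"
    have "qform (set (x # xs)) A ?e > 0" using q by auto
    moreover have "qform (set (x # xs)) A ?e = A x x"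
    proof -
      have "qform (set (x # xs)) A ?e =
          (\<Sum>i\<in>set (x # xs). \<Sum>j\<in>set (x # xs). if j = x then if i = x then A x x else 0 else 0)"
        unfolding qform_def by (intro sum.cong) auto
      also have "\<dots> = A x x" by (simp only: sum.delta finite_set) simp
      finally show ?thesis .
    qed
    ultimately have a: "A x x > 0" by simp
    have "qform (set xs) (schur x A) v > 0" if v: "\<exists>i\<in>set xs. v i \<noteq> 0" for v
    proof -
      \<comment> \<open>The coordinate \<open>x\<close> is chosen to make the square in
        \<open>qform_schur\<close> vanish, so the whole form equals the reduced one.\<close>
      define w where "w = v(x := - (\<Sum>j\<in>set xs. A x j * v j) / A x x)"
      have wv: "w i = v i" if "i \<in> set xs" for i using that x(1) by (auto simp: w_def)
      have "\<exists>i\<in>set (x # xs). w i \<noteq> 0" using v wv by fastforce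
      then have "qform (set (x # xs)) A w > 0" using q by blast
      moreover have "(\<Sum>j\<in>set xs. A x j * w j) = (\<Sum>j\<in>set xs. A x j * v j)"
        by (intro sum.cong) (auto simp: wv)
      moreover have "qform (set xs) (schur x A) w = qform (set xs) (schur x A) v"
        by (rule qform_cong) (simp add: wv)
      moreover have "w x + (\<Sum>j\<in>set xs. A x j * v j) / A x x = 0" by (simp add: w_def)
      moreover have "A x x \<noteq> 0" using a by simp
      ultimately show ?thesis using Q[of w] by simp
    qed
    then show "pd (x # xs) A" using a IH by auto
  qed
qed auto

lemma measurable_schur:
  assumes "\<And>i j. (\<lambda>w. A w i j) \<in> borel_measurable M"
  shows "(\<lambda>w. schur x (A w) i j) \<in> borel_measurable M"
  unfolding schur_def using assms by measurable

lemma measurable_pdet: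
  assumes "\<And>i j. (\<lambda>w. A w i j) \<in> borel_measurable M"
  shows "(\<lambda>w. pdet xs (A w)) \<in> borel_measurable M"
  using assms
proof (induction xs arbitrary: A)
  case (Cons x xs)
  have [measurable]: "(\<lambda>w. A w x x) \<in> borel_measurable M" by (rule Cons.prems)
  have [measurable]: "(\<lambda>w. pdet xs (schur x (A w))) \<in> borel_measurable M"
    by (rule Cons.IH) (rule measurable_schur, rule Cons.prems)
  show ?case by simp
qed simp

lemma measurable_pd:
  assumes "\<And>i j. (\<lambda>w. A w i j) \<in> borel_measurable M"
  shows "Measurable.pred M (\<lambda>w. pd xs (A w))"
  using assms
proof (induction xs arbitrary: A)
  case (Cons x xs)
  have [measurable]: "(\<lambda>w. A w x x) \<in> borel_measurable M" by (rule Cons.prems)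
  have [measurable]: "Measurable.pred M (\<lambda>w. pd xs (schur x (A w)))"
    by (rule Cons.IH) (rule measurable_schur, rule Cons.prems)
  show ?case by simp
qed simp

abbreviation interleave :: "('b \<Rightarrow> 'a) \<Rightarrow> ('b \<Rightarrow> 'a) \<Rightarrow> 'b list \<Rightarrow> 'a list" where
  "interleave a b is \<equiv> concat (map (\<lambda>i. [a i, b i]) is)"

text \<open>Passing to normalized sums and differences of the two copies splits
  \<open>[L, D; D, L]\<close> into \<open>L + D\<close> and \<open>L - D\<close>. Interleaving the
  copies makes the elimination of a pair \<open>a x\<close>, \<open>b x\<close> one elimination step
  in each summand, so the splitting survives the induction.\<close>

lemma pd_pair_block:
  assumes "\<And>i j. S (a i) (a j) = L i j" "\<And>i j. S (b i) (b j) = L i j"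
    "\<And>i j. S (a i) (b j) = D i j" "\<And>i j. S (b i) (a j) = D i j"
  shows "(pd (interleave a b is) S \<longleftrightarrow>
      pd is (\<lambda>i j. L i j + D i j) \<and> pd is (\<lambda>i j. L i j - D i j)) \<and>
    (pd (interleave a b is) S \<longrightarrow> pdet (interleave a b is) S =
      pdet is (\<lambda>i j. L i j + D i j) * pdet is (\<lambda>i j. L i j - D i j))"
  using assms
proof (induction "is" arbitrary: S L D)
  case (Cons x "is")
  define S' where "S' = schur (b x) (schur (a x) S)"
  define Lp where "Lp = schur x (\<lambda>i j. L i j + D i j)"
  define Lm where "Lm = schur x (\<lambda>i j. L i j - D i j)"
  define l d where "l = L x x" "d = D x x"
  let ?c = "l + d > 0 \<and> l - d > 0"
  have "schur (a x) S (b x) (b x) = l - d * d / l"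
    unfolding schur_def using Cons.prems by (simp add: l_d_def)
  moreover have "S (a x) (a x) = l" using Cons.prems by (simp add: l_d_def)
  ultimately have pv: "S (a x) (a x) > 0 \<and> schur (a x) S (b x) (b x) > 0 \<longleftrightarrow> ?c"
     and pp: "?c \<Longrightarrow> S (a x) (a x) * schur (a x) S (b x) (b x) = (l + d) * (l - d)"
  proof -
    assume e: "schur (a x) S (b x) (b x) = l - d * d / l" "S (a x) (a x) = l"
    have f: "l - d * d / l = (l + d) * (l - d) / l" if "l > 0"
      using that by (simp add: field_simps)
    show "S (a x) (a x) > 0 \<and> schur (a x) S (b x) (b x) > 0 \<longleftrightarrow> ?c" unfolding e
    proof
      assume h: "l > 0 \<and> l - d * d / l > 0"
      then have "(l + d) * (l - d) / l > 0" unfolding f[OF conjunct1[OF h], symmetric] by blast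
      then have "(l + d) * (l - d) > 0" using h by (auto simp: zero_less_divide_iff)
      then show ?c using h by (auto simp: zero_less_mult_iff)
    next
      assume h: ?c
      then have "l > 0" by linarith
      have "(l + d) * (l - d) / l > 0" using h \<open>l > 0\<close> by simp
      then show "l > 0 \<and> l - d * d / l > 0" unfolding f[OF \<open>l > 0\<close>] using \<open>l > 0\<close> by blast
    qed
    show "S (a x) (a x) * schur (a x) S (b x) (b x) = (l + d) * (l - d)" if ?c
    proof -
      have l: "l > 0" using that by linarith
      show ?thesis unfolding e f[OF l] using l by simp
    qed
  qed
  \<comment> \<open>The remaining form has the same shape, with half the sum and half the difference
    of \<open>Lp\<close> and \<open>Lm\<close> in the roles of \<open>L\<close> and
    \<open>D\<close>.\<close>
  have core: "S' (a i) (a j) = (Lp i j + Lm i j) / 2 \<and> S' (b i) (b j) = (Lp i j + Lm i j) / 2 \<and>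
     S' (a i) (b j) = (Lp i j - Lm i j) / 2 \<and> S' (b i) (a j) = (Lp i j - Lm i j) / 2" if c: ?c for i j
  proof -
    define u w where "u = l + d" "w = l - d"
    have nz: "u \<noteq> 0" "w \<noteq> 0" "u + w \<noteq> 0" using c by (auto simp: u_w_def)
    have l: "l = (u + w) / 2" and d: "d = (u - w) / 2" by (auto simp: u_w_def)
    have ld: "l - d * d / l = u * w / l" using nz unfolding l d by (simp add: field_simps)
    show ?thesis
      unfolding S'_def Lp_def Lm_def schur_def Cons.prems l_d_def[symmetric] ld u_w_def[symmetric]
      using nz unfolding l d by (simp add: divide_simps) (simp add: algebra_simps)
  qed
  have pm: "(\<lambda>i j. (Lp i j + Lm i j) / 2 + (Lp i j - Lm i j) / 2) = Lp"
    "(\<lambda>i j. (Lp i j + Lm i j) / 2 - (Lp i j - Lm i j) / 2) = Lm"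
    by (simp_all add: fun_eq_iff field_simps)
  have IH1: "pd (interleave a b is) S' \<longleftrightarrow> pd is Lp \<and> pd is Lm" if ?c
    using Cons.IH[where S=S' and L="\<lambda>i j. (Lp i j + Lm i j) / 2" and D="\<lambda>i j. (Lp i j - Lm i j) / 2"]
      core[OF that] unfolding pm by auto
  have IH2: "pdet (interleave a b is) S' = pdet is Lp * pdet is Lm"
    if ?c "pd (interleave a b is) S'"
    using Cons.IH[where S=S' and L="\<lambda>i j. (Lp i j + Lm i j) / 2" and D="\<lambda>i j. (Lp i j - Lm i j) / 2"]
      core[OF that(1)] that(2) unfolding pm by auto
  have cc: "interleave a b (x # is) = a x # b x # interleave a b is"
    by simp
  have ld: "L x x + D x x = l + d" "L x x - D x x = l - d" by (simp_all add: l_d_def)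
  have 1: "pd (interleave a b (x # is)) S \<longleftrightarrow>
      ?c \<and> pd (interleave a b is) S'"
    unfolding cc pd.simps S'_def[symmetric] using pv by blast
  then have 2: "pd (interleave a b (x # is)) S \<longleftrightarrow>
      pd (x # is) (\<lambda>i j. L i j + D i j) \<and> pd (x # is) (\<lambda>i j. L i j - D i j)"
    unfolding pd.simps ld Lp_def[symmetric] Lm_def[symmetric] using IH1 by blast
  have "pdet (interleave a b (x # is)) S =
      pdet (x # is) (\<lambda>i j. L i j + D i j) * pdet (x # is) (\<lambda>i j. L i j - D i j)"
    if "pd (interleave a b (x # is)) S"
  proof -
    have c: ?c and p: "pd (interleave a b is) S'" using 1 that by blast+
    have "pdet (interleave a b (x # is)) S =
        (S (a x) (a x) * schur (a x) S (b x) (b x)) * pdet (interleave a b is) S'"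
      unfolding cc pdet.simps S'_def[symmetric] by (rule mult.assoc[symmetric])
    also have "\<dots> = ((l + d) * pdet is Lp) * ((l - d) * pdet is Lm)"
      unfolding pp[OF c] IH2[OF c p] by (simp only: mult_ac)
    finally show ?thesis unfolding pdet.simps ld Lp_def[symmetric] Lm_def[symmetric] .
  qed
  with 2 show ?case by blast
qed simp

section \<open>Iterated integrals and one-dimensional beta integrals\<close>

text \<open>Points are total functions and integration overwrites coordinates in place. Coordinates
  that are not listed keep their values and act as parameters, so partial integrals compose without
  a change of product space.\<close>

fun iterint :: "'i list \<Rightarrow> (('i \<Rightarrow> real) \<Rightarrow> ennreal) \<Rightarrow> ('i \<Rightarrow> real) \<Rightarrow> ennreal" where
  "iterint [] f x = f x"
| "iterint (i # is) f x = (\<integral>\<^sup>+t. iterint is f (x(i := t)) \<partial>lborel)"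

text \<open>Serves as the measurable space of parameters; volumes are taken on finite
  products.\<close>

abbreviation fun_space :: "('i \<Rightarrow> real) measure" where
  "fun_space \<equiv> PiM UNIV (\<lambda>_. lborel)"

lemma measurable_upd: "(\<lambda>(x, t). x(i := t)) \<in> measurable (fun_space \<Otimes>\<^sub>M lborel) fun_space"
proof -
  have "(\<lambda>p. (fst p)(i := snd p)) \<in> measurable (fun_space \<Otimes>\<^sub>M lborel) fun_space"
    by (rule measurable_fun_upd[where J = UNIV]) auto
  then show ?thesis by (simp add: case_prod_beta)
qed

lemma measurable_upd1: "(\<lambda>t. x(i := t)) \<in> measurable lborel fun_space"
  by (rule measurable_fun_upd[where J = UNIV]) (auto simp: space_PiM)

lemma measurable_iterint:
  assumes "f \<in> borel_measurable fun_space"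
  shows "iterint is f \<in> borel_measurable fun_space"
proof (induction "is")
  case (Cons i "is")
  have "(\<lambda>(x, t). iterint is f (x(i := t))) \<in> borel_measurable (fun_space \<Otimes>\<^sub>M lborel)"
    using measurable_compose[OF measurable_upd[of i] Cons.IH]
    by (simp add: split_beta' del: fun_upd_apply)
  then have "(\<lambda>x. \<integral>\<^sup>+t. iterint is f (x(i := t)) \<partial>lborel) \<in> borel_measurable fun_space"
    by (rule lborel.borel_measurable_nn_integral)
  then show ?case by (simp only: iterint.simps)
qed (simp add: assms)

lemma iterint_append: "iterint (is @ js) f = iterint is (iterint js f)"
  by (induction "is") (auto simp: fun_eq_iff)

text \<open>Integration never alters the unlisted coordinates, so inside the integral they are the
  constants given by \<open>x0\<close>. This lets an integrand be simplified once the outer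
  variables are fixed.\<close>

lemma iterint_cong:
  assumes "\<And>x. (\<And>i. i \<notin> set is \<Longrightarrow> x i = x0 i) \<Longrightarrow> f x = g x"
  shows "iterint is f x0 = iterint is g x0"
  using assms
proof (induction "is" arbitrary: x0)
  case (Cons i "is")
  have "iterint is f (x0(i := t)) = iterint is g (x0(i := t))" for t
    by (rule Cons.IH, rule Cons.prems) auto
  then show ?case by simp
qed simp

lemma iterint_cmult:
  assumes "f \<in> borel_measurable fun_space"
  shows "iterint is (\<lambda>x. c * f x) x0 = c * iterint is f x0"
proof (induction "is" arbitrary: x0)
  case (Cons i "is")
  have "(\<lambda>t. iterint is f (x0(i := t))) \<in> borel_measurable lborel"
    by (rule measurable_compose[OF measurable_upd1 measurable_iterint[OF assms]])
  then show ?case by (simp only: iterint.simps Cons.IH nn_integral_cmult)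
qed simp

lemma iterint_zero: "iterint is (\<lambda>x. 0) x0 = 0"
  by (induction "is" arbitrary: x0) auto

lemma iterint_affine:
  assumes f: "f \<in> borel_measurable fun_space" and c: "c > 0"
  shows "ennreal c ^ length is * iterint is (\<lambda>x. f (\<lambda>i. c * x i + d i)) x0 =
    iterint is f (\<lambda>i. c * x0 i + d i)"
proof (induction "is" arbitrary: x0)
  case (Cons i "is")
  have aff: "(\<lambda>x. \<lambda>i. c * x i + d i) \<in> measurable fun_space fun_space"
    by (rule measurable_PiM_single') (auto simp: space_PiM)
  have m1: "(\<lambda>t. iterint is f ((\<lambda>i. c * x0 i + d i)(i := t))) \<in> borel_measurable lborel"
    by (rule measurable_compose[OF measurable_upd1 measurable_iterint[OF f]])
  have m2: "(\<lambda>t. iterint is (\<lambda>x. f (\<lambda>i. c * x i + d i)) (x0(i := t))) \<in> borel_measurable lborel"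
    by (rule measurable_compose[OF measurable_upd1 measurable_iterint[OF measurable_compose[OF aff f]]])
  have "iterint (i # is) f (\<lambda>i. c * x0 i + d i) =
      ennreal c * (\<integral>\<^sup>+t. iterint is f ((\<lambda>i. c * x0 i + d i)(i := d i + c * t)) \<partial>lborel)"
    using c m1 by (simp, subst nn_integral_real_affine[where c = c and t = "d i"]) auto
  also have "(\<lambda>t. iterint is f ((\<lambda>i. c * x0 i + d i)(i := d i + c * t))) =
      (\<lambda>t. iterint is f (\<lambda>j. c * (x0(i := t)) j + d j))"
    by (intro ext arg_cong[where f = "iterint is f"]) auto
  also have "\<dots> = (\<lambda>t. ennreal c ^ length is * iterint is (\<lambda>x. f (\<lambda>i. c * x i + d i)) (x0(i := t)))"
    by (simp only: Cons.IH)
  also have "(\<integral>\<^sup>+t. ennreal c ^ length is * iterint is (\<lambda>x. f (\<lambda>i. c * x i + d i)) (x0(i := t)) \<partial>lborel) =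
     ennreal c ^ length is * (\<integral>\<^sup>+t. iterint is (\<lambda>x. f (\<lambda>i. c * x i + d i)) (x0(i := t)) \<partial>lborel)"
    by (rule nn_integral_cmult[OF m2])
  finally show ?case by (simp add: mult.assoc)
qed simp

lemma nn_integral_PiM_iterint:
  assumes "distinct is" and f: "f \<in> borel_measurable fun_space"
  shows "(\<integral>\<^sup>+y. f (\<lambda>i. if i \<in> set is then y i else x0 i) \<partial>PiM (set is) (\<lambda>_. lborel)) = iterint is f x0"
  using assms(1)
proof (induction "is" arbitrary: x0)
  case Nil
  then show ?case by (simp add: nn_integral_count_space_finite PiM_empty)
next
  case (Cons i "is")
  interpret product_sigma_finite "\<lambda>_. lborel :: real measure"
    by standard
  have m: "(\<lambda>y j. if j \<in> set (i # is) then y j else x0 j) \<in> measurable (PiM (insert i (set is)) (\<lambda>_. lborel)) fun_space"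
  proof (rule measurable_PiM_single')
    fix j
    show "(\<lambda>y. if j \<in> set (i # is) then y j else x0 j) \<in> measurable (PiM (insert i (set is)) (\<lambda>_. lborel)) lborel"
      by (cases "j \<in> set (i # is)") auto
  qed (auto simp: space_PiM)
  have "(\<integral>\<^sup>+y. f (\<lambda>j. if j \<in> set (i # is) then y j else x0 j) \<partial>PiM (set (i # is)) (\<lambda>_. lborel)) =
     (\<integral>\<^sup>+t. \<integral>\<^sup>+y. f (\<lambda>j. if j \<in> set (i # is) then (y(i := t)) j else x0 j) \<partial>PiM (set is) (\<lambda>_. lborel) \<partial>lborel)"
    unfolding list.set using Cons.prems measurable_compose[OF m f]
    by (intro product_nn_integral_insert_rev) auto
  also have "\<dots> = (\<integral>\<^sup>+t. \<integral>\<^sup>+y. f (\<lambda>j. if j \<in> set is then y j else (x0(i := t)) j) \<partial>PiM (set is) (\<lambda>_. lborel) \<partial>lborel)"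
    using Cons.prems by (intro nn_integral_cong arg_cong[where f = f]) auto
  also have "\<dots> = iterint (i # is) f x0"
    using Cons.prems by (simp only: iterint.simps Cons.IH distinct.simps simp_thms)
  finally show ?case .
qed

abbreviation bump :: "real \<Rightarrow> real \<Rightarrow> real \<Rightarrow> real \<Rightarrow> ennreal" where
  "bump l r m x \<equiv> (if l < x \<and> x < r then ennreal (((x - l) * (r - x)) powr m) else 0)"

lemma nn_integral_sym_beta:
  fixes l r m :: real
  assumes m: "m > -1"
  shows "(\<integral>\<^sup>+x. bump l r m x \<partial>lborel) =
    (if l < r then ennreal ((r - l) powr (2 * m + 1) * Beta (m + 1) (m + 1)) else 0)"
proof (cases "l < r")
  case True
  define c where "c = r - l"
  have c: "c > 0" using True by (simp add: c_def)
  have "(\<integral>\<^sup>+x. bump l r m x \<partial>lborel) =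
    ennreal c * (\<integral>\<^sup>+u. bump l r m (l + c * u) \<partial>lborel)"
    using c by (subst nn_integral_real_affine[where c = c and t = l]) auto
  also have "(\<lambda>u. bump l r m (l + c * u)) =
     (\<lambda>u. ennreal (c powr (2 * m)) * (if 0 < u \<and> u < 1 then ennreal (u powr m * (1 - u) powr m) else 0))"
  proof
    fix u
    have r: "r = l + c" by (simp add: c_def)
    have e: "((l + c * u) - l) * (r - (l + c * u)) = (c * c) * (u * (1 - u))" by (simp add: r algebra_simps)
    have cond: "l < l + c * u \<and> l + c * u < r \<longleftrightarrow> 0 < u \<and> u < 1"
      using c by (auto simp: r zero_less_mult_iff)
    have "((c * c) * (u * (1 - u))) powr m = c powr (2 * m) * (u powr m * (1 - u) powr m)" if "0 < u" "u < 1"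
    proof -
      have "(c * c) powr m = c powr (2 * m)" using c by (simp add: powr_mult powr_add[symmetric])
      then show ?thesis using that c by (simp add: powr_mult)
    qed
    then show "bump l r m (l + c * u)
      = ennreal (c powr (2 * m)) * (if 0 < u \<and> u < 1 then ennreal (u powr m * (1 - u) powr m) else 0)"
      unfolding cond e by (simp add: ennreal_mult)
  qed
  also have "(\<integral>\<^sup>+u. ennreal (c powr (2 * m)) * (if 0 < u \<and> u < 1 then ennreal (u powr m * (1 - u) powr m) else 0) \<partial>lborel) =
    ennreal (c powr (2 * m)) * (\<integral>\<^sup>+u. (if 0 < u \<and> u < 1 then ennreal (u powr m * (1 - u) powr m) else 0) \<partial>lborel)"
    by (rule nn_integral_cmult) simp
  \<comment> \<open>The open interval differs from the closed one of the Beta integral only by its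
    end points, a null set.\<close>
  also have "(\<integral>\<^sup>+u. (if 0 < u \<and> u < 1 then ennreal (u powr m * (1 - u) powr m) else 0) \<partial>lborel) =
     (\<integral>\<^sup>+u. ennreal (u powr m * (1 - u) powr m) * indicator {0..1} u \<partial>lborel)"
    by (rule nn_integral_cong_AE, rule AE_I[of _ _ "{0, 1}"])
      (auto simp: indicator_def emeasure_lborel_countable)
  also have "\<dots> = ennreal (Beta (m + 1) (m + 1))"
    using has_integral_Beta_real[of "m + 1" "m + 1"] m
    by (intro nn_integral_has_integral_lebesgue') auto
  also have "ennreal c * (ennreal (c powr (2 * m)) * ennreal (Beta (m + 1) (m + 1))) =
     ennreal ((r - l) powr (2 * m + 1) * Beta (m + 1) (m + 1))"
  proof -
    have "Beta (m + 1) (m + 1) \<ge> 0" using m by (simp add: Beta_def Gamma_real_pos less_imp_le)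
    moreover have "c powr (2 * m + 1) = c * c powr (2 * m)" using c by (simp add: powr_add)
    ultimately show ?thesis unfolding c_def[symmetric] using c
      by (simp add: ennreal_mult[symmetric] mult_ac)
  qed
  finally show ?thesis using True by simp
next
  case False
  then have "bump l r m x = 0" for x by auto
  then show ?thesis using False by simp
qed

lemma Gamma_duplication_real:
  fixes z :: real
  assumes "z > 0"
  shows "Gamma z * Gamma (z + 1/2) = 2 powr (1 - 2 * z) * sqrt pi * Gamma (2 * z)"
proof -
  have nz: "complex_of_real x \<notin> \<int>\<^sub>\<le>\<^sub>0" if "x > 0" for x
    using that by (auto elim!: nonpos_Ints_cases simp: complex_eq_iff)
  have e: "exp ((1 - 2 * complex_of_real z) * complex_of_real (ln 2)) = complex_of_real (2 powr (1 - 2 * z))"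
    by (simp add: powr_def exp_of_real[symmetric])
  have h: "complex_of_real z + 1/2 = complex_of_real (z + 1/2)" "2 * complex_of_real z = complex_of_real (2 * z)"
    by simp_all
  have "Gamma (complex_of_real z) * Gamma (complex_of_real (z + 1/2)) =
     complex_of_real (2 powr (1 - 2 * z)) * complex_of_real (sqrt pi) * Gamma (complex_of_real (2 * z))"
    using Gamma_legendre_duplication[of "complex_of_real z"] nz[of z] nz[of "z + 1/2"] assms
    unfolding h e[unfolded h] by simp
  then have "complex_of_real (Gamma z * Gamma (z + 1/2)) =
     complex_of_real (2 powr (1 - 2 * z) * sqrt pi * Gamma (2 * z))"
    unfolding Gamma_complex_of_real by (simp only: of_real_mult)
  then show ?thesis by (simp only: of_real_eq_iff)
qed

text \<open>The form of the duplication formula in which the power of two, coming from the length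
  \<open>2 q\<close> of an interval, disappears. Factors \<open>Beta (1/2) z\<close> with shifted
  \<open>z\<close> telescope later.\<close>

lemma Beta_duplication:
  assumes "z > 0"
  shows "2 powr (2 * z - 1) * Beta z z = Beta (1/2) (z :: real)"
proof -
  define P where "P = (2 powr (2 * z - 1) :: real)"
  define a b c where "a = Gamma z" "b = Gamma (z + 1/2)" "c = Gamma (2 * z)"
  have pos: "a > 0" "b > 0" "c > 0" "P > 0"
    using assms by (auto simp: a_b_c_def P_def intro!: Gamma_real_pos)
  have "P * 2 powr (1 - 2 * z) = 1" unfolding P_def by (simp add: powr_add[symmetric])
  moreover have "a * b = 2 powr (1 - 2 * z) * sqrt pi * c"
    using Gamma_duplication_real[OF assms] by (simp add: a_b_c_def)
  ultimately have "P * (a * b) = sqrt pi * c" by (simp add: mult.assoc[symmetric])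
  then have "P * (a * a / c) = sqrt pi * a / b" using pos by (simp add: field_simps)
  then show ?thesis
    unfolding Beta_def P_def[symmetric] Gamma_one_half_real add.commute[of "1/2"] mult_2[symmetric]
      a_b_c_def[symmetric] by simp
qed

text \<open>The base of the power is positive exactly on an interval of half-length
  \<open>sqrt (\<beta> / \<kappa>)\<close> around \<open>v\<close>, where the integrand is
  \<open>\<kappa> powr m\<close> times \<open>bump\<close>.\<close>

lemma nn_integral_quadratic:
  fixes \<beta> \<kappa> m v :: real
  assumes m: "m > -1" and k: "\<kappa> > 0"
  shows "(\<integral>\<^sup>+x. (if \<beta> - \<kappa> * (x - v)\<^sup>2 > 0 then ennreal ((\<beta> - \<kappa> * (x - v)\<^sup>2) powr m) else 0) \<partial>lborel) =
    (if \<beta> > 0 then ennreal (\<beta> powr (m + 1/2) * \<kappa> powr (- 1/2) * Beta (1/2) (m + 1)) else 0)"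
proof (cases "\<beta> > 0")
  case True
  define q where "q = sqrt (\<beta> / \<kappa>)"
  have q: "q > 0" "q * q = \<beta> / \<kappa>" using True k by (auto simp: q_def)
  define l r where "l = v - q" "r = v + q"
  have f: "\<beta> - \<kappa> * (x - v)\<^sup>2 = \<kappa> * ((x - l) * (r - x))" for x
  proof -
    have "\<kappa> * ((x - l) * (r - x)) = \<kappa> * (q * q) - \<kappa> * (x - v)\<^sup>2"
      by (simp add: l_r_def power2_eq_square algebra_simps)
    then show ?thesis using k q(2) by simp
  qed
  have pos: "\<kappa> * ((x - l) * (r - x)) > 0 \<longleftrightarrow> l < x \<and> x < r" for x
    using k q(1) by (auto simp: zero_less_mult_iff l_r_def)
  have "(\<integral>\<^sup>+x. (if \<beta> - \<kappa> * (x - v)\<^sup>2 > 0 then ennreal ((\<beta> - \<kappa> * (x - v)\<^sup>2) powr m) else 0) \<partial>lborel)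
     = (\<integral>\<^sup>+x. ennreal (\<kappa> powr m) * bump l r m x \<partial>lborel)"
    unfolding f pos using k by (intro nn_integral_cong) (auto simp: powr_mult ennreal_mult)
  also have "\<dots> = ennreal (\<kappa> powr m) * (\<integral>\<^sup>+x. bump l r m x \<partial>lborel)"
    by (rule nn_integral_cmult) simp
  also have "\<dots> = ennreal (\<kappa> powr m * ((r - l) powr (2 * m + 1) * Beta (m + 1) (m + 1)))"
    using m q(1) by (subst nn_integral_sym_beta) (auto simp: l_r_def ennreal_mult')
  also have "\<kappa> powr m * ((r - l) powr (2 * m + 1) * Beta (m + 1) (m + 1)) =
     \<beta> powr (m + 1/2) * \<kappa> powr (- 1/2) * Beta (1/2) (m + 1)"
  proof -
    have "(r - l) powr (2 * m + 1) = 2 powr (2 * m + 1) * q powr (2 * m + 1)"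
      using q(1) by (simp add: l_r_def powr_mult[symmetric])
    also have "q powr (2 * m + 1) = (\<beta> / \<kappa>) powr (m + 1/2)"
      using True k by (simp add: q_def powr_half_sqrt[symmetric] powr_powr algebra_simps add_divide_distrib)
    also have "\<dots> = \<beta> powr (m + 1/2) * \<kappa> powr (- m - 1/2)"
    proof -
      have e: "- m - 1/2 = - (m + 1/2)" by simp
      have "(\<beta> / \<kappa>) powr a = \<beta> powr a * \<kappa> powr (- a)" for a
        using True k powr_divide[of \<beta> \<kappa> a] by (simp only: powr_minus divide_inverse[symmetric] less_imp_le)
      then show ?thesis unfolding e .
    qed
    also have "2 powr (2 * m + 1) * (\<beta> powr (m + 1/2) * \<kappa> powr (- m - 1/2)) * Beta (m + 1) (m + 1) =
        (\<beta> powr (m + 1/2) * \<kappa> powr (- m - 1/2)) * Beta (1/2) (m + 1)"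
      using Beta_duplication[of "m + 1"] m by (simp add: algebra_simps)
    finally have "\<kappa> powr m * ((r - l) powr (2 * m + 1) * Beta (m + 1) (m + 1)) =
        (\<kappa> powr m * \<kappa> powr (- m - 1/2)) * \<beta> powr (m + 1/2) * Beta (1/2) (m + 1)"
      by (simp add: mult_ac)
    also have "\<kappa> powr m * \<kappa> powr (- m - 1/2) = \<kappa> powr (- 1/2)" by (simp add: powr_add[symmetric])
    finally show ?thesis by (simp add: mult_ac)
  qed
  finally show ?thesis using True by simp
next
  case False
  have "\<not> \<beta> - \<kappa> * (x - v)\<^sup>2 > 0" for x using False k by (smt (verit) mult_nonneg_nonneg zero_le_power2)
  then show ?thesis using False by simp
qed

abbreviation pd_power :: "'a list \<Rightarrow> real \<Rightarrow> 'a kernel \<Rightarrow> ennreal" where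
  "pd_power xs m A \<equiv> (if pd xs A then ennreal (pdet xs A powr m) else 0)"

lemma measurable_pd_power:
  assumes "\<And>i j. (\<lambda>w. A w i j) \<in> borel_measurable M"
  shows "(\<lambda>w. pd_power xs m (A w)) \<in> borel_measurable M"
proof -
  note [measurable] = measurable_pd[of A M xs, OF assms] measurable_pdet[of A M xs, OF assms]
  show ?thesis by measurable
qed

lemma measurable_coord: "(\<lambda>x. x i) \<in> borel_measurable fun_space"
  using measurable_component_singleton[of i UNIV "\<lambda>_. lborel :: real measure"] by simp

text \<open>Each inner coordinate contributes half a power of the current pivot. The coordinate
  outside \<open>d\<close> others therefore meets the exponent \<open>m + d / 2\<close>, whence the
  argument of \<open>Beta\<close>.\<close>

fun row_const :: "nat \<Rightarrow> real \<Rightarrow> real" where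
  "row_const 0 m = 1"
| "row_const (Suc d) m = row_const d m * Beta (1/2) (m + d / 2 + 1)"

lemma Beta_nonneg: "a > 0 \<Longrightarrow> b > 0 \<Longrightarrow> Beta a (b :: real) \<ge> 0"
  by (simp add: Beta_def Gamma_real_pos less_imp_le)

lemma row_const_nonneg: "m > -1 \<Longrightarrow> row_const d m \<ge> 0"
  by (induction d) (auto intro!: mult_nonneg_nonneg Beta_nonneg)

text \<open>Sherman-Morrison for one elimination step: a rank-one correction stays rank one. The
  vector becomes the residual of \<open>u\<close> after regression on the index \<open>b\<close>,
  and the coefficient grows by the ratio of the uncorrected to the corrected pivot.\<close>

lemma schur_rank_one:
  fixes B :: "'a kernel"
  assumes "symm B" "B b b - \<kappa> * u b ^ 2 > 0" "\<kappa> > 0"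
  shows "schur b (\<lambda>i j. B i j - \<kappa> * u i * u j) i j =
    schur b B i j - (\<kappa> * B b b / (B b b - \<kappa> * u b ^ 2)) *
      (u i - B i b * u b / B b b) * (u j - B j b * u b / B b b)"
proof -
  define \<beta> where "\<beta> = B b b"
  define t where "t = \<beta> - \<kappa> * u b * u b"
  have t: "t > 0" using assms(2) by (simp add: t_def \<beta>_def power2_eq_square mult.assoc)
  have \<beta>: "\<beta> = t + \<kappa> * u b * u b" by (simp add: t_def)
  have bp: "\<beta> > 0" using t assms(3) unfolding \<beta> by (simp add: add_pos_nonneg mult.assoc)
  have s: "B b j = B j b" by (rule symmD[OF assms(1)])
  define p q where "p = B i b" "q = B j b"
  have e: "\<beta> - \<kappa> * (u b)\<^sup>2 = t" by (simp add: t_def power2_eq_square)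
  have "(p - \<kappa> * u i * u b) * (q - \<kappa> * u b * u j) / t - p * q / \<beta> - \<kappa> * \<beta> / t * (u i - p * u b / \<beta>) * (u j - q * u b / \<beta>)
      + \<kappa> * u i * u j = 0"
  proof -
    have "t * \<beta> * ((p - \<kappa> * u i * u b) * (q - \<kappa> * u b * u j) / t - p * q / \<beta> - \<kappa> * \<beta> / t * (u i - p * u b / \<beta>) * (u j - q * u b / \<beta>)
      + \<kappa> * u i * u j) = \<beta> * ((p - \<kappa> * u i * u b) * (q - \<kappa> * u b * u j)) - t * (p * q)
       - \<kappa> * (\<beta> * u i - p * u b) * (\<beta> * u j - q * u b) + t * \<beta> * (\<kappa> * u i * u j)"
      using t bp by (simp add: field_simps)
    also have "\<dots> = 0" unfolding t_def by (simp add: algebra_simps)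
    finally show ?thesis using t bp by simp
  qed
  then show ?thesis
    unfolding schur_def s \<beta>_def[symmetric] p_q_def[symmetric] e t_def[symmetric] by simp
qed

text \<open>Once the first coordinate of the vector is fixed, eliminating its index leaves by
  \<open>schur_rank_one\<close> an integral of the same type with new \<open>B\<close>,
  \<open>\<kappa>\<close> and centre \<open>v\<close>, so the induction generalizes over these. This
  replaces a substitution by the matrix square root of \<open>B\<close>.\<close>

lemma iterint_row:
  fixes c :: "'a \<Rightarrow> 'i" and B :: "'a kernel"
  assumes "distinct js" "inj_on c (set js)" "symm B" "\<kappa> > 0" "m > -1"
  shows "iterint (map c js) (\<lambda>x. pd_power js m (\<lambda>i j. B i j - \<kappa> * (x (c i) - v i) * (x (c j) - v j))) x0 =
    (if pd js B then ennreal (\<kappa> powr (- real (length js) / 2) * pdet js B powr (m + 1/2) * row_const (length js) m) else 0)"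
  using assms
proof (induction js arbitrary: B \<kappa> v x0)
  case Nil
  then show ?case by simp
next
  case (Cons b js)
  define d where "d = length js"
  define \<beta> where "\<beta> = B b b"
  define B' where "B' = schur b B"
  define tt where "tt = (\<lambda>t. \<beta> - \<kappa> * (t - v b)\<^sup>2)"
  define \<kappa>' where "\<kappa>' = (\<lambda>t. \<kappa> * \<beta> / tt t)"
  define v' where "v' = (\<lambda>t i. v i + B i b * (t - v b) / \<beta>)"
  define M where "M = (\<lambda>x i j. B i j - \<kappa> * (x (c i) - v i) * (x (c j) - v j))"
  define M' where "M' = (\<lambda>t x i j. B' i j - \<kappa>' t * (x (c i) - v' t i) * (x (c j) - v' t j))"
  define E where "E = \<kappa> powr (- real d / 2) * \<beta> powr (- real d / 2) * pdet js B' powr (m + 1/2) * row_const d m"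
  let ?q = "\<lambda>t. if tt t > 0 then ennreal (tt t powr (m + d / 2)) else 0"
  let ?I = "\<lambda>t. iterint (map c js) (\<lambda>x. pd_power (b # js) m (M x)) (x0(c b := t))"
  let ?I' = "\<lambda>t. iterint (map c js) (\<lambda>x. pd_power js m (M' t x)) (x0(c b := t))"
  have Epos: "E \<ge> 0" unfolding E_def using row_const_nonneg[of m d] Cons.prems(5) by simp
  note symB' = symm_schur[OF Cons.prems(3), of b, folded B'_def]
  have inner: "?I t
     = (if pd js B' then ennreal E else 0) * ?q t" for t
  proof (cases "tt t > 0")
    case True
    have bp: "\<beta> > 0" using True Cons.prems(4) by (auto simp: tt_def intro: order.strict_trans2[of _ "\<kappa> * (t - v b)\<^sup>2"])
       (smt (verit) mult_nonneg_nonneg zero_le_power2)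
    have k': "\<kappa>' t > 0" using bp True Cons.prems(4) by (simp add: \<kappa>'_def)
    have "?I t
      = iterint (map c js) (\<lambda>x. ennreal (tt t powr m) * pd_power js m (M' t x)) (x0(c b := t))"
    proof (rule iterint_cong)
      fix x assume "\<And>i. i \<notin> set (map c js) \<Longrightarrow> x i = (x0(c b := t)) i"
      moreover have "c b \<notin> set (map c js)" using Cons.prems(1,2) by (auto simp: inj_on_def)
      ultimately have xb: "x (c b) = t" by auto
      have Mbb: "M x b b = tt t" by (simp add: M_def tt_def \<beta>_def xb power2_eq_square)
      have "schur b (M x) = M' t x"
      proof (intro ext)
        fix i j
        show "schur b (M x) i j = M' t x i j"
          unfolding M_def M'_def B'_def using True Cons.prems(3,4)
          by (subst schur_rank_one) (auto simp: \<kappa>'_def v'_def tt_def xb \<beta>_def algebra_simps)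
      qed
      then show "pd_power (b # js) m (M x) =
          ennreal (tt t powr m) * pd_power js m (M' t x)"
        using True pdet_pos[of js "M' t x"] by (simp add: Mbb powr_mult ennreal_mult)
    qed
    also have "\<dots> = ennreal (tt t powr m) * ?I' t"
      by (intro iterint_cmult measurable_pd_power) (auto simp: M'_def intro!: borel_measurable_diff borel_measurable_times measurable_coord)
    also have "?I' t
       = (if pd js B' then ennreal (\<kappa>' t powr (- real d / 2) * pdet js B' powr (m + 1/2) * row_const d m) else 0)"
      unfolding M'_def d_def using Cons.prems k' symB' by (intro Cons.IH) auto
    \<comment> \<open>Here the new coefficient turns into the extra power \<open>d / 2\<close> of
      the pivot \<open>tt t\<close>.\<close>
    also have "\<kappa>' t powr (- real d / 2) = \<kappa> powr (- real d / 2) * \<beta> powr (- real d / 2) * tt t powr (real d / 2)"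
    proof -
      have "inverse (tt t) powr (- real d / 2) = tt t powr (real d / 2)"
        using True by (simp add: powr_minus[symmetric] inverse_powr[symmetric] del: inverse_powr) (simp add: powr_minus inverse_powr)
      then show ?thesis using True bp Cons.prems(4) unfolding \<kappa>'_def divide_inverse[of "\<kappa> * \<beta>"]
        by (simp add: powr_mult)
    qed
    also have "ennreal (tt t powr m) * (if pd js B' then ennreal (\<kappa> powr (- real d / 2) * \<beta> powr (- real d / 2) * tt t powr (real d / 2) *
         pdet js B' powr (m + 1/2) * row_const d m) else 0) =
         (if pd js B' then ennreal E else 0) * ennreal (tt t powr (m + d / 2))"
      using Epos row_const_nonneg[of m d] Cons.prems(5) unfolding E_def
      by (simp add: ennreal_mult'[symmetric] powr_add mult_ac)
    finally show ?thesis using True by (simp only: if_True)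
  next
    case False
    have "?I t
      = iterint (map c js) (\<lambda>x. 0) (x0(c b := t))"
    proof (rule iterint_cong)
      fix x assume "\<And>i. i \<notin> set (map c js) \<Longrightarrow> x i = (x0(c b := t)) i"
      moreover have "c b \<notin> set (map c js)" using Cons.prems(1,2) by (auto simp: inj_on_def)
      ultimately have xb: "x (c b) = t" by auto
      have Mbb: "M x b b = tt t" by (simp add: M_def tt_def \<beta>_def xb power2_eq_square)
      then show "pd_power (b # js) m (M x) = 0"
        using False by simp
    qed
    then show ?thesis using False by (simp add: iterint_zero)
  qed
  have md: "m + real d / 2 > -1" using Cons.prems(5) by (smt (verit) divide_nonneg_nonneg of_nat_0_le_iff)
  have "iterint (map c (b # js)) (\<lambda>x. pd_power (b # js) m (M x)) x0
     = (\<integral>\<^sup>+t. (if pd js B' then ennreal E else 0) * ?q t \<partial>lborel)"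
    unfolding list.map iterint.simps inner ..
  also have "\<dots> = (if pd js B' then ennreal E else 0) * (\<integral>\<^sup>+t. ?q t \<partial>lborel)"
    unfolding tt_def by (rule nn_integral_cmult) measurable
  also have "(\<integral>\<^sup>+t. ?q t \<partial>lborel) =
     (if \<beta> > 0 then ennreal (\<beta> powr (m + d / 2 + 1/2) * \<kappa> powr (- 1/2) * Beta (1/2) (m + d / 2 + 1)) else 0)"
    unfolding tt_def by (rule nn_integral_quadratic[OF md Cons.prems(4)])
  also have "(if pd js B' then ennreal E else 0) * \<dots> = (if pd (b # js) B then
      ennreal (\<kappa> powr (- real (length (b # js)) / 2) * pdet (b # js) B powr (m + 1/2) * row_const (length (b # js)) m) else 0)"
  proof (cases "pd (b # js) B")
    case True
    then have p: "\<beta> > 0" "pd js B'" by (auto simp: \<beta>_def B'_def)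
    have e1: "\<beta> powr (- real d / 2) * \<beta> powr (m + d / 2 + 1/2) = \<beta> powr (m + 1/2)"
      using p by (simp add: powr_add[symmetric])
    have ed: "- real d / 2 + - 1/2 = - real (Suc d) / 2" by (simp add: add_divide_distrib diff_divide_distrib)
    have e2: "\<kappa> powr (- real d / 2) * \<kappa> powr (- 1/2) = \<kappa> powr (- real (Suc d) / 2)"
      unfolding powr_add[symmetric] ed ..
    have e3: "pdet (b # js) B powr (m + 1/2) = \<beta> powr (m + 1/2) * pdet js B' powr (m + 1/2)"
      by (simp add: \<beta>_def B'_def powr_mult)
    have "E * (\<beta> powr (m + d / 2 + 1/2) * \<kappa> powr (- 1/2) * Beta (1/2) (m + d / 2 + 1)) =
      (\<kappa> powr (- real d / 2) * \<kappa> powr (- 1/2)) * ((\<beta> powr (- real d / 2) * \<beta> powr (m + d / 2 + 1/2)) *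
        pdet js B' powr (m + 1/2)) * (row_const d m * Beta (1/2) (m + d / 2 + 1))"
      unfolding E_def by (simp only: mult_ac)
    then have "E * (\<beta> powr (m + d / 2 + 1/2) * \<kappa> powr (- 1/2) * Beta (1/2) (m + d / 2 + 1)) =
      \<kappa> powr (- real (length (b # js)) / 2) * pdet (b # js) B powr (m + 1/2) * row_const (length (b # js)) m"
      unfolding e1 e2 e3[symmetric] row_const.simps[symmetric] by (simp only: list.size d_def add_Suc_right add_0_right)
    moreover have "ennreal E * ennreal (\<beta> powr (m + d / 2 + 1/2) * \<kappa> powr (- 1/2) * Beta (1/2) (m + d / 2 + 1)) =
       ennreal (E * (\<beta> powr (m + d / 2 + 1/2) * \<kappa> powr (- 1/2) * Beta (1/2) (m + d / 2 + 1)))"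
      using Epos by (simp only: ennreal_mult')
    ultimately show ?thesis using True p by (simp only: if_True)
  next
    case False
    then show ?thesis by (auto simp: \<beta>_def B'_def)
  qed
  finally show ?case unfolding M_def .
qed

section \<open>The matrix-variate beta integral\<close>

text \<open>Row by row, with the diagonal entry of a row outermost and later rows innermost: while
  the inner rows are integrated, the row of the eliminated index is fixed.\<close>

fun tri :: "('a \<Rightarrow> 'a \<Rightarrow> 'i) \<Rightarrow> 'a list \<Rightarrow> 'i list" where
  "tri c [] = []"
| "tri c (a # js) = map (c a) (a # js) @ tri c js"

lemma set_tri: "set (tri c js) \<subseteq> {c i j | i j. i \<in> set js \<and> j \<in> set js}"
proof (induction js)
  case (Cons a js)
  then have "\<And>x. x \<in> set (tri c js) \<Longrightarrow> \<exists>i j. x = c i j \<and> i \<in> set js \<and> j \<in> set js" by blast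
  then show ?case by fastforce
qed simp

definition beta_weight :: "'a list \<Rightarrow> real \<Rightarrow> 'a kernel \<Rightarrow> 'a kernel \<Rightarrow> ennreal" where
  "beta_weight js s Y Z = (if pd js Y \<and> pd js Z then ennreal ((pdet js Y * pdet js Z) powr s) else 0)"

lemma measurable_beta_weight:
  assumes "\<And>i j. (\<lambda>w. Y w i j) \<in> borel_measurable M" "\<And>i j. (\<lambda>w. Z w i j) \<in> borel_measurable M"
  shows "(\<lambda>w. beta_weight js s (Y w) (Z w)) \<in> borel_measurable M"
proof -
  note [measurable] = measurable_pd[of Y M js, OF assms(1)] measurable_pdet[of Y M js, OF assms(1)]
    measurable_pd[of Z M js, OF assms(2)] measurable_pdet[of Z M js, OF assms(2)]
  show ?thesis unfolding beta_weight_def by measurable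
qed

lemma beta_weight_cong:
  assumes "\<And>i j. i \<in> set js \<Longrightarrow> j \<in> set js \<Longrightarrow> Y i j = Y' i j"
    "\<And>i j. i \<in> set js \<Longrightarrow> j \<in> set js \<Longrightarrow> Z i j = Z' i j"
  shows "beta_weight js s Y Z = beta_weight js s Y' Z'"
  unfolding beta_weight_def using pd_cong[of js Y Y'] pd_cong[of js Z Z'] pdet_cong[of js Y Y'] pdet_cong[of js Z Z'] assms
  by presburger

text \<open>The factors of a step come from the other \<open>d\<close> rows, from the off-diagonal
  entries of the first row, where the determinant already carries the exponent
  \<open>2 * s + (d + 1) / 2\<close>, and from its diagonal entry with exponent
  \<open>s + d / 2\<close>.\<close>

fun beta_const :: "nat \<Rightarrow> real \<Rightarrow> real" where
  "beta_const 0 s = 1"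
| "beta_const (Suc d) s = beta_const d s * row_const d (2 * s + (d + 1) / 2) * Beta (s + d / 2 + 1) (s + d / 2 + 1)"

lemma beta_const_nonneg: "s > - 1/2 \<Longrightarrow> beta_const d s \<ge> 0"
proof (induction d)
  case (Suc d)
  have "2 * s + (real d + 1) / 2 > -1" "s + real d / 2 + 1 > 0" using Suc.prems by (simp_all add: field_simps)
  then show ?case using Suc row_const_nonneg Beta_nonneg by (simp add: add.commute)
qed simp

text \<open>Only ordered index pairs are read, so the matrix is symmetric for every
  \<open>x\<close>, whatever \<open>x\<close> holds elsewhere.\<close>

definition symm_coord :: "('a :: linorder \<Rightarrow> 'a \<Rightarrow> 'i) \<Rightarrow> ('i \<Rightarrow> real) \<Rightarrow> 'a \<Rightarrow> 'a \<Rightarrow> real" where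
  "symm_coord c x i j = x (c (min i j) (max i j))"

lemma symm_symm_coord: "symm (symm_coord c x)"
  by (simp add: symm_def symm_coord_def min.commute max.commute)

text \<open>Completing the square: the rank-one corrections in the Schur complements of \<open>X - D\<close> and \<open>A - X\<close>
  add up to that of \<open>A - D\<close> plus a rank-one term centred at a weighted mean of \<open>D\<close> and \<open>A\<close>.\<close>
lemma parallel_sum:
  fixes \<alpha> \<gamma> :: real
  assumes "\<alpha> > 0" "\<gamma> > 0"
  shows "(z - d) * (w - e) / \<alpha> + (a - z) * (b - w) / \<gamma> =
    (a - d) * (b - e) / (\<alpha> + \<gamma>) +
    (\<alpha> + \<gamma>) / (\<alpha> * \<gamma>) * (z - (\<gamma> * d + \<alpha> * a) / (\<alpha> + \<gamma>)) * (w - (\<gamma> * e + \<alpha> * b) / (\<alpha> + \<gamma>))"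
proof -
  have nz: "\<alpha> + \<gamma> > 0" "\<alpha> * \<gamma> > 0" using assms by auto
  define \<sigma> where "\<sigma> = \<alpha> + \<gamma>"
  have "(z - d) * (w - e) / \<alpha> + (a - z) * (b - w) / \<gamma> = ((z - d) * (w - e) * \<gamma> + (a - z) * (b - w) * \<alpha>) / (\<alpha> * \<gamma>)"
    using assms by (simp add: field_simps)
  also have "\<dots> = (\<sigma> * ((z - d) * (w - e) * \<gamma> + (a - z) * (b - w) * \<alpha>)) / (\<sigma> * (\<alpha> * \<gamma>))"
    using nz by (simp add: \<sigma>_def)
  also have "\<sigma> * ((z - d) * (w - e) * \<gamma> + (a - z) * (b - w) * \<alpha>) =
     \<alpha> * \<gamma> * ((a - d) * (b - e)) + (\<sigma> * z - (\<gamma> * d + \<alpha> * a)) * (\<sigma> * w - (\<gamma> * e + \<alpha> * b))"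
    unfolding \<sigma>_def by (simp add: algebra_simps)
  also have "\<dots> / (\<sigma> * (\<alpha> * \<gamma>)) = (a - d) * (b - e) / \<sigma> +
     \<sigma> / (\<alpha> * \<gamma>) * (z - (\<gamma> * d + \<alpha> * a) / \<sigma>) * (w - (\<gamma> * e + \<alpha> * b) / \<sigma>)"
    using assms nz unfolding \<sigma>_def[symmetric] by (simp add: field_simps)
  finally show ?thesis unfolding \<sigma>_def .
qed

abbreviation gap_weight ::
  "('a :: linorder \<Rightarrow> 'a \<Rightarrow> 'i) \<Rightarrow> 'a list \<Rightarrow> real \<Rightarrow> 'a kernel \<Rightarrow> 'a kernel \<Rightarrow> ('i \<Rightarrow> real) \<Rightarrow> ennreal" where
  "gap_weight c js s D A x \<equiv>
    beta_weight js s (\<lambda>i j. symm_coord c x i j - D i j) (\<lambda>i j. A i j - symm_coord c x i j)"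

text \<open>Eliminating the first index from \<open>X - D\<close> and from \<open>A - X\<close>
  gives the same problem for the other rows, with bounds \<open>D'\<close> and \<open>A'\<close>
  that depend on the first row. By \<open>parallel_sum\<close> the new gap \<open>A' - D'\<close> is
  the Schur complement of \<open>A - D\<close> minus a rank-one term in that row, so
  \<open>iterint_row\<close> integrates the row. The diagonal entry is left with a one-dimensional
  symmetric beta integral.\<close>

lemma iterint_beta:
  fixes c :: "'a :: linorder \<Rightarrow> 'a \<Rightarrow> 'i" and A D :: "'a kernel"
  assumes "sorted_wrt (<) js" "inj (\<lambda>(i, j). c i j)" "symm A" "symm D" "s > - 1/2"
  shows "iterint (tri c js) (\<lambda>x. gap_weight c js s D A x) x0 =
    (if pd js (\<lambda>i j. A i j - D i j) then ennreal (beta_const (length js) s *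
        pdet js (\<lambda>i j. A i j - D i j) powr (2 * s + (real (length js) + 1) / 2)) else 0)"
  using assms
proof (induction js arbitrary: A D x0)
  case Nil
  then show ?case by (simp add: beta_weight_def)
next
  case (Cons a js)
  have ajs: "\<And>j. j \<in> set js \<Longrightarrow> a < j" and sjs: "sorted_wrt (<) js" using Cons.prems by auto
  have cinj: "c i j = c i' j' \<longleftrightarrow> i = i' \<and> j = j'" for i j i' j'
    using Cons.prems(2) by (auto simp: inj_def)
  define d where "d = length js"
  define \<delta> where "\<delta> = A a a - D a a"
  define lo where "lo = (\<lambda>t. t - D a a)"
  define hi where "hi = (\<lambda>t. A a a - t)"
  define X where "X = symm_coord c"
  define D' where "D' = (\<lambda>x i j. D i j + (x (c a i) - D i a) * (x (c a j) - D a j) / lo (x (c a a)))"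
  define A' where "A' = (\<lambda>x i j. A i j - (A i a - x (c a i)) * (A a j - x (c a j)) / hi (x (c a a)))"
  define B where "B = schur a (\<lambda>i j. A i j - D i j)"
  define \<kappa> where "\<kappa> = (\<lambda>t. \<delta> / (lo t * hi t))"
  define v where "v = (\<lambda>t i. (hi t * D i a + lo t * A i a) / \<delta>)"
  define m where "m = 2 * s + (real d + 1) / 2"
  define K where "K = beta_const d s"
  define M where "M = (\<lambda>t x i j. B i j - \<kappa> t * (x (c a i) - v t i) * (x (c a j) - v t j))"
  have K0: "K \<ge> 0" unfolding K_def by (rule beta_const_nonneg[OF Cons.prems(5)])
  have m1: "m > -1" unfolding m_def using Cons.prems(5) by (simp add: field_simps)
  have symD: "D i j = D j i" and symA: "A i j = A j i" for i j
    using Cons.prems(3,4) by (auto dest: symmD)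
  have symmD': "symm (D' x)" and symmA': "symm (A' x)" for x
    by (auto simp: symm_def D'_def A'_def symD symA mult.commute)
  have symmB: "symm B" unfolding B_def by (rule symm_schur) (auto simp: symm_def symD symA)
  have lohi: "lo t + hi t = \<delta>" for t by (simp add: lo_def hi_def \<delta>_def)
  let ?w = "\<lambda>js x. beta_weight js s (\<lambda>i j. X x i j - D i j) (\<lambda>i j. A i j - X x i j)"
  have Xa: "X x a j = x (c a j)" "X x j a = x (c a j)" if "j \<in> set js" for x j
    using less_imp_le[OF ajs[OF that]] by (simp_all add: X_def symm_coord_def min_absorb1 min_absorb2 max_absorb1 max_absorb2)
  have Xaa: "X x a a = x (c a a)" for x by (simp add: X_def symm_coord_def)
  have A'D': "A' x i j - D' x i j = M (x (c a a)) x i j" if p: "lo (x (c a a)) > 0" "hi (x (c a a)) > 0" for x i j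
    using parallel_sum[OF p, of "x (c a i)" "D i a" "x (c a j)" "D a j" "A i a" "A a j"]
    unfolding A'_def D'_def M_def B_def schur_def \<kappa>_def v_def lohi \<delta>_def[symmetric]
    by (simp add: symD[of a j] symA[of a j] algebra_simps)
  have inner: "iterint (tri c js) (?w (a # js)) x =
     (if lo (x (c a a)) > 0 \<and> hi (x (c a a)) > 0 then
        ennreal ((lo (x (c a a)) * hi (x (c a a))) powr s) * (ennreal K *
       pd_power js m (M (x (c a a)) x)) else 0)" for x
  proof -
    define t where "t = x (c a a)"
    let ?e = "if lo t > 0 \<and> hi t > 0 then ennreal ((lo t * hi t) powr s) else 0"
    \<comment> \<open>Integrating the inner rows leaves the first row alone, because
      \<open>c\<close> is injective and \<open>a\<close> is smaller than all of
      \<open>js\<close>.\<close>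
    have ag: "y (c a j) = x (c a j)" if "\<And>i. i \<notin> set (tri c js) \<Longrightarrow> y i = x i" for y j
    proof -
      have "c a j \<notin> set (tri c js)"
      proof
        assume "c a j \<in> set (tri c js)"
        then obtain i' j' where "c a j = c i' j'" "i' \<in> set js" using set_tri[of c js] by blast
        then show False using ajs[of i'] by (simp add: cinj)
      qed
      then show ?thesis by (rule that)
    qed
    have "iterint (tri c js) (?w (a # js)) x = iterint (tri c js) (\<lambda>y.
       ?e *
         gap_weight c js s (D' x) (A' x) y) x"
    proof (rule iterint_cong)
      fix y assume y: "\<And>i. i \<notin> set (tri c js) \<Longrightarrow> y i = x i"
      note yx = ag[OF y]
      have e1: "schur a (\<lambda>i j. X y i j - D i j) i j = X y i j - D' x i j"
        and e2: "schur a (\<lambda>i j. A i j - X y i j) i j = A' x i j - X y i j" if "i \<in> set js" "j \<in> set js" for i j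
        using that by (simp_all add: schur_def Xa Xaa yx D'_def A'_def lo_def hi_def)
      let ?Y = "schur a (\<lambda>i j. X y i j - D i j)" and ?Z = "schur a (\<lambda>i j. A i j - X y i j)"
      have "?w (a # js) y = ?e * beta_weight js s ?Y ?Z"
      proof (cases "lo t > 0 \<and> hi t > 0 \<and> pd js ?Y \<and> pd js ?Z")
        case True
        have e: "(lo t * pdet js ?Y) * (hi t * pdet js ?Z) = (lo t * hi t) * (pdet js ?Y * pdet js ?Z)"
          by (simp only: mult_ac)
        have "ennreal (((lo t * pdet js ?Y) * (hi t * pdet js ?Z)) powr s) =
          ennreal ((lo t * hi t) powr s) * ennreal ((pdet js ?Y * pdet js ?Z) powr s)"
          unfolding e powr_mult[of "lo t * hi t"] by (rule ennreal_mult) auto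
        moreover have "X y a a - D a a = lo t" "A a a - X y a a = hi t"
          by (simp_all add: Xaa yx t_def lo_def hi_def)
        ultimately show ?thesis using True
          by (simp only: beta_weight_def pd.simps pdet.simps if_True simp_thms)
      next
        case False
        then show ?thesis by (auto simp: beta_weight_def Xaa yx t_def[symmetric] lo_def hi_def)
      qed
      also have "beta_weight js s ?Y ?Z = beta_weight js s (\<lambda>i j. X y i j - D' x i j) (\<lambda>i j. A' x i j - X y i j)"
        by (rule beta_weight_cong) (auto simp: e1 e2)
      finally show "?w (a # js) y = ?e *
         gap_weight c js s (D' x) (A' x) y"
        unfolding X_def .
    qed
    also have "\<dots> = ?e *
       iterint (tri c js) (\<lambda>y. gap_weight c js s (D' x) (A' x) y) x"
      by (intro iterint_cmult measurable_beta_weight)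
        (auto simp: symm_coord_def intro!: borel_measurable_diff measurable_coord)
    also have "\<dots> = (if lo t > 0 \<and> hi t > 0 then ennreal ((lo t * hi t) powr s) * (ennreal K *
       pd_power js m (M t x)) else 0)"
    proof (cases "lo t > 0 \<and> hi t > 0")
      case True
      have "(\<lambda>i j. A' x i j - D' x i j) = M t x"
        using A'D'[of x] True by (auto simp: fun_eq_iff t_def)
      then show ?thesis using True K0
        by (simp add: Cons.IH[OF sjs Cons.prems(2) symmA' symmD' Cons.prems(5)] K_def d_def m_def ennreal_mult' add.commute)
    next
      case False
      then show ?thesis by auto
    qed
    finally show ?thesis unfolding t_def .
  qed
  define E where "E = K * (pdet js B powr (m + 1/2) * row_const d m)"
  have R0: "row_const d m \<ge> 0" by (rule row_const_nonneg[OF m1])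
  have E0: "E \<ge> 0" unfolding E_def using K0 R0 by simp
  let ?R = "\<lambda>t. iterint (map (c a) js) (iterint (tri c js) (?w (a # js))) (x0(c a a := t))"
  let ?S = "\<lambda>t. iterint (map (c a) js) (\<lambda>x. pd_power js m (M t x)) (x0(c a a := t))"
  have row: "?R t =
     (if pd js B then ennreal (E * \<delta> powr (- real d / 2)) else 0) *
       bump (D a a) (A a a) (s + d / 2) t" for t
  proof (cases "lo t > 0 \<and> hi t > 0")
    case True
    have dpos: "\<delta> > 0" using True lohi[of t] by linarith
    have kpos: "\<kappa> t > 0" unfolding \<kappa>_def using True dpos by simp
    have nin: "c a a \<notin> set (map (c a) js)" by (auto simp: cinj dest: ajs)
    have "?R t =
      iterint (map (c a) js) (\<lambda>x. (ennreal ((lo t * hi t) powr s) * ennreal K) *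
        pd_power js m (M t x)) (x0(c a a := t))"
    proof (rule iterint_cong)
      fix x assume "\<And>i. i \<notin> set (map (c a) js) \<Longrightarrow> x i = (x0(c a a := t)) i"
      from this[OF nin] have "x (c a a) = t" by simp
      then show "iterint (tri c js) (?w (a # js)) x = (ennreal ((lo t * hi t) powr s) * ennreal K) *
        pd_power js m (M t x)"
        unfolding inner using True by (simp add: mult.assoc)
    qed
    also have "\<dots> = (ennreal ((lo t * hi t) powr s) * ennreal K) *
       ?S t"
      by (intro iterint_cmult measurable_pd_power) (auto simp: M_def intro!: borel_measurable_diff borel_measurable_times measurable_coord)
    also have "?S t
      = (if pd js B then ennreal (\<kappa> t powr (- real d / 2) * pdet js B powr (m + 1/2) * row_const d m) else 0)"
      unfolding M_def d_def using sjs kpos m1 symmB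
      by (intro iterint_row) (auto simp: strict_sorted_iff inj_on_def cinj)
    \<comment> \<open>\<open>\<kappa> t\<close> is \<open>\<delta>\<close> over the product of the
      two pivots, so this power adds \<open>d / 2\<close> to the exponent of that product.\<close>
    also have "\<kappa> t powr (- real d / 2) = \<delta> powr (- real d / 2) * (lo t * hi t) powr (d / 2)"
    proof -
      have e: "x powr (- real d / 2) = inverse (x powr (real d / 2))" for x :: real
        by (simp add: powr_minus[symmetric])
      show ?thesis unfolding \<kappa>_def e powr_divide[of \<delta> "lo t * hi t"]
        by (simp only: divide_inverse inverse_mult_distrib inverse_inverse_eq)
    qed
    also have "(ennreal ((lo t * hi t) powr s) * ennreal K) *
      (if pd js B then ennreal (\<delta> powr (- real d / 2) * (lo t * hi t) powr (d / 2) * pdet js B powr (m + 1/2) * row_const d m) else 0) =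
      (if pd js B then ennreal (E * \<delta> powr (- real d / 2)) else 0) * ennreal ((lo t * hi t) powr (s + d / 2))"
      using K0 R0 unfolding E_def by (simp add: ennreal_mult'[symmetric] powr_add mult_ac)
    finally show ?thesis using True by (simp add: lo_def hi_def del: fun_upd_apply)
  next
    case False
    have nin: "c a a \<notin> set (map (c a) js)" by (auto simp: cinj dest: ajs)
    have "?R t =
      iterint (map (c a) js) (\<lambda>x. 0) (x0(c a a := t))"
    proof (rule iterint_cong)
      fix x assume "\<And>i. i \<notin> set (map (c a) js) \<Longrightarrow> x i = (x0(c a a := t)) i"
      from this[OF nin] have xt: "x (c a a) = t" by simp
      show "iterint (tri c js) (?w (a # js)) x = 0"
        unfolding inner xt if_not_P[OF False] by (rule refl)
    qed
    then show ?thesis using False by (auto simp: iterint_zero lo_def hi_def)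
  qed
  have sd: "s + real d / 2 > -1" using Cons.prems(5) by (simp add: field_simps)
  have "iterint (tri c (a # js)) (?w (a # js)) x0 =
     (\<integral>\<^sup>+t. (if pd js B then ennreal (E * \<delta> powr (- real d / 2)) else 0) *
       bump (D a a) (A a a) (s + d / 2) t \<partial>lborel)"
    unfolding tri.simps list.map append.simps iterint.simps iterint_append row ..
  also have "\<dots> = (if pd js B then ennreal (E * \<delta> powr (- real d / 2)) else 0) *
     (\<integral>\<^sup>+t. bump (D a a) (A a a) (s + d / 2) t \<partial>lborel)"
    by (rule nn_integral_cmult) measurable
  also have "\<dots> = (if pd js B then ennreal (E * \<delta> powr (- real d / 2)) else 0) *
     (if D a a < A a a then ennreal (\<delta> powr (2 * (s + d / 2) + 1) * Beta (s + d / 2 + 1) (s + d / 2 + 1)) else 0)"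
    unfolding nn_integral_sym_beta[OF sd] \<delta>_def ..
  also have "\<dots> = (if pd (a # js) (\<lambda>i j. A i j - D i j) then ennreal (beta_const (length (a # js)) s *
        pdet (a # js) (\<lambda>i j. A i j - D i j) powr (2 * s + (real (length (a # js)) + 1) / 2)) else 0)"
  proof (cases "pd (a # js) (\<lambda>i j. A i j - D i j)")
    case True
    then have p: "\<delta> > 0" "pd js B" by (auto simp: \<delta>_def B_def)
    define b where "b = 2 * s + (real (length (a # js)) + 1) / 2"
    have ed: "- real d / 2 + (2 * (s + d / 2) + 1) = b" by (simp add: b_def d_def add_divide_distrib)
    have e1: "\<delta> powr (- real d / 2) * \<delta> powr (2 * (s + d / 2) + 1) = \<delta> powr b"
      unfolding powr_add[symmetric] ed ..
    have e2: "m + 1/2 = b" by (simp add: m_def b_def d_def add_divide_distrib)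
    have e3: "pdet (a # js) (\<lambda>i j. A i j - D i j) powr b = \<delta> powr b * pdet js B powr b"
      by (simp add: \<delta>_def B_def powr_mult)
    have e4: "beta_const (length (a # js)) s = K * row_const d m * Beta (s + d / 2 + 1) (s + d / 2 + 1)"
      by (simp add: K_def d_def m_def add.commute)
    have "E * \<delta> powr (- real d / 2) * (\<delta> powr (2 * (s + d / 2) + 1) * Beta (s + d / 2 + 1) (s + d / 2 + 1)) =
      (K * row_const d m * Beta (s + d / 2 + 1) (s + d / 2 + 1)) *
        ((\<delta> powr (- real d / 2) * \<delta> powr (2 * (s + d / 2) + 1)) * pdet js B powr b)"
      unfolding E_def e2 by (simp only: mult_ac)
    then have "E * \<delta> powr (- real d / 2) * (\<delta> powr (2 * (s + d / 2) + 1) * Beta (s + d / 2 + 1) (s + d / 2 + 1)) =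
      beta_const (length (a # js)) s * pdet (a # js) (\<lambda>i j. A i j - D i j) powr b"
      unfolding e1 e3 e4 .
    moreover have "ennreal (E * \<delta> powr (- real d / 2)) * ennreal (\<delta> powr (2 * (s + d / 2) + 1) * Beta (s + d / 2 + 1) (s + d / 2 + 1)) =
      ennreal (E * \<delta> powr (- real d / 2) * (\<delta> powr (2 * (s + d / 2) + 1) * Beta (s + d / 2 + 1) (s + d / 2 + 1)))"
      using E0 by (intro ennreal_mult'[symmetric]) simp
    moreover have "D a a < A a a" using p by (simp add: \<delta>_def)
    ultimately show ?thesis using True p unfolding b_def[symmetric] by (simp only: if_True)
  next
    case False
    then show ?thesis by (auto simp: B_def)
  qed
  finally show ?case unfolding X_def .
qed

section \<open>Block Toeplitz matrices of Chebyshev moments\<close>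

text \<open>\<open>Beta (1/2) (m + d / 2 + 1)\<close> is \<open>sqrt pi\<close> times a quotient of
  Gamma values half a unit apart, so the product telescopes.\<close>

lemma row_const_eq:
  assumes "m > -1"
  shows "row_const d m = pi powr (d / 2) * Gamma (m + 1) / Gamma (m + d / 2 + 1)"
proof (induction d)
  case 0
  have "Gamma (m + 1) > 0" using assms by (intro Gamma_real_pos) simp
  then show ?case by simp
next
  case (Suc d)
  have p: "Gamma (m + d / 2 + 1) > 0" using assms by (intro Gamma_real_pos) (smt (verit) divide_nonneg_nonneg of_nat_0_le_iff)
  have e: "1/2 + (m + real d / 2 + 1) = m + real (Suc d) / 2 + 1" by (simp add: add_divide_distrib)
  have "row_const (Suc d) m = pi powr (d / 2) * Gamma (m + 1) / Gamma (m + d / 2 + 1) *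
      (sqrt pi * Gamma (m + d / 2 + 1) / Gamma (m + real (Suc d) / 2 + 1))"
    unfolding row_const.simps Suc.IH Beta_def Gamma_one_half_real e ..
  also have "\<dots> = (pi powr (d / 2) * sqrt pi) * Gamma (m + 1) / Gamma (m + real (Suc d) / 2 + 1)"
    using p by simp
  also have "pi powr (d / 2) * sqrt pi = pi powr (real (Suc d) / 2)"
    by (simp add: powr_half_sqrt[symmetric] powr_add[symmetric] add_divide_distrib add.commute)
  finally show ?case .
qed

lemma multi_gamma_Suc:
  "multi_gamma (Suc d) a = pi powr (d / 2) * Gamma a * multi_gamma d (a - 1/2)"
proof -
  have e: "real (Suc d) * (real (Suc d) - 1) / 4 = d / 2 + real d * (real d - 1) / 4"
    by (simp add: field_simps)
  have "(\<Prod>i=1..Suc d. Gamma (a - (real i - 1) / 2)) = Gamma a * (\<Prod>i=2..Suc d. Gamma (a - (real i - 1) / 2))"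
    by (subst prod.atLeast_Suc_atMost) (auto simp: numeral_2_eq_2)
  also have "(\<Prod>i=2..Suc d. Gamma (a - (real i - 1) / 2)) = (\<Prod>i=1..d. Gamma (a - 1/2 - (real i - 1) / 2))"
    unfolding numeral_2_eq_2 One_nat_def prod.shift_bounds_cl_Suc_ivl
    by (intro prod.cong refl arg_cong[where f = Gamma]) (simp add: field_simps)
  finally show ?thesis unfolding multi_gamma_def e powr_add by simp
qed

text \<open>The Gamma arguments descend in steps of 1/2, so a shift by 1/2 exchanges only the
  factors at the two ends.\<close>

lemma multi_gamma_shift:
  "multi_gamma d (b + 1/2) * Gamma (b + 1/2 - d / 2) = multi_gamma d b * Gamma (b + 1/2)"
proof -
  have "(\<Prod>i=1..d. Gamma (b + 1/2 - (real i - 1) / 2)) * Gamma (b + 1/2 - d / 2) =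
      (\<Prod>i=1..d. Gamma (b - (real i - 1) / 2)) * Gamma (b + 1/2)"
  proof (induction d)
    case (Suc d)
    have e: "b - (real (Suc d) - 1) / 2 = b - d / 2" "b + 1/2 - (real (Suc d) - 1) / 2 = b + 1/2 - d / 2"
      "b + 1/2 - real (Suc d) / 2 = b - d / 2"
      by (simp_all add: add_divide_distrib)
    have i1: "1 \<le> Suc d" by simp
    show ?case unfolding prod.nat_ivl_Suc'[OF i1] e using Suc.IH by (simp only: mult_ac)
  qed simp
  then show ?thesis unfolding multi_gamma_def by (simp add: mult.assoc)
qed

lemma multi_gamma_pos:
  assumes "a > (real d - 1) / 2"
  shows "multi_gamma d a > 0"
proof -
  have "Gamma (a - (real i - 1) / 2) > 0" if "i \<in> {1..d}" for i
  proof (rule Gamma_real_pos)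
    have "(real i - 1) / 2 \<le> (real d - 1) / 2" using that by (intro divide_right_mono) auto
    then show "a - (real i - 1) / 2 > 0" using assms by linarith
  qed
  then show ?thesis unfolding multi_gamma_def by (intro mult_pos_pos prod_pos) auto
qed

lemma beta_const_eq:
  assumes "s \<ge> 0"
  shows "beta_const d s = multi_beta d (s + (real d + 1) / 2) (s + (real d + 1) / 2)"
proof (induction d)
  case 0
  show ?case by (simp add: multi_beta_def multi_gamma_def)
next
  case (Suc d)
  define a where "a = s + (real (Suc d) + 1) / 2"
  have A: "a = s + real d / 2 + 1" unfolding a_def by (simp add: add_divide_distrib)
  have a1: "s + (real d + 1) / 2 = a - 1/2" "2 * s + (real d + 1) / 2 + 1 = 2 * a - 1/2 - d / 2"
    "2 * s + (real d + 1) / 2 + d / 2 + 1 = 2 * a - 1/2" "s + d / 2 + 1 = a"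
    unfolding A by (simp_all add: add_divide_distrib)
  define M N where "M = multi_gamma d (a - 1/2)" and "N = multi_gamma d (2 * a - 1)"
  define N' where "N' = multi_gamma d (2 * a - 1/2)"
  define g h k where "g = Gamma a" and "h = Gamma (2 * a)" and "k = Gamma (2 * a - 1/2)"
  define l where "l = Gamma (2 * a - 1/2 - d / 2)"
  define q where "q = pi powr (d / 2)"
  have d0: "real d \<ge> 0" by simp
  have d2: "real d / 2 \<ge> 0" "(real d - 1) / 2 = real d / 2 - 1/2" by (simp_all add: diff_divide_distrib)
  have pos: "M > 0" "N > 0" "N' > 0"
    unfolding M_def N_def N'_def using assms d2 by (intro multi_gamma_pos; simp add: A)+
  have pos2: "g > 0" "k > 0" "l > 0" "h > 0"
    unfolding g_def k_def l_def h_def using assms d2(1) by (intro Gamma_real_pos; simp add: A)+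
  have q0: "q > 0" by (simp add: q_def)
  \<comment> \<open>The Gamma quotient of \<open>row_const\<close> turns
    \<open>multi_gamma d (2 * a - 1)\<close> into the value at \<open>2 * a - 1/2\<close> that the
    recursion \<open>multi_gamma_Suc\<close> asks for.\<close>
  have shift: "N' * l = N * k"
    using multi_gamma_shift[of d "2 * a - 1"] unfolding N'_def N_def k_def l_def by simp
  have "2 * s + (real d + 1) / 2 > -1" using assms by (simp add: field_simps)
  from row_const_eq[OF this, of d]
  have row: "row_const d (2 * s + (real d + 1) / 2) = q * l / k"
    unfolding a1 q_def l_def k_def .
  have IH: "beta_const d s = M * M / N"
  proof -
    have e: "a - 1/2 + (a - 1/2) = 2 * a - 1" by simp
    show ?thesis unfolding Suc.IH a1 multi_beta_def M_def N_def e ..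
  qed
  have "beta_const (Suc d) s = M * M / N * (q * l / k) * (g * g / h)"
    unfolding beta_const.simps IH by (simp only: of_nat_add of_nat_1 row a1 Beta_def g_def h_def mult_2[of a])
  also have "\<dots> = (q * g * M) * (q * g * M) / (q * h * N')"
  proof -
    have "M * M / N * (q * l / k) * (g * g / h) = (M * M * q * g * g / h) * (l / (N * k))"
      by (simp only: times_divide_eq_left times_divide_eq_right divide_divide_eq_left mult_ac)
    also have "l / (N * k) = 1 / N'" unfolding shift[symmetric] using pos pos2 by simp
    also have "(M * M * q * g * g / h) * (1 / N') = (q * (M * M * q * g * g)) / (q * (h * N'))"
      using q0 by simp
    finally show ?thesis by (simp only: mult_ac)
  qed
  also have "\<dots> = multi_beta (Suc d) a a"
    unfolding multi_beta_def multi_gamma_Suc q_def g_def M_def h_def N'_def mult_2[symmetric] ..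
  finally show ?case unfolding a_def .
qed

section \<open>Toeplitz blocks of a moment sequence and the interval of the next moment\<close>

type_synonym moments = "nat \<times> nat \<times> nat \<Rightarrow> real"

text \<open>\<open>cheb k\<close> is \<open>2 T\<^sub>k(2x - 1)\<close>, that is \<open>z\<^sup>k + z\<^sup>-\<^sup>k\<close> for \<open>4x = z + 2 + 1/z\<close>.\<close>
fun cheb :: "nat \<Rightarrow> real poly" where
  "cheb 0 = [:2:]"
| "cheb (Suc 0) = [:-2, 4:]"
| "cheb (Suc (Suc k)) = [:-2, 4:] * cheb (Suc k) - cheb k"

lemma degree_cheb: "degree (cheb k) \<le> k"
proof (induction k rule: cheb.induct)
  case (3 k)
  have "degree ([:-2, 4:] * cheb (Suc k)) \<le> 1 + Suc k"
    by (rule order.trans[OF degree_mult_le]) (use 3 in auto)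
  then show ?case using 3(2) by (auto intro!: degree_diff_le)
qed auto

text \<open>This is the rate at which a corner block of the Toeplitz matrix moves with the newest
  moment, and the source of every \<open>4 ^ N\<close> below. Order 0 is exceptional because
  \<open>cheb 0\<close> is 2.\<close>

lemma coeff_cheb: "k \<ge> 1 \<Longrightarrow> coeff (cheb k) k = 4 ^ k"
proof (induction k rule: cheb.induct)
  case (3 k)
  have "coeff (cheb k) (Suc (Suc k)) = 0" "coeff (cheb (Suc k)) (Suc (Suc k)) = 0"
    using degree_cheb[of k] degree_cheb[of "Suc k"] by (auto intro!: coeff_eq_0)
  then show ?case using 3(1) by simp
qed auto

lemma poly_cheb: "poly (cheb k) ((1 + cos t) / 2) = 2 * cos (real k * t)"
proof (induction k rule: cheb.induct)
  case (3 k)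
  have "2 * cos t * cos (real (Suc k) * t) = cos (real (Suc (Suc k)) * t) + cos (real k * t)"
  proof -
    have e: "real (Suc (Suc k)) * t = real (Suc k) * t + t" "real k * t = real (Suc k) * t - t"
      by (simp_all add: algebra_simps)
    show ?thesis unfolding e cos_add cos_diff by simp
  qed
  moreover have "poly [:-2, 4:] ((1 + cos t) / 2) = 2 * cos t"
  proof -
    have "poly [:-2, 4:] ((1 + cos t) / 2) = 4 * ((1 + cos t) / 2) - 2" by simp
    also have "\<dots> = 2 * cos t" by (simp add: add_divide_distrib)
    finally show ?thesis .
  qed
  ultimately show ?case using 3 by (simp only: cheb.simps poly_diff poly_mult)
qed (auto simp: add_divide_distrib)

text \<open>Order 0 is the identity by the normalization of the measure, so \<open>x\<close>
  supplies the orders from 1 on.\<close>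

definition mom :: "moments \<Rightarrow> nat \<Rightarrow> nat \<Rightarrow> nat \<Rightarrow> real" where
  "mom x k i j = (if k = 0 then if i = j then 1 else 0 else symm_coord (\<lambda>i j. (k, i, j)) x i j)"

text \<open>For the moments of a measure this is the integral of \<open>2 cos (b t)\<close>, with
  the variable of integration written as \<open>(1 + cos t) / 2\<close>.\<close>

definition cmom :: "moments \<Rightarrow> nat \<Rightarrow> nat \<Rightarrow> nat \<Rightarrow> real" where
  "cmom x b i j = (\<Sum>k\<le>b. coeff (cheb b) k * mom x k i j)"

definition toep :: "moments \<Rightarrow> int \<times> nat \<Rightarrow> int \<times> nat \<Rightarrow> real" where
  "toep x u w = cmom x (nat \<bar>fst u - fst w\<bar>) (snd u) (snd w)"

text \<open>The block indices are integers, so that shifts and reflections preserve \<open>toep x\<close> everywhere.\<close>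
definition blocks :: "nat \<Rightarrow> int list \<Rightarrow> (int \<times> nat) list" where
  "blocks p bs = concat (map (\<lambda>b. map (Pair b) [0..<p]) bs)"

abbreviation tblocks :: "nat \<Rightarrow> nat \<Rightarrow> (int \<times> nat) list" where
  "tblocks p N \<equiv> blocks p (map int [0..<N])"

definition tpos :: "nat \<Rightarrow> nat \<Rightarrow> moments \<Rightarrow> bool" where
  "tpos p N x = pd (tblocks p N) (toep x)"

definition tdet :: "nat \<Rightarrow> nat \<Rightarrow> moments \<Rightarrow> real" where
  "tdet p N x = pdet (tblocks p N) (toep x)"

definition mids :: "nat \<Rightarrow> nat \<Rightarrow> (int \<times> nat) list" where
  "mids p N = blocks p (map int [1..<N])"

text \<open>\<open>slice\<close> and \<open>cross\<close> are the blocks \<open>L\<close> and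
  \<open>E\<close> that remain at the outer block indices \<open>0\<close> and \<open>N\<close> once
  the middle ones are eliminated.\<close>

definition slice :: "nat \<Rightarrow> nat \<Rightarrow> moments \<Rightarrow> nat \<Rightarrow> nat \<Rightarrow> real" where
  "slice p N x i j = schurs (mids p N) (toep x) (0, i) (0, j)"

definition cross :: "nat \<Rightarrow> nat \<Rightarrow> moments \<Rightarrow> nat \<Rightarrow> nat \<Rightarrow> real" where
  "cross p N x i j = schurs (mids p N) (toep x) (0, i) (int N, j)"

text \<open>The end points of the matrix interval of admissible moments of order \<open>N\<close>, given those of order
  less than \<open>N\<close>; neither depends on \<open>mom x N\<close>. The determinant of its length is \<open>wgt p (N - 1) x\<close>.\<close>
definition low :: "nat \<Rightarrow> nat \<Rightarrow> moments \<Rightarrow> nat \<Rightarrow> nat \<Rightarrow> real" where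
  "low p N x i j = mom x N i j - (slice p N x i j + cross p N x i j) / 4 ^ N"

definition upp :: "nat \<Rightarrow> nat \<Rightarrow> moments \<Rightarrow> nat \<Rightarrow> nat \<Rightarrow> real" where
  "upp p N x i j = low p N x i j + 2 * slice p N x i j / 4 ^ N"

definition wgt :: "nat \<Rightarrow> nat \<Rightarrow> moments \<Rightarrow> real" where
  "wgt p n x = (2 / 4 ^ Suc n) ^ p * tdet p (Suc n) x / tdet p n x"

lemma symm_mom: "mom x k i j = mom x k j i"
  by (auto simp: mom_def symmD[OF symm_symm_coord])

lemma symm_toep: "symm (toep x)"
  unfolding symm_def toep_def cmom_def
  by (metis (no_types, lifting) abs_minus_commute sum.cong symm_mom)

lemma blocks_append: "blocks p (as @ bs) = blocks p as @ blocks p bs"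
  by (simp add: blocks_def)

lemma set_blocks: "set (blocks p bs) = set bs \<times> {..<p}"
  by (auto simp: blocks_def)

lemma mset_blocks: "mset as = mset bs \<Longrightarrow> mset (blocks p as) = mset (blocks p bs)"
proof -
  have "mset (blocks p as) = sum_mset (image_mset (\<lambda>b. mset (map (Pair b) [0..<p])) (mset as))" for as
    unfolding blocks_def by (induction as) auto
  then show "mset as = mset bs \<Longrightarrow> mset (blocks p as) = mset (blocks p bs)" by simp
qed

lemma blocks_map: "blocks p (map f bs) = map (\<lambda>(b, i). (f b, i)) (blocks p bs)"
  by (simp add: blocks_def map_concat comp_def)

lemma toep_shift: "toep x (case u of (b, i) \<Rightarrow> (b + k, i)) (case w of (b, i) \<Rightarrow> (b + k, i)) = toep x u w"
  by (cases u, cases w) (simp add: toep_def)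

lemma toep_refl: "toep x (case u of (b, i) \<Rightarrow> (k - b, i)) (case w of (b, i) \<Rightarrow> (k - b, i)) = toep x u w"
  by (cases u, cases w) (simp add: toep_def abs_minus_commute)

lemma mids_eq:
  assumes "N \<ge> 1"
  shows "mids p N = map (\<lambda>(b, i). (b + 1, i)) (blocks p (map int [0..<N - 1]))"
proof -
  have "[1..<N] = map Suc [0..<N - 1]" using assms by (simp add: map_Suc_upt)
  then have "map int [1..<N] = map (\<lambda>b. b + 1) (map int [0..<N - 1])" by (simp add: comp_def add.commute)
  then show ?thesis unfolding mids_def by (simp only: blocks_map)
qed

lemma pd_mids:
  assumes "N \<ge> 1"
  shows "pd (mids p N) (toep x) = tpos p (N - 1) x"
  unfolding mids_eq[OF assms] tpos_def pd_map toep_shift ..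

lemma pdet_mids:
  assumes "N \<ge> 1"
  shows "pdet (mids p N) (toep x) = tdet p (N - 1) x"
  unfolding mids_eq[OF assms] tdet_def pdet_map toep_shift ..

text \<open>The reversal of \<open>b\<close> to \<open>N - b\<close> preserves \<open>toep\<close>
  and permutes the middle blocks among themselves, and elimination does not depend on the
  order.\<close>

lemma schurs_reflect:
  assumes "pd (mids p N) (toep x)"
  shows "schurs (mids p N) (toep x) (int N - b, i) (int N - c, j) = schurs (mids p N) (toep x) (b, i) (c, j)"
proof -
  let ?f = "\<lambda>(b, i). (int N - b, i :: nat)"
  have "(\<lambda>b. int N - b) ` int ` {1..<N} = int ` {1..<N}"
  proof (intro equalityI subsetI)
    fix y assume "y \<in> (\<lambda>b. int N - b) ` int ` {1..<N}"
    then obtain k where "k \<in> {1..<N}" "y = int N - int k" by blast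
    then have "y = int (N - k)" "N - k \<in> {1..<N}" by auto
    then show "y \<in> int ` {1..<N}" by blast
  next
    fix y assume "y \<in> int ` {1..<N}"
    then obtain k where "k \<in> {1..<N}" "y = int k" by blast
    then have "y = int N - int (N - k)" "N - k \<in> {1..<N}" by auto
    then show "y \<in> (\<lambda>b. int N - b) ` int ` {1..<N}" by blast
  qed
  then have "set (map (\<lambda>b. int N - b) (map int [1..<N])) = set (map int [1..<N])"
    by (simp only: set_map set_upt)
  moreover have "distinct (map (\<lambda>b. int N - b) (map int [1..<N]))" "distinct (map int [1..<N])"
    by (simp_all add: distinct_map inj_on_def)
  ultimately have m0: "mset (map int [1..<N]) = mset (map (\<lambda>b. int N - b) (map int [1..<N]))"
    by (simp only: set_eq_iff_mset_eq_distinct)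
  have m: "mset (mids p N) = mset (map ?f (mids p N))"
    unfolding mids_def blocks_map[of p "\<lambda>b. int N - b" "map int [1..<N]", symmetric]
    by (rule mset_blocks[OF m0])
  have "schurs (mids p N) (toep x) (?f (b, i)) (?f (c, j)) = schurs (map ?f (mids p N)) (toep x) (?f (b, i)) (?f (c, j))"
    by (rule perm_invariant(3)[OF symm_toep m assms, THEN fun_cong, THEN fun_cong])
  also have "\<dots> = schurs (mids p N) (toep x) (b, i) (c, j)"
    unfolding schurs_map toep_refl ..
  finally show ?thesis by simp
qed

text \<open>Elimination subtracts from the entry at \<open>u\<close>, \<open>w\<close> a correction
  built only from entries with an index in \<open>xs\<close>. Kernels that agree on those have the
  same correction even if their entries at \<open>u\<close>, \<open>w\<close> differ; this isolates
  the influence of the newest moment.\<close>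

lemma schurs_diff_cong:
  assumes "\<And>a b. a \<in> set xs \<Longrightarrow> b \<in> J \<Longrightarrow> A a b = A' a b \<and> A b a = A' b a" "set xs \<subseteq> J"
    "u \<in> J" "w \<in> J"
  shows "schurs xs A u w - A u w = schurs xs A' u w - A' u w"
  using assms
proof (induction xs arbitrary: A A')
  case (Cons x xs)
  have "schurs xs (schur x A) u w - schur x A u w = schurs xs (schur x A') u w - schur x A' u w"
  proof (rule Cons.IH)
    fix a b assume ab: "a \<in> set xs" "b \<in> J"
    have x: "x \<in> set (x # xs)" "a \<in> set (x # xs)" "a \<in> J" "x \<in> J" using ab Cons.prems(2) by auto
    note e = Cons.prems(1)[OF x(2) ab(2)] Cons.prems(1)[OF x(1) ab(2)] Cons.prems(1)[OF x(1) x(3)]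
      Cons.prems(1)[OF x(1) x(4)]
    show "schur x A a b = schur x A' a b \<and> schur x A b a = schur x A' b a" unfolding schur_def by (simp only: e)
  next
    show "set xs \<subseteq> J" using Cons.prems(2) by simp
  qed fact+
  moreover have "schur x A u w - A u w = schur x A' u w - A' u w"
  proof -
    have x: "x \<in> set (x # xs)" "x \<in> J" using Cons.prems(2) by auto
    show ?thesis unfolding schur_def
      using Cons.prems(1)[OF x(1) Cons.prems(3)] Cons.prems(1)[OF x(1) Cons.prems(4)] Cons.prems(1)[OF x] by simp
  qed
  ultimately show ?case unfolding schurs.simps by linarith
qed simp

lemma upt_split: "N \<ge> 1 \<Longrightarrow> [0..<N] = 0 # [1..<N]"
  by (simp add: upt_rec)

lemma mset_first: "N \<ge> 1 \<Longrightarrow> mset (tblocks p N) = mset (mids p N @ blocks p [0])"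
  unfolding mids_def blocks_append[symmetric] by (rule mset_blocks) (simp add: upt_split)

lemma blocks_Suc: "tblocks p (Suc N) = tblocks p N @ blocks p [int N]"
  by (simp add: blocks_append)

lemma blocks_single: "blocks p [b] = map (Pair b) [0..<p]"
  by (simp add: blocks_def)

lemma mset_pairs: "mset (interleave a b is) = mset (map a is @ map b is)"
  by (induction "is") auto

lemma tpos_pred: "tpos p (Suc N) x \<Longrightarrow> tpos p N x"
  unfolding tpos_def blocks_Suc by (simp add: pd_append)

lemma tpos_split:
  assumes "N \<ge> 1"
  shows "tpos p N x \<longleftrightarrow> tpos p (N - 1) x \<and> pd [0..<p] (slice p N x)"
    and "tpos p N x \<Longrightarrow> tdet p N x = tdet p (N - 1) x * pdet [0..<p] (slice p N x)"
proof -
  have s: "(\<lambda>i j. schurs (mids p N) (toep x) (0, i) (0, j)) = slice p N x"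
    by (simp add: slice_def fun_eq_iff)
  note P = perm_invariant[OF symm_toep[of x] mset_first[OF assms, of p]]
  show "tpos p N x \<longleftrightarrow> tpos p (N - 1) x \<and> pd [0..<p] (slice p N x)"
    using P(1) unfolding pd_append pd_mids[OF assms] blocks_single pd_map s tpos_def[of p N] .
  show "tdet p N x = tdet p (N - 1) x * pdet [0..<p] (slice p N x)" if "tpos p N x"
    using P(2) that unfolding pdet_append pdet_mids[OF assms] blocks_single pdet_map s tpos_def[of p N] tdet_def[of p N] .
qed

lemma reflect_slice:
  assumes "pd (mids p N) (toep x)"
  shows "schurs (mids p N) (toep x) (int N, i) (int N, j) = slice p N x i j"
    and "schurs (mids p N) (toep x) (int N, i) (0, j) = cross p N x i j"
  using schurs_reflect[OF assms, of 0 i 0 j] schurs_reflect[OF assms, of 0 i "int N" j]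
  unfolding slice_def cross_def by simp_all

abbreviation slice_plus where
  "slice_plus p N x \<equiv> \<lambda>i j. slice p N x i j + cross p N x i j"

abbreviation slice_minus where
  "slice_minus p N x \<equiv> \<lambda>i j. slice p N x i j - cross p N x i j"

text \<open>With the middle blocks eliminated first, the two outer blocks form the pattern of
  \<open>pd_pair_block\<close>; for this reason they are listed interleaved.\<close>

lemma tpos_Suc_split:
  assumes "N \<ge> 1"
  shows "tpos p (Suc N) x \<longleftrightarrow> tpos p (N - 1) x \<and>
      pd [0..<p] (slice_plus p N x) \<and> pd [0..<p] (slice_minus p N x)" (is ?pos)
    and "tpos p (Suc N) x \<Longrightarrow> tdet p (Suc N) x = tdet p (N - 1) x *
      (pdet [0..<p] (slice_plus p N x) * pdet [0..<p] (slice_minus p N x))" (is "_ \<Longrightarrow> ?det")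
proof -
  define S where "S = schurs (mids p N) (toep x)"
  define q where "q = interleave (Pair 0) (Pair (int N)) [0..<p]"
  have m: "mset (tblocks p (Suc N)) = mset (mids p N @ q)"
  proof -
    have "mset (tblocks p (Suc N)) = mset (mids p N @ blocks p [0]) + mset (blocks p [int N])"
      unfolding blocks_Suc mset_append mset_first[OF assms] ..
    also have "\<dots> = mset (mids p N @ q)"
      unfolding q_def blocks_single mset_append mset_pairs[of "Pair 0" "Pair (int N)"] by (simp add: add.assoc)
    finally show ?thesis .
  qed
  note P = perm_invariant[OF symm_toep[of x] m]
  have *: "pd q S \<longleftrightarrow> pd [0..<p] (slice_plus p N x) \<and> pd [0..<p] (slice_minus p N x)"
    "pd q S \<longrightarrow> pdet q S = pdet [0..<p] (slice_plus p N x) * pdet [0..<p] (slice_minus p N x)"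
    if "pd (mids p N) (toep x)"
    using pd_pair_block[of S "Pair 0" "slice p N x" "Pair (int N)" "cross p N x" "[0..<p]"]
      reflect_slice[OF that] unfolding q_def S_def by (simp_all add: slice_def cross_def)
  show ?pos
    using P(1) * unfolding pd_append S_def[symmetric] tpos_def[of p "Suc N"] pd_mids[OF assms, symmetric] by blast
  show ?det
    if t: "tpos p (Suc N) x"
  proof -
    have "pd (mids p N) (toep x) \<and> pd q S" using P(1) t unfolding pd_append S_def[symmetric] tpos_def[of p "Suc N"] by blast
    then show ?thesis using P(2) t * unfolding pdet_append S_def[symmetric] tpos_def[of p "Suc N"] tdet_def[of p "Suc N"] pdet_mids[OF assms, symmetric]
      by presburger
  qed
qed

lemma symm_slice: "symm (slice p N x)"
  unfolding symm_def slice_def using symmD[OF symm_schurs[OF symm_toep]] by blast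

text \<open>Transposition exchanges the outer blocks and reflection exchanges them back.\<close>

lemma symm_cross:
  assumes "pd (mids p N) (toep x)"
  shows "symm (cross p N x)"
  unfolding symm_def
proof (intro allI)
  fix i j
  have "cross p N x i j = schurs (mids p N) (toep x) (int N, j) (0, i)"
    unfolding cross_def by (rule symmD[OF symm_schurs[OF symm_toep]])
  also have "\<dots> = cross p N x j i" by (rule reflect_slice(2)[OF assms])
  finally show "cross p N x i j = cross p N x j i" .
qed

lemma symm_low:
  assumes "N \<ge> 1" "tpos p (N - 1) x"
  shows "symm (low p N x)" "symm (upp p N x)"
proof -
  have c: "cross p N x i j = cross p N x j i" and s: "slice p N x i j = slice p N x j i" for i j
    using symm_cross[of p N x] symm_slice[of p N x] assms pd_mids[of N p x] by (auto dest: symmD)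
  show 1: "symm (low p N x)" unfolding symm_def low_def
    by (intro allI) (metis c s symm_mom)
  show "symm (upp p N x)" unfolding symm_def upp_def
    by (intro allI) (metis s symmD[OF 1])
qed

lemma low_diff:
  "mom x N i j - low p N x i j = (1 / 4 ^ N) * (slice p N x i j + cross p N x i j)"
  "upp p N x i j - mom x N i j = (1 / 4 ^ N) * (slice p N x i j - cross p N x i j)"
  "upp p N x i j - low p N x i j = (2 / 4 ^ N) * slice p N x i j"
  unfolding upp_def low_def by (simp_all add: field_simps)

text \<open>Up to the factor \<open>1 / 4 ^ N\<close>, the distances of the new moment from the ends
  of its interval are \<open>L + E\<close> and \<open>L - E\<close>.\<close>

lemma tpos_step:
  assumes "N \<ge> 1"
  shows "tpos p (Suc N) x \<longleftrightarrow> tpos p N x \<and> pd [0..<p] (\<lambda>i j. mom x N i j - low p N x i j) \<and>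
     pd [0..<p] (\<lambda>i j. upp p N x i j - mom x N i j)"
proof -
  have c: "(1 :: real) / 4 ^ N > 0" by simp
  show ?thesis unfolding low_diff pd_scale[OF c]
    using tpos_pred[of p N x] tpos_Suc_split(1)[OF assms, of p x] tpos_split(1)[OF assms, of p x] by blast
qed

lemma tdet_pos: "tpos p N x \<Longrightarrow> tdet p N x > 0"
  unfolding tpos_def tdet_def by (rule pdet_pos)

lemma wgt_pos: "tpos p (Suc n) x \<Longrightarrow> wgt p n x > 0"
  unfolding wgt_def using tdet_pos[of p "Suc n" x] tdet_pos[of p n x] tpos_pred[of p n x] by simp

lemma upp_low:
  assumes "N \<ge> 1" "tpos p N x"
  shows "pd [0..<p] (\<lambda>i j. upp p N x i j - low p N x i j)"
    "pdet [0..<p] (\<lambda>i j. upp p N x i j - low p N x i j) = wgt p (N - 1) x"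
proof -
  have c: "(2 :: real) / 4 ^ N > 0" by simp
  show "pd [0..<p] (\<lambda>i j. upp p N x i j - low p N x i j)"
    unfolding low_diff pd_scale[OF c] using tpos_split(1)[OF assms(1)] assms(2) by blast
  have "tpos p (N - 1) x" using tpos_split(1)[OF assms(1)] assms(2) by blast
  then have "tdet p (N - 1) x \<noteq> 0" using tdet_pos by fastforce
  then show "pdet [0..<p] (\<lambda>i j. upp p N x i j - low p N x i j) = wgt p (N - 1) x"
    unfolding low_diff pdet_scale[OF c] wgt_def using tpos_split(2)[OF assms] assms(1) by simp
qed

lemma wgt_step:
  assumes "N \<ge> 1" "tpos p (Suc N) x"
  shows "wgt p N x = pdet [0..<p] (\<lambda>i j. mom x N i j - low p N x i j) *
     pdet [0..<p] (\<lambda>i j. upp p N x i j - mom x N i j) / wgt p (N - 1) x"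
proof -
  have c: "(1 :: real) / 4 ^ N > 0" by simp
  define a b where "a = pdet [0..<p] (slice_plus p N x)"
    and "b = pdet [0..<p] (slice_minus p N x)"
  define l where "l = pdet [0..<p] (slice p N x)"
  define g where "g = tdet p (N - 1) x"
  have t: "tpos p N x" using tpos_pred assms(2) .
  then have g: "g > 0" unfolding g_def using tdet_pos tpos_split(1)[OF assms(1)] by blast
  have l: "l > 0" unfolding l_def using pdet_pos tpos_split(1)[OF assms(1)] t by blast
  have 1: "tdet p (Suc N) x = g * (a * b)" unfolding g_def a_def b_def by (rule tpos_Suc_split(2)[OF assms])
  have 2: "tdet p N x = g * l" unfolding g_def l_def by (rule tpos_split(2)[OF assms(1) t])
  define r where "r = (4 :: real) ^ N"
  have r: "r > 0" by (simp add: r_def)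
  have S: "Suc (N - 1) = N" using assms(1) by simp
  have "wgt p N x = (2 / (4 * r)) ^ p * (g * (a * b)) / (g * l)"
    unfolding wgt_def 1 2 r_def by simp
  also have "\<dots> = (2 / (4 * r)) ^ p * (a * b) / l" using g by simp
  \<comment> \<open>The normalization of \<open>wgt\<close> is compatible with this identity, so all
    powers of 2 and 4 are absorbed by the two distances and the length.\<close>
  also have "2 / (4 * r) = (1 / r) * (1 / r) / (2 / r)" using r by simp
  also have "\<dots> ^ p = (1 / r) ^ p * (1 / r) ^ p / (2 / r) ^ p"
    by (simp only: power_mult_distrib power_divide)
  also have "(1 / r) ^ p * (1 / r) ^ p / (2 / r) ^ p * (a * b) / l = ((1 / r) ^ p * a) * ((1 / r) ^ p * b) / ((2 / r) ^ p * l)"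
    by (simp only: times_divide_eq_left times_divide_eq_right divide_divide_eq_left mult_ac)
  also have "(2 / r) ^ p * l = wgt p (N - 1) x"
    unfolding wgt_def S 2 g_def[symmetric] r_def using g by simp
  finally show ?thesis unfolding low_diff pdet_scale[OF c] a_def b_def r_def by simp
qed

section \<open>Volume by peeling off the last moment\<close>

lemma mom_cong: "(\<And>i j. x (k, i, j) = y (k, i, j)) \<Longrightarrow> mom x k i j = mom y k i j"
  by (simp add: mom_def symm_coord_def)

lemma cmom_cong:
  assumes "\<And>k i j. k \<le> b \<Longrightarrow> x (k, i, j) = y (k, i, j)"
  shows "cmom x b i j = cmom y b i j"
  unfolding cmom_def by (intro sum.cong refl arg_cong2[where f = "(*)"] mom_cong assms) simp

lemma toep_cong:
  assumes "\<And>k i j. k < N \<Longrightarrow> x (k, i, j) = y (k, i, j)" "nat \<bar>fst u - fst w\<bar> < N"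
  shows "toep x u w = toep y u w"
  unfolding toep_def by (rule cmom_cong) (use assms in auto)

lemma tpos_cong:
  assumes "\<And>k i j. k < N \<Longrightarrow> x (k, i, j) = y (k, i, j)"
  shows "tpos p N x = tpos p N y" "tdet p N x = tdet p N y"
proof -
  have "toep x u w = toep y u w" if "u \<in> set (tblocks p N)" "w \<in> set (tblocks p N)" for u w
    using that by (intro toep_cong[where N = N and x = x and y = y, OF assms]) (auto simp: set_blocks)
  then show "tpos p N x = tpos p N y" "tdet p N x = tdet p N y"
    unfolding tpos_def tdet_def by (auto intro!: pd_cong pdet_cong)
qed

lemma wgt_cong:
  assumes "\<And>k i j. k \<le> n \<Longrightarrow> x (k, i, j) = y (k, i, j)"
  shows "wgt p n x = wgt p n y"
  unfolding wgt_def using tpos_cong(2)[of "Suc n" x y p] tpos_cong(2)[of n x y p] assms by simp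

lemma cmom_top:
  assumes "N \<ge> 1"
  shows "cmom x N i j = (\<Sum>k<N. coeff (cheb N) k * mom x k i j) + 4 ^ N * mom x N i j"
  unfolding cmom_def lessThan_Suc_atMost[symmetric] sum.lessThan_Suc coeff_cheb[OF assms] ..

text \<open>Of the entries involved, only the corner entry inside \<open>cross\<close> contains the
  moment of order \<open>N\<close>, with coefficient \<open>4 ^ N\<close>; the term
  \<open>mom x N\<close> in \<open>low\<close> cancels it.\<close>

lemma low_cong:
  assumes "N \<ge> 1" "\<And>k i j. k < N \<Longrightarrow> x (k, i, j) = y (k, i, j)"
  shows "slice p N x i j = slice p N y i j" "low p N x i j = low p N y i j" "upp p N x i j = upp p N y i j"
proof -
  define J where "J = {0..int N} \<times> (UNIV :: nat set)"
  have m: "toep x a b = toep y a b \<and> toep x b a = toep y b a" if "a \<in> set (mids p N)" "b \<in> J" for a b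
    using that assms(1) by (intro conjI toep_cong[where N = N and x = x and y = y, OF assms(2)]) (auto simp: mids_def set_blocks J_def)
  have J: "set (mids p N) \<subseteq> J" by (auto simp: mids_def set_blocks J_def)
  note D = schurs_diff_cong[where A = "toep x" and A' = "toep y", OF m J]
  have "toep x (0, i) (0, j) = toep y (0, i) (0, j)"
    using assms(1) by (intro toep_cong[where N = N and x = x and y = y, OF assms(2)]) auto
  then show 1: "slice p N x i j = slice p N y i j"
    using D[where u = "(0, i)" and w = "(0, j)"] unfolding slice_def by (simp add: J_def)
  have t: "toep x (0, i) (int N, j) = (\<Sum>k<N. coeff (cheb N) k * mom x k i j) + 4 ^ N * mom x N i j" for x
    unfolding toep_def by (simp add: cmom_top[OF assms(1)])
  have s: "(\<Sum>k<N. coeff (cheb N) k * mom x k i j) = (\<Sum>k<N. coeff (cheb N) k * mom y k i j)"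
    by (intro sum.cong refl arg_cong2[where f = "(*)"] mom_cong assms(2)) simp
  have "cross p N x i j - 4 ^ N * mom x N i j = cross p N y i j - 4 ^ N * mom y N i j"
    using D[where u = "(0, i)" and w = "(int N, j)"] unfolding cross_def t s by (simp add: J_def)
  then have "(cross p N x i j - 4 ^ N * mom x N i j) / 4 ^ N = (cross p N y i j - 4 ^ N * mom y N i j) / 4 ^ N"
    by (rule arg_cong)
  then have "cross p N x i j / 4 ^ N - mom x N i j = cross p N y i j / 4 ^ N - mom y N i j"
    by (simp add: diff_divide_distrib)
  then show 2: "low p N x i j = low p N y i j" unfolding low_def add_divide_distrib 1 by linarith
  show "upp p N x i j = upp p N y i j" unfolding upp_def 1 2 ..
qed

lemma pd_two: "distinct js \<Longrightarrow> pd js (\<lambda>i j. if i = j then 2 else 0) \<and> pdet js (\<lambda>i j. if i = j then 2 else 0) = 2 ^ length js"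
proof (induction js)
  case (Cons a js)
  have e: "schur a (\<lambda>i j. if i = j then 2 else 0) i j = (if i = j then 2 else 0)"
    if "i \<in> set js" "j \<in> set js" for i j
    using that Cons.prems by (auto simp: schur_def)
  have "pd js (schur a (\<lambda>i j. if i = j then 2 else 0)) = pd js (\<lambda>i j. if i = j then 2 else 0)"
    "pdet js (schur a (\<lambda>i j. if i = j then 2 else 0)) = pdet js (\<lambda>i j. if i = j then 2 else 0)"
    by (rule pd_cong pdet_cong, rule e, assumption+)+
  then show ?case using Cons by simp
qed simp

text \<open>The block of order 0 is twice the identity, since \<open>cheb 0\<close> is 2. So the
  interval of the first moment has a length of determinant 1 and the recursion ends without a
  leftover factor.\<close>

lemma tpos_1: "tpos p (Suc 0) x" "wgt p 0 x = 1"
proof -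
  have t: "(\<lambda>i j. toep x (0, i) (0, j)) = (\<lambda>i j. if i = j then 2 else 0)"
    by (auto simp: fun_eq_iff toep_def cmom_def mom_def)
  have b: "blocks p (map int [0..<Suc 0]) = map (Pair 0) [0..<p]" by (simp add: blocks_single)
  show "tpos p (Suc 0) x" unfolding tpos_def b pd_map t using pd_two[of "[0..<p]"] by simp
  have 1: "tdet p (Suc 0) x = 2 ^ p" unfolding tdet_def b pdet_map t using pd_two[of "[0..<p]"] by simp
  have 0: "tdet p 0 x = 1" by (simp add: tdet_def blocks_def)
  show "wgt p 0 x = 1" unfolding wgt_def 0 1 by (simp add: power_mult_distrib[symmetric])
qed

text \<open>Orders ascend, so the last moment is innermost and is integrated first.\<close>

definition mom_coords :: "nat \<Rightarrow> nat \<Rightarrow> (nat \<times> nat \<times> nat) list" where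
  "mom_coords p n = concat (map (\<lambda>k. tri (\<lambda>i j. (k, i, j)) [0..<p]) [1..<Suc n])"

lemma mom_coords_Suc: "mom_coords p (Suc n) = mom_coords p n @ tri (\<lambda>i j. (Suc n, i, j)) [0..<p]"
  by (simp add: mom_coords_def)

lemma measurable_mom: "(\<lambda>x. mom x k i j) \<in> borel_measurable fun_space"
  unfolding mom_def symm_coord_def by (cases "k = 0") (auto intro: measurable_coord)

lemma measurable_toep: "(\<lambda>x. toep x u w) \<in> borel_measurable fun_space"
  unfolding toep_def cmom_def by (intro borel_measurable_sum borel_measurable_times measurable_mom) simp

lemma measurable_tpos: "Measurable.pred fun_space (tpos p N)"
  unfolding tpos_def by (rule measurable_pd) (rule measurable_toep)

lemma measurable_wgt: "wgt p n \<in> borel_measurable fun_space"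
proof -
  have [measurable]: "tdet p N \<in> borel_measurable fun_space" for N
    unfolding tdet_def by (rule measurable_pdet) (rule measurable_toep)
  show ?thesis unfolding wgt_def by measurable
qed

definition wgt_integrand :: "nat \<Rightarrow> nat \<Rightarrow> real \<Rightarrow> moments \<Rightarrow> ennreal" where
  "wgt_integrand p n s x = (if tpos p (Suc n) x then ennreal (wgt p n x powr s) else 0)"

lemma measurable_wgt_integrand: "wgt_integrand p n s \<in> borel_measurable fun_space"
proof -
  note [measurable] = measurable_tpos[of p "Suc n"] measurable_wgt[of p n]
  show ?thesis unfolding wgt_integrand_def by measurable
qed

lemma beta_const_half_nonneg: "s \<ge> 0 \<Longrightarrow> beta_const p s \<ge> 0"
  by (rule beta_const_nonneg) simp

text \<open>By \<open>wgt_step\<close> the integrand is the weight of order \<open>n\<close> to the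
  power \<open>- s\<close> times a beta weight. \<open>iterint_beta\<close> returns the power
  \<open>2 * s + (p + 1) / 2\<close> of the same weight, which leaves
  \<open>s + (p + 1) / 2\<close>.\<close>

lemma iterint_level:
  assumes s: "s \<ge> 0"
  shows "iterint (tri (\<lambda>i j. (Suc n, i, j)) [0..<p]) (wgt_integrand p (Suc n) s) x =
    ennreal (beta_const p s) * wgt_integrand p n (s + (real p + 1) / 2) x"
proof -
  define N where "N = Suc n"
  define c where "c = (\<lambda>(i :: nat) (j :: nat). (N, i, j))"
  define js where "js = [0..<p]"
  define D A where "D = low p N x" and "A = upp p N x"
  have N1: "N \<ge> 1" and Nn: "N - 1 = n" by (simp_all add: N_def)
  define E where "E = (if tpos p N x then ennreal (wgt p n x powr (- s)) else 0)"
  have "iterint (tri c js) (wgt_integrand p N s) x =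
     iterint (tri c js) (\<lambda>y. E * gap_weight c js s D A y) x"
  proof (rule iterint_cong)
    fix y assume y: "\<And>i. i \<notin> set (tri c js) \<Longrightarrow> y i = x i"
    have yx: "y (k, i, j) = x (k, i, j)" if "k < N" for k i j
    proof (rule y)
      show "(k, i, j) \<notin> set (tri c js)" using that set_tri[of c js] unfolding c_def by blast
    qed
    have low: "low p N y = D" "upp p N y = A"
      unfolding D_def A_def using low_cong[OF N1, of y x] yx by (auto simp: fun_eq_iff)
    have t: "tpos p N y = tpos p N x" by (rule tpos_cong(1)) (rule yx)
    have w: "wgt p n y = wgt p n x" by (rule wgt_cong, rule yx) (simp add: N_def)
    have m: "mom y N = symm_coord c y" by (simp add: fun_eq_iff mom_def N_def c_def)
    let ?Y = "\<lambda>i j. symm_coord c y i j - D i j" and ?Z = "\<lambda>i j. A i j - symm_coord c y i j"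
    have step: "tpos p (Suc N) y \<longleftrightarrow> tpos p N x \<and> pd js ?Y \<and> pd js ?Z"
      using tpos_step[OF N1, of p y] unfolding low t m js_def .
    show "wgt_integrand p N s y = E * beta_weight js s ?Y ?Z"
    proof (cases "tpos p (Suc N) y")
      case True
      then have tx: "tpos p N x" "pd js ?Y" "pd js ?Z" using step by blast+
      have "wgt p N y = (pdet js ?Y * pdet js ?Z) / wgt p n x"
        using wgt_step[OF N1 True] unfolding low m js_def Nn w .
      then have "wgt p N y powr s = (pdet js ?Y * pdet js ?Z) powr s / wgt p n x powr s"
        by (simp only: powr_divide)
      also have "\<dots> = wgt p n x powr (- s) * (pdet js ?Y * pdet js ?Z) powr s"
        by (simp only: powr_minus divide_inverse mult.commute)
      finally have "wgt p N y powr s = \<dots>" .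
      then show ?thesis using True tx unfolding wgt_integrand_def beta_weight_def E_def
        by (simp only: if_True simp_thms) (rule ennreal_mult, auto)
    next
      case False
      then show ?thesis using step unfolding wgt_integrand_def beta_weight_def E_def by auto
    qed
  qed
  also have "\<dots> = E * iterint (tri c js) (\<lambda>y. gap_weight c js s D A y) x"
    by (intro iterint_cmult measurable_beta_weight)
       (auto simp: symm_coord_def intro!: borel_measurable_diff measurable_coord)
  also have "\<dots> = ennreal (beta_const p s) * wgt_integrand p n (s + (real p + 1) / 2) x"
  proof (cases "tpos p N x")
    case True
    have sym: "symm A" "symm D" unfolding A_def D_def
      using symm_low[OF N1] True tpos_split(1)[OF N1] by blast+
    have UL: "pd js (\<lambda>i j. A i j - D i j)" "pdet js (\<lambda>i j. A i j - D i j) = wgt p n x"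
      using upp_low[OF N1 True] unfolding A_def D_def js_def Nn by auto
    have sj: "sorted_wrt (<) js" unfolding js_def by (rule sorted_wrt_upt)
    have inj: "inj (\<lambda>(i, j). c i j)" by (auto simp: inj_def c_def)
    have "iterint (tri c js) (\<lambda>y. gap_weight c js s D A y) x =
      ennreal (beta_const p s * wgt p n x powr (2 * s + (real p + 1) / 2))"
      using iterint_beta[OF sj inj sym, of s x] s UL by (simp add: js_def)
    moreover have "wgt p n x powr (- s) * wgt p n x powr (2 * s + (real p + 1) / 2) = wgt p n x powr (s + (real p + 1) / 2)"
      by (simp add: powr_add[symmetric])
    ultimately show ?thesis using True beta_const_half_nonneg[OF s, of p] unfolding E_def wgt_integrand_def N_def[symmetric]
      by (simp add: ennreal_mult[symmetric] mult_ac)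
  next
    case False
    then show ?thesis unfolding E_def wgt_integrand_def N_def by simp
  qed
  finally show ?thesis unfolding c_def js_def N_def .
qed

abbreviation diag_beta :: "nat \<Rightarrow> real \<Rightarrow> real" where
  "diag_beta p a \<equiv> multi_beta p a a"

lemma iterint_wgt:
  assumes "s \<ge> 0"
  shows "iterint (mom_coords p n) (wgt_integrand p n s) x0 =
    ennreal (\<Prod>k=1..n. diag_beta p (s + real k * (real p + 1) / 2))"
  using assms
proof (induction n arbitrary: s)
  case 0
  then show ?case by (simp add: mom_coords_def wgt_integrand_def tpos_1)
next
  case (Suc n)
  define h where "h = (real p + 1) / 2"
  have sh: "s + h \<ge> 0" using Suc.prems by (simp add: h_def)
  have "iterint (mom_coords p (Suc n)) (wgt_integrand p (Suc n) s) x0 =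
     iterint (mom_coords p n) (\<lambda>x. ennreal (beta_const p s) * wgt_integrand p n (s + h) x) x0"
    unfolding mom_coords_Suc iterint_append iterint_level[OF Suc.prems] h_def
    by (rule arg_cong2[where f = "\<lambda>f x. iterint (mom_coords p n) f x"]) (auto simp: iterint_level[OF Suc.prems])
  also have "\<dots> = ennreal (beta_const p s) * iterint (mom_coords p n) (wgt_integrand p n (s + h)) x0"
    by (rule iterint_cmult[OF measurable_wgt_integrand])
  also have "\<dots> = ennreal (diag_beta p (s + h)) *
      ennreal (\<Prod>k=1..n. diag_beta p (s + h + real k * (real p + 1) / 2))"
    unfolding Suc.IH[OF sh] beta_const_eq[OF Suc.prems] unfolding h_def ..
  also have "\<dots> = ennreal (diag_beta p (s + h) *
     (\<Prod>k=1..n. diag_beta p (s + h + real k * (real p + 1) / 2)))"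
    using beta_const_half_nonneg[OF Suc.prems, of p] unfolding beta_const_eq[OF Suc.prems] h_def[symmetric]
    by (rule ennreal_mult'[symmetric])
  also have "(\<Prod>k=1..n. diag_beta p (s + h + real k * (real p + 1) / 2)) =
     (\<Prod>k=2..Suc n. diag_beta p (s + real k * (real p + 1) / 2))"
  proof -
    have e: "s + h + real k * (real p + 1) / 2 = s + real (Suc k) * (real p + 1) / 2" for k
      unfolding h_def of_nat_Suc by (simp add: algebra_simps add_divide_distrib)
    show ?thesis unfolding numeral_2_eq_2 One_nat_def prod.shift_bounds_cl_Suc_ivl e ..
  qed
  also have "diag_beta p (s + h) * \<dots> =
     (\<Prod>k=1..Suc n. diag_beta p (s + real k * (real p + 1) / 2))"
    by (subst (2) prod.atLeast_Suc_atMost) (auto simp: h_def numeral_2_eq_2)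
  finally show ?case .
qed

section \<open>Simultaneous diagonalization\<close>

definition bil :: "'a set \<Rightarrow> 'a kernel \<Rightarrow> ('a \<Rightarrow> real) \<Rightarrow> ('a \<Rightarrow> real) \<Rightarrow> real" where
  "bil I A v w = (\<Sum>i\<in>I. \<Sum>j\<in>I. v i * A i j * w j)"

lemma qform_bil: "qform I A v = bil I A v v"
  by (simp add: qform_def bil_def)

lemma bil_sym:
  assumes "symm A"
  shows "bil I A v w = bil I A w v"
  unfolding bil_def by (subst sum.swap) (intro sum.cong refl, simp add: symmD[OF assms] mult_ac)

lemma bil_add_right: "bil I A v (\<lambda>i. w i + t * z i) = bil I A v w + t * bil I A v z"
  unfolding bil_def by (simp add: algebra_simps sum.distrib sum_distrib_left)

lemma qform_add:
  assumes "symm A"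
  shows "qform I A (\<lambda>i. v i + t * w i) = qform I A v + 2 * t * bil I A v w + t * t * qform I A w"
proof -
  have "qform I A (\<lambda>i. v i + t * w i) = bil I A (\<lambda>i. v i + t * w i) v + t * bil I A (\<lambda>i. v i + t * w i) w"
    unfolding qform_bil bil_add_right ..
  also have "\<dots> = bil I A v (\<lambda>i. v i + t * w i) + t * bil I A w (\<lambda>i. v i + t * w i)"
    by (simp only: bil_sym[OF assms, of I "\<lambda>i. v i + t * w i"])
  also have "\<dots> = bil I A v v + t * bil I A v w + t * (bil I A w v + t * bil I A w w)"
    unfolding bil_add_right ..
  finally show ?thesis unfolding qform_bil bil_sym[OF assms, of I w v] by (simp add: algebra_simps)
qed

lemma qform_scale: "qform I A (\<lambda>i. t * v i) = t * t * qform I A v"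
  unfolding qform_def by (simp add: sum_distrib_left mult_ac)

text \<open>A null vector minimizes the nonnegative form, so the form has no linear term
  there.\<close>

lemma psd_kernel:
  assumes "symm A" "\<And>v. qform I A v \<ge> 0" "qform I A u = 0"
  shows "bil I A u v = 0"
proof (rule ccontr)
  assume nz: "bil I A u v \<noteq> 0"
  define b q where "b = bil I A u v" "q = qform I A v"
  have q: "q \<ge> 0" unfolding b_q_def by (rule assms(2))
  \<comment> \<open>The minimizer of \<open>2 * t * b + t * t * q\<close> would be
    \<open>- b / q\<close>; adding 1 to the denominator avoids \<open>q = 0\<close> and keeps the
    value negative.\<close>
  define t where "t = - b / (q + 1)"
  define m where "m = q + 1"
  have m: "m > 0" "q - 2 * m < 0" using q by (simp_all add: m_def)
  have t: "t = - b / m" by (simp add: t_def m_def)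
  have "0 \<le> 2 * t * b + t * t * q"
    using assms(2)[of "\<lambda>i. u i + t * v i"] unfolding qform_add[OF assms(1)] assms(3) b_q_def by simp
  also have "2 * t * b + t * t * q = (b * b) * (q - 2 * m) / (m * m)"
    using m(1) unfolding t by (simp add: field_simps)
  also have "\<dots> < 0"
    using m nz by (intro divide_neg_pos mult_pos_neg) (auto simp: b_q_def zero_less_mult_iff)
  finally show False by simp
qed

lemma bil_delta:
  assumes "finite I" "j \<in> I"
  shows "bil I A u (\<lambda>i. if i = j then 1 else 0) = (\<Sum>i\<in>I. u i * A i j)"
  unfolding bil_def using assms by (simp add: if_distrib sum.delta cong: if_cong)

lemma qform_diff: "qform I (\<lambda>i j. c * A i j - B i j) v = c * qform I A v - qform I B v"
  unfolding qform_def by (simp add: algebra_simps sum_subtractf sum_distrib_left)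

lemma qform_rank_one: "qform I (\<lambda>i j. A i j - c * h i * h j) v = qform I A v - c * (\<Sum>i\<in>I. h i * v i)\<^sup>2"
proof -
  have "(\<Sum>i\<in>I. \<Sum>j\<in>I. v i * (c * h i * h j) * v j) = c * (\<Sum>i\<in>I. h i * v i)\<^sup>2"
  proof -
    have "c * (\<Sum>i\<in>I. h i * v i)\<^sup>2 = (\<Sum>i\<in>I. \<Sum>j\<in>I. c * ((h i * v i) * (h j * v j)))"
      unfolding power2_eq_square sum_product sum_distrib_left[of c] ..
    also have "\<dots> = (\<Sum>i\<in>I. \<Sum>j\<in>I. v i * (c * h i * h j) * v j)"
      by (intro sum.cong refl) (simp add: mult_ac)
    finally show ?thesis ..
  qed
  then show ?thesis unfolding qform_def by (simp add: algebra_simps sum_subtractf)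
qed

lemma continuous_qform: "continuous_on S (qform I A)"
  unfolding qform_def
  by (intro continuous_intros continuous_on_product_coordinates continuous_on_subset[OF _ subset_UNIV])

lemma compact_PiE_UNIV:
  fixes S :: "'a \<Rightarrow> 'b :: topological_space set"
  assumes "\<And>i. compact (S i)"
  shows "compact (PiE UNIV S)"
proof -
  have "compactin (product_topology (\<lambda>_. euclidean) UNIV) (PiE UNIV S)"
    unfolding compactin_PiE using assms by simp
  then show ?thesis unfolding euclidean_product_topology by simp
qed

text \<open>The quotient of the forms is continuous on the unit sphere of the coordinates in
  \<open>I\<close>, and homogeneity extends the maximum to all vectors.\<close>

lemma rayleigh_maximizer:
  fixes H B :: "'a kernel"
  assumes I: "finite I" "I \<noteq> {}"
    and H: "\<And>v. (\<exists>i\<in>I. v i \<noteq> 0) \<Longrightarrow> qform I H v > 0"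
  obtains u where "qform I H u = 1" "\<And>v. qform I B v \<le> qform I B u * qform I H v"
proof -
  define n2 where "n2 = (\<lambda>v :: 'a \<Rightarrow> real. \<Sum>i\<in>I. v i * v i)"
  \<comment> \<open>The coordinates outside \<open>I\<close> are pinned to 0 so that the sphere is
    compact in the space of all functions.\<close>
  define K where "K = PiE UNIV (\<lambda>i. if i \<in> I then {-1..1 :: real} else {0}) \<inter> {v. n2 v = 1}"
  have cont: "continuous_on UNIV n2"
    unfolding n2_def by (intro continuous_intros continuous_on_product_coordinates)
  have "compact K" unfolding K_def
    by (intro compact_Int_closed compact_PiE_UNIV closed_Collect_eq cont continuous_on_const) auto
  moreover have "K \<noteq> {}"
  proof -
    obtain x where "x \<in> I" using I by blast
    then have "(\<lambda>i. if i = x then 1 else 0) \<in> K"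
      using I(1) by (auto simp: K_def n2_def if_distrib sum.delta cong: if_cong)
    then show ?thesis by blast
  qed
  moreover have pos: "qform I H v > 0" if "n2 v = 1" for v
  proof (rule H, rule ccontr)
    assume "\<not> (\<exists>i\<in>I. v i \<noteq> 0)"
    then have "n2 v = 0" unfolding n2_def by (intro sum.neutral) auto
    then show False using that by simp
  qed
  have "\<forall>v\<in>K. qform I H v \<noteq> 0"
  proof
    fix v assume "v \<in> K"
    then have "n2 v = 1" by (simp add: K_def)
    from pos[OF this] show "qform I H v \<noteq> 0" by simp
  qed
  then have "continuous_on K (\<lambda>v. qform I B v / qform I H v)"
    by (intro continuous_on_divide continuous_qform)
  ultimately obtain u0 where u0: "u0 \<in> K" "\<And>v. v \<in> K \<Longrightarrow> qform I B v / qform I H v \<le> qform I B u0 / qform I H u0"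
    using continuous_attains_sup[of K "\<lambda>v. qform I B v / qform I H v"] by blast
  define l where "l = qform I B u0 / qform I H u0"
  have h0: "qform I H u0 > 0" using u0(1) pos by (simp add: K_def)
  define s where "s = 1 / sqrt (qform I H u0)"
  have ss: "s * s = 1 / qform I H u0" using h0 by (simp add: s_def)
  have "qform I H (\<lambda>i. s * u0 i) = 1" unfolding qform_scale ss using h0 by simp
  moreover have Bl: "qform I B (\<lambda>i. s * u0 i) = l" unfolding qform_scale ss l_def by simp
  moreover have "qform I B v \<le> l * qform I H v" for v
  proof (cases "\<exists>i\<in>I. v i \<noteq> 0")
    case True
    define r where "r = n2 v"
    have r: "r > 0"
    proof -
      from True obtain i where i: "i \<in> I" "v i \<noteq> 0" by blast
      have "0 < v i * v i" using i by (auto simp: zero_less_mult_iff linorder_neq_iff)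
      also have "\<dots> \<le> r" unfolding r_def n2_def by (rule member_le_sum) (use i I in auto)
      finally show ?thesis .
    qed
    define t where "t = 1 / sqrt r"
    have tt: "t * t = 1 / r" using r by (simp add: t_def)
    define w where "w = (\<lambda>i. if i \<in> I then t * v i else 0)"
    have w: "qform I A w = (1 / r) * qform I A v" for A
    proof -
      have "qform I A w = qform I A (\<lambda>i. t * v i)" by (rule qform_cong) (simp add: w_def)
      then show ?thesis unfolding qform_scale tt .
    qed
    have n: "n2 w = 1"
    proof -
      have "n2 w = (\<Sum>i\<in>I. (t * t) * (v i * v i))" unfolding n2_def by (intro sum.cong) (auto simp: w_def)
      also have "\<dots> = (t * t) * r" unfolding r_def n2_def sum_distrib_left ..
      finally show ?thesis using r by (simp add: tt)
    qed
    have "w i \<in> {-1..1}" if "i \<in> I" for i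
    proof -
      have "w i * w i \<le> n2 w" unfolding n2_def by (rule member_le_sum) (use that I in auto)
      then have "(w i)\<^sup>2 \<le> 1" by (simp add: n power2_eq_square)
      then have "\<bar>w i\<bar> \<le> 1" by (simp add: abs_square_le_1)
      then show ?thesis by auto
    qed
    then have "w \<in> K" using n by (auto simp: K_def w_def PiE_def)
    from u0(2)[OF this] have "qform I B w \<le> l * qform I H w"
      using pos[OF n] by (simp add: l_def pos_divide_le_eq)
    then show ?thesis unfolding w using r by (simp add: divide_simps)
  next
    case False
    then have "qform I A v = 0" for A by (simp add: qform_def)
    then show ?thesis by simp
  qed
  ultimately show thesis using that[of "\<lambda>i. s * u0 i"] by simp
qed

text \<open>As \<open>u x\<close> is nonzero, the kernel relation expresses row and column
  \<open>x\<close> through the other entries.\<close>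

lemma symm_extend_zero:
  fixes D :: "'a kernel"
  assumes "finite I" "x \<in> I" "u x \<noteq> 0" "symm D"
    and ker: "\<And>i. i \<in> I \<Longrightarrow> (\<Sum>j\<in>I. D i j * u j) = 0"
    and zero: "\<And>i j. i \<in> I - {x} \<Longrightarrow> j \<in> I - {x} \<Longrightarrow> D i j = 0"
    and ij: "i \<in> I" "j \<in> I"
  shows "D i j = 0"
proof -
  have s: "(\<Sum>j\<in>I. D i j * u j) = D i x * u x + (\<Sum>j\<in>I - {x}. D i j * u j)" for i
    using assms(1,2) by (rule sum.remove)
  have ix: "D i x = 0" if "i \<in> I - {x}" for i
  proof -
    have "(\<Sum>j\<in>I - {x}. D i j * u j) = 0" by (intro sum.neutral ballI) (simp add: zero[OF that])
    then show ?thesis using ker[of i] s[of i] that assms(3) by simp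
  qed
  have xi: "D x i = 0" if "i \<in> I - {x}" for i using ix[OF that] symmD[OF assms(4), of x i] by simp
  have "(\<Sum>j\<in>I - {x}. D x j * u j) = 0" by (intro sum.neutral ballI) (simp only: xi mult_zero_left)
  then have "D x x = 0" using ker[of x] s[of x] assms(2,3) by simp
  then show ?thesis using ix xi zero ij by (cases "i = x"; cases "j = x") auto
qed

lemma sum_mult_add_scaled:
  fixes c :: real
  shows "(\<Sum>i\<in>I. f i * (g i + c * k i)) = (\<Sum>i\<in>I. f i * g i) + c * (\<Sum>i\<in>I. f i * k i)"
  by (simp add: distrib_left sum.distrib sum_distrib_left mult_ac)

text \<open>Splitting off a maximizer \<open>u\<close> of the Rayleigh quotient leaves forms that annihilate \<open>u\<close>; an index
  \<open>x\<close> with \<open>u x \<noteq> 0\<close> is then redundant. The dual family \<open>u\<close> serves as the inverse matrix of \<open>w\<close>.\<close>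
lemma simultaneous_diagonalization:
  fixes H B :: "'a kernel"
  assumes "finite I" "card I = n" "symm H" "symm B"
    and "\<And>v. (\<exists>i\<in>I. v i \<noteq> 0) \<Longrightarrow> qform I H v > 0"
    and "\<And>v. 0 \<le> qform I B v" "\<And>v. qform I B v \<le> qform I H v"
  shows "\<exists>(l :: nat \<Rightarrow> real) w u. (\<forall>r<n. 0 \<le> l r \<and> l r \<le> 1) \<and>
    (\<forall>i\<in>I. \<forall>j\<in>I. H i j = (\<Sum>r<n. w r i * w r j)) \<and>
    (\<forall>i\<in>I. \<forall>j\<in>I. B i j = (\<Sum>r<n. l r * (w r i * w r j))) \<and>
    (\<forall>r<n. \<forall>s<n. (\<Sum>i\<in>I. w r i * u s i) = (if r = s then 1 else 0))"
  using assms
proof (induction n arbitrary: I H B)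
  case 0
  then show ?case by auto
next
  case (Suc n)
  note fin = Suc.prems(1) and symH = Suc.prems(3) and symB = Suc.prems(4)
  have "I \<noteq> {}" using Suc.prems(2) by auto
  from rayleigh_maximizer[OF fin this Suc.prems(5), of B]
  obtain u where u: "qform I H u = 1" and max: "\<And>v. qform I B v \<le> qform I B u * qform I H v" by blast
  define l where "l = qform I B u"
  have l01: "0 \<le> l" "l \<le> 1" unfolding l_def using Suc.prems(6)[of u] Suc.prems(7)[of u] u by auto
  define h where "h = (\<lambda>j. \<Sum>i\<in>I. u i * H i j)"
  have symQ: "symm (\<lambda>i j. l * H i j - B i j)"
    unfolding symm_def using symmD[OF symH] symmD[OF symB] by metis
  \<comment> \<open>\<open>l H - B\<close> is nonnegative and vanishes at the maximizer
    \<open>u\<close>, so \<open>u\<close> lies in its kernel: \<open>B u = l H u\<close>.\<close>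
  have "bil I (\<lambda>i j. l * H i j - B i j) u v = 0" for v
    by (rule psd_kernel[OF symQ]) (use max u in \<open>auto simp: qform_diff l_def\<close>)
  then have "(\<Sum>i\<in>I. u i * (l * H i j - B i j)) = 0" if "j \<in> I" for j
    using bil_delta[OF fin that, of "\<lambda>i j. l * H i j - B i j" u] by simp
  then have Bu: "(\<Sum>i\<in>I. u i * B i j) = l * h j" if "j \<in> I" for j
    using that by (simp add: h_def algebra_simps sum_subtractf sum_distrib_left)
  have hu: "(\<Sum>j\<in>I. h j * u j) = 1"
  proof -
    have "(\<Sum>j\<in>I. h j * u j) = bil I H u u"
      unfolding h_def bil_def sum_distrib_right by (rule sum.swap)
    then show ?thesis using u by (simp add: qform_bil)
  qed
  have Hu: "(\<Sum>j\<in>I. H i j * u j) = h i" for i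
    unfolding h_def by (intro sum.cong refl) (simp add: symmD[OF symH, of i] mult.commute)
  have Bu': "(\<Sum>j\<in>I. B i j * u j) = l * h i" if "i \<in> I" for i
    unfolding Bu[OF that, symmetric] by (intro sum.cong refl) (simp add: symmD[OF symB, of i] mult.commute)
  define H' where "H' = (\<lambda>i j. H i j - 1 * h i * h j)"
  define B' where "B' = (\<lambda>i j. B i j - l * h i * h j)"
  have symH': "symm H'" unfolding symm_def H'_def using symmD[OF symH] by (metis mult.assoc mult.commute)
  have symB': "symm B'" unfolding symm_def B'_def using symmD[OF symB] by (metis mult.assoc mult.commute)
  have ker: "(\<Sum>j\<in>I. (F i j - c * h i * h j) * u j) = 0" if "(\<Sum>j\<in>I. F i j * u j) = c * h i" for F c i
  proof -
    have "(\<Sum>j\<in>I. (F i j - c * h i * h j) * u j) = (\<Sum>j\<in>I. F i j * u j) - c * h i * (\<Sum>j\<in>I. h j * u j)"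
      by (simp add: left_diff_distrib sum_subtractf sum_distrib_left mult.assoc)
    then show ?thesis unfolding that hu by simp
  qed
  have kerH: "(\<Sum>j\<in>I. H' i j * u j) = 0" for i
    unfolding H'_def by (rule ker) (simp add: Hu)
  have kerB: "(\<Sum>j\<in>I. B' i j * u j) = 0" if "i \<in> I" for i
    unfolding B'_def by (rule ker) (rule Bu'[OF that])
  have "\<exists>x\<in>I. u x \<noteq> 0"
  proof (rule ccontr)
    assume "\<not> (\<exists>x\<in>I. u x \<noteq> 0)"
    then have "qform I H u = 0" by (auto simp: qform_def intro!: sum.neutral)
    then show False using u by simp
  qed
  then obtain x where x: "x \<in> I" "u x \<noteq> 0" by blast
  define I' where "I' = I - {x}"
  have I': "finite I'" "card I' = n" "I = insert x I'" "x \<notin> I'" using fin Suc.prems(2) x by (auto simp: I'_def)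
  define ext where "ext = (\<lambda>v :: 'a \<Rightarrow> real. \<lambda>i. if i = x then 0 else v i)"
  have qext: "qform I' A v = qform I A (ext v)" for A v
    unfolding qform_def I'(3) using I'(1,4)
    by (auto simp: ext_def intro!: sum.cong)
  define al where "al = (\<lambda>v. \<Sum>i\<in>I. h i * ext v i)"
  \<comment> \<open>On vectors vanishing at \<open>x\<close>, the reduced form is the original one
    after projection along \<open>u\<close> onto the \<open>H\<close>-orthogonal complement of
    \<open>u\<close>. Positivity and the bounds are inherited this way.\<close>
  have peel: "qform I' (\<lambda>i j. F i j - c * h i * h j) v = qform I F (\<lambda>i. ext v i + (- al v) * u i)"
    if "symm F" "qform I F u = c" and Fu: "\<And>i. i \<in> I \<Longrightarrow> (\<Sum>j\<in>I. F i j * u j) = c * h i" for F c v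
  proof -
    have "bil I F (ext v) u = (\<Sum>i\<in>I. ext v i * (\<Sum>j\<in>I. F i j * u j))"
      unfolding bil_def by (simp add: sum_distrib_left mult.assoc)
    also have "\<dots> = (\<Sum>i\<in>I. ext v i * (c * h i))" by (intro sum.cong refl) (simp add: Fu)
    also have "\<dots> = c * al v" by (simp add: al_def sum_distrib_left mult_ac)
    finally show ?thesis
      unfolding qext unfolding qform_rank_one qform_add[OF that(1)] that(2) by (simp add: al_def power2_eq_square)
  qed
  have H'q: "qform I' H' v = qform I H (\<lambda>i. ext v i + (- al v) * u i)" for v
    unfolding H'_def by (rule peel[OF symH u]) (simp add: Hu)
  have B'q: "qform I' B' v = qform I B (\<lambda>i. ext v i + (- al v) * u i)" for v
    unfolding B'_def by (rule peel[OF symB l_def[symmetric]]) (rule Bu')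
  have pos: "qform I' H' v > 0" if v: "\<exists>i\<in>I'. v i \<noteq> 0" for v
    unfolding H'q
  proof (rule Suc.prems(5))
    show "\<exists>i\<in>I. ext v i + (- al v) * u i \<noteq> 0"
    proof (cases "al v = 0")
      case True
      then show ?thesis using v I' by (auto simp: ext_def)
    next
      case False
      then show ?thesis using x by (intro bexI[of _ x]) (auto simp: ext_def)
    qed
  qed
  have "\<exists>(l :: nat \<Rightarrow> real) w u. (\<forall>r<n. 0 \<le> l r \<and> l r \<le> 1) \<and>
    (\<forall>i\<in>I'. \<forall>j\<in>I'. H' i j = (\<Sum>r<n. w r i * w r j)) \<and>
    (\<forall>i\<in>I'. \<forall>j\<in>I'. B' i j = (\<Sum>r<n. l r * (w r i * w r j))) \<and>
    (\<forall>r<n. \<forall>s<n. (\<Sum>i\<in>I'. w r i * u s i) = (if r = s then 1 else 0))"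
    by (rule Suc.IH[OF I'(1,2) symH' symB' pos]) (simp_all only: H'q B'q Suc.prems(6,7))
  then obtain l' w' u' where IH:
    "\<And>r. r < n \<Longrightarrow> 0 \<le> l' r \<and> l' r \<le> (1::real)"
    "\<And>i j. i \<in> I' \<Longrightarrow> j \<in> I' \<Longrightarrow> H' i j = (\<Sum>r<n. w' r i * w' r j)"
    "\<And>i j. i \<in> I' \<Longrightarrow> j \<in> I' \<Longrightarrow> B' i j = (\<Sum>r<n. l' r * (w' r i * w' r j))"
    "\<And>r s. r < n \<Longrightarrow> s < n \<Longrightarrow> (\<Sum>i\<in>I'. w' r i * u' s i) = (if r = s then 1 else 0)"
    by blast
  \<comment> \<open>The value at \<open>x\<close> is solved from the requirement that
    \<open>W r\<close> annihilate \<open>u\<close>, as the peeled forms do.\<close>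
  define W where "W = (\<lambda>r i. if r = n then h i else if i = x then - (\<Sum>j\<in>I'. w' r j * u j) / u x else w' r i)"
  define L where "L = (\<lambda>r. if r = n then l else l' r)"
  \<comment> \<open>Subtracting a multiple of \<open>u\<close> makes the old dual vectors orthogonal
    to the new row \<open>h\<close>; the pairings with the other rows do not change, since these
    annihilate \<open>u\<close>.\<close>
  define U where "U = (\<lambda>s i. if s = n then u i else ext (u' s) i + (- al (u' s)) * u i)"
  have Wn: "W n = h" and Ln: "L n = l" and Un: "U n = u" by (auto simp: W_def L_def U_def fun_eq_iff)
  have W': "W r i = w' r i" if "r < n" "i \<in> I'" for r i using that I' by (auto simp: W_def)
  have L': "L r = l' r" if "r < n" for r using that by (simp add: L_def)
  have sumI: "sum f I = f x + sum f I'" for f :: "'a \<Rightarrow> real" using I' by simp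
  have Wu: "(\<Sum>j\<in>I. W r j * u j) = 0" if "r < n" for r
  proof -
    have "(\<Sum>j\<in>I'. W r j * u j) = (\<Sum>j\<in>I'. w' r j * u j)" by (intro sum.cong refl) (simp add: W'[OF that])
    moreover have "W r x * u x = - (\<Sum>j\<in>I'. w' r j * u j)" using that x by (simp add: W_def)
    ultimately show ?thesis unfolding sumI by linarith
  qed
  have gen: "F i j = (\<Sum>r<n. c r * (W r i * W r j))"
    if F: "symm F" "\<And>i. i \<in> I \<Longrightarrow> (\<Sum>j\<in>I. F i j * u j) = 0"
      "\<And>i j. i \<in> I' \<Longrightarrow> j \<in> I' \<Longrightarrow> F i j = (\<Sum>r<n. c r * (w' r i * w' r j))" and ij: "i \<in> I" "j \<in> I" for F c i j
  proof -
    have "F i j - (\<Sum>r<n. c r * (W r i * W r j)) = 0"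
    proof (rule symm_extend_zero[of I x u "\<lambda>i j. F i j - (\<Sum>r<n. c r * (W r i * W r j))"])
      show "symm (\<lambda>i j. F i j - (\<Sum>r<n. c r * (W r i * W r j)))"
        unfolding symm_def using symmD[OF F(1)] by (metis (no_types, lifting) mult.commute sum.cong)
      fix i assume i: "i \<in> I"
      have "(\<Sum>j\<in>I. (\<Sum>r<n. c r * (W r i * W r j)) * u j) = (\<Sum>r<n. \<Sum>j\<in>I. c r * (W r i * W r j) * u j)"
        unfolding sum_distrib_right by (rule sum.swap)
      also have "\<dots> = (\<Sum>r<n. c r * W r i * (\<Sum>j\<in>I. W r j * u j))"
        unfolding sum_distrib_left by (simp add: mult.assoc)
      also have "\<dots> = 0" by (intro sum.neutral) (simp add: Wu)
      finally show "(\<Sum>j\<in>I. (F i j - (\<Sum>r<n. c r * (W r i * W r j))) * u j) = 0"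
        using F(2)[OF i] by (simp add: left_diff_distrib sum_subtractf)
    next
      fix i j assume "i \<in> I - {x}" "j \<in> I - {x}"
      then show "F i j - (\<Sum>r<n. c r * (W r i * W r j)) = 0"
        using F(3)[of i j] by (simp add: I'_def[symmetric] W')
    qed (use fin x ij in auto)
    then show ?thesis by simp
  qed
  have HW: "H i j = (\<Sum>r<Suc n. W r i * W r j)" if "i \<in> I" "j \<in> I" for i j
    using gen[OF symH' kerH, of "\<lambda>_. 1" i j] IH(2) that by (simp add: H'_def Wn)
  have BW: "B i j = (\<Sum>r<Suc n. L r * (W r i * W r j))" if "i \<in> I" "j \<in> I" for i j
  proof -
    have "B' i j = (\<Sum>r<n. l' r * (W r i * W r j))" by (rule gen[OF symB' kerB IH(3) that])
    moreover have "(\<Sum>r<n. l' r * (W r i * W r j)) = (\<Sum>r<n. L r * (W r i * W r j))"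
      by (intro sum.cong refl) (simp add: L')
    ultimately show ?thesis by (simp add: B'_def Wn Ln mult.assoc)
  qed
  have hU: "(\<Sum>i\<in>I. h i * U s i) = (if s = n then 1 else 0)" if "s < Suc n" for s
  proof (cases "s = n")
    case True
    then show ?thesis using hu Un by simp
  next
    case False
    have "(\<Sum>i\<in>I. h i * U s i) = al (u' s) + (- al (u' s)) * (\<Sum>i\<in>I. h i * u i)"
      unfolding U_def if_not_P[OF False] sum_mult_add_scaled by (simp only: al_def)
    then show ?thesis using False hu by simp
  qed
  have WU: "(\<Sum>i\<in>I. W r i * U s i) = (if r = s then 1 else 0)" if "r < n" "s < Suc n" for r s
  proof (cases "s = n")
    case True
    then show ?thesis using Wu[OF that(1)] Un that by simp
  next
    case False
    have "(\<Sum>i\<in>I. W r i * U s i) = (\<Sum>i\<in>I. W r i * ext (u' s) i) + (- al (u' s)) * (\<Sum>i\<in>I. W r i * u i)"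
      unfolding U_def if_not_P[OF False] sum_mult_add_scaled ..
    also have "\<dots> = (\<Sum>i\<in>I. W r i * ext (u' s) i)" unfolding Wu[OF that(1)] by simp
    also have "\<dots> = (\<Sum>i\<in>I'. W r i * ext (u' s) i)" unfolding sumI by (simp add: ext_def)
    also have "\<dots> = (\<Sum>i\<in>I'. w' r i * u' s i)"
      using I'(4) by (intro sum.cong refl) (auto simp: W'[OF that(1)] ext_def)
    also have "\<dots> = (if r = s then 1 else 0)" using IH(4)[of r s] that False by simp
    finally show ?thesis .
  qed
  have WU': "(\<Sum>i\<in>I. W r i * U s i) = (if r = s then 1 else 0)" if "r < Suc n" "s < Suc n" for r s
  proof (cases "r = n")
    case True
    then show ?thesis using hU[OF that(2)] Wn by auto
  next
    case False
    then show ?thesis using WU[of r s] that by simp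
  qed
  have L01: "0 \<le> L r \<and> L r \<le> 1" if "r < Suc n" for r
    using that IH(1)[of r] l01 by (cases "r = n") (auto simp: L_def)
  show ?case
    by (rule exI[of _ L], rule exI[of _ W], rule exI[of _ U], intro conjI allI impI ballI;
        (rule HW BW WU' L01[THEN conjunct1] L01[THEN conjunct2]; assumption))
qed

section \<open>Atomic representation of interior points\<close>

text \<open>The interval of the next moment has positive definite length, and its midpoint has the
  same positive definite distance \<open>c\<close> from both ends.\<close>

lemma extend_moments:
  assumes "tpos p (Suc n) x"
  shows "\<exists>y. (\<forall>k\<le>n. \<forall>i j. y (k, i, j) = x (k, i, j)) \<and> tpos p (Suc (n + m)) y"
proof (induction m)
  case 0
  then show ?case using assms by auto
next
  case (Suc m)
  then obtain y where y: "\<And>k i j. k \<le> n \<Longrightarrow> y (k, i, j) = x (k, i, j)" "tpos p (Suc (n + m)) y" by blast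
  define N where "N = Suc (n + m)"
  have N: "N \<ge> 1" by (simp add: N_def)
  define c where "c = (\<lambda>i j. (1/2) * (upp p N y i j - low p N y i j))"
  define z where "z = (\<lambda>(k, i, j). if k = N then low p N y i j + c i j else y (k, i, j))"
  have zy: "z (k, i, j) = y (k, i, j)" if "k < N" for k i j using that by (simp add: z_def)
  have tz: "tpos p N z"
    using y(2) tpos_cong(1)[of N z y p] zy unfolding N_def by blast
  have tN: "tpos p N y" using y(2) by (simp add: N_def)
  have "tpos p (N - 1) y" using tpos_split(1)[OF N] tN by blast
  note sym = symm_low[OF N this]
  have low: "low p N z i j = low p N y i j" "upp p N z i j = upp p N y i j" for i j
    using low_cong[OF N, of z y] zy by auto
  have m: "mom z N i j = low p N y i j + c i j" for i j
  proof -
    have "mom z N i j = low p N y (min i j) (max i j) + c (min i j) (max i j)"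
      using N by (simp add: mom_def symm_coord_def z_def)
    also have "\<dots> = low p N y i j + c i j"
      unfolding c_def using symmD[OF sym(1), of i j] symmD[OF sym(2), of i j] by (cases "i \<le> j") (auto simp: min_def max_def)
    finally show ?thesis .
  qed
  have h: "(1/2 :: real) > 0" by simp
  have d: "(\<lambda>i j. mom z N i j - low p N z i j) = c" "(\<lambda>i j. upp p N z i j - mom z N i j) = c"
    unfolding m low c_def by (intro ext; simp add: field_simps)+
  have "pd [0..<p] c" unfolding c_def pd_scale[OF h] by (rule upp_low(1)[OF N tN])
  then have "tpos p (Suc N) z" unfolding tpos_step[OF N] d using tz by blast
  moreover have "z (k, i, j) = x (k, i, j)" if "k \<le> n" for k i j
    using y(1)[OF that] zy[of k i j] that by (simp add: N_def)
  ultimately show ?case unfolding N_def by (intro exI[of _ z]) simp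
qed

text \<open>The Riesz functional of the moment sequence at the entry \<open>i\<close>,
  \<open>j\<close>.\<close>

definition lfun :: "moments \<Rightarrow> nat \<Rightarrow> nat \<Rightarrow> real poly \<Rightarrow> real" where
  "lfun x i j P = (\<Sum>k\<le>degree P. coeff P k * mom x k i j)"

lemma lfun_le:
  assumes "degree P \<le> N"
  shows "lfun x i j P = (\<Sum>k\<le>N. coeff P k * mom x k i j)"
  unfolding lfun_def using assms
  by (intro sum.mono_neutral_left) (auto simp: coeff_eq_0)

lemma lfun_add: "lfun x i j (P + Q) = lfun x i j P + lfun x i j Q"
proof -
  define N where "N = max (degree P) (degree Q)"
  have "degree P \<le> N" "degree Q \<le> N" "degree (P + Q) \<le> N"
    by (auto simp: N_def intro: degree_add_le)
  then show ?thesis by (simp add: lfun_le[of _ N] algebra_simps sum.distrib)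
qed

lemma lfun_smult: "lfun x i j (smult c P) = c * lfun x i j P"
  by (simp add: lfun_le[OF degree_smult_le] lfun_def sum_distrib_left mult.assoc)

lemma lfun_zero: "lfun x i j 0 = 0"
  by (simp add: lfun_def)

lemma lfun_sum: "finite A \<Longrightarrow> lfun x i j (\<Sum>a\<in>A. f a) = (\<Sum>a\<in>A. lfun x i j (f a))"
  by (induction A rule: finite_induct) (auto simp: lfun_zero lfun_add)

lemma lfun_monom: "lfun x i j (monom 1 k) = mom x k i j"
proof -
  have "lfun x i j (monom 1 k) = (\<Sum>l\<le>k. if l = k then mom x l i j else 0)"
    unfolding lfun_le[OF degree_monom_le] by (intro sum.cong) auto
  then show ?thesis by simp
qed

lemma cmom_lfun: "cmom x b i j = lfun x i j (cheb b)"
  unfolding cmom_def lfun_le[OF degree_cheb] ..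

section \<open>Real polynomials on the unit circle\<close>

definition cev :: "real poly \<Rightarrow> complex \<Rightarrow> complex" where
  "cev f z = poly (map_poly complex_of_real f) z"

lemma cev_mult: "cev (f * g) z = cev f z * cev g z"
proof -
  have "map_poly complex_of_real (f * g) = map_poly complex_of_real f * map_poly complex_of_real g"
    by (rule poly_eqI) (simp add: coeff_map_poly coeff_mult)
  then show ?thesis by (simp add: cev_def)
qed

lemma cev_add: "cev (f + g) z = cev f z + cev g z"
proof -
  have "map_poly complex_of_real (f + g) = map_poly complex_of_real f + map_poly complex_of_real g"
    by (rule poly_eqI) (simp add: coeff_map_poly)
  then show ?thesis by (simp add: cev_def)
qed

lemma cev_pCons: "cev (pCons a f) z = complex_of_real a + z * cev f z"
  by (simp add: cev_def map_poly_pCons)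

lemma cev_0: "cev 0 z = 0"
  by (simp add: cev_def)

lemma cev_1: "cev 1 z = 1"
  by (simp add: one_pCons cev_pCons cev_0)

lemma cev_smult: "cev (smult c f) z = complex_of_real c * cev f z"
  using cev_mult[of "[:c:]" f z] by (simp add: cev_pCons cev_0)

lemma cev_power: "cev (f ^ n) z = cev f z ^ n"
  by (induction n) (auto simp: cev_1 cev_mult)

lemma cev_sum: "finite A \<Longrightarrow> cev (\<Sum>a\<in>A. f a) z = (\<Sum>a\<in>A. cev (f a) z)"
  by (induction A rule: finite_induct) (auto simp: cev_0 cev_add)

lemma cev_cis:
  assumes "degree f \<le> N"
  shows "cev f (cis t) = (\<Sum>b\<le>N. complex_of_real (coeff f b) * cis (real b * t))"
proof -
  have "degree (map_poly complex_of_real f) \<le> N" using assms by (simp add: degree_map_poly)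
  then have "poly (map_poly complex_of_real f) (cis t) = (\<Sum>b\<le>N. coeff (map_poly complex_of_real f) b * cis t ^ b)"
    unfolding poly_altdef by (intro sum.mono_neutral_left) (auto simp: coeff_eq_0)
  then show ?thesis unfolding cev_def by (simp only: coeff_map_poly of_real_0 Complex.DeMoivre)
qed

text \<open>The points \<open>(1 + cos t) / 2\<close> fill the infinite set
  \<open>[0, 1]\<close>.\<close>

lemma poly_eq_cos:
  assumes "\<And>t. poly P ((1 + cos t) / 2) = poly Q ((1 + cos t) / 2)"
  shows "P = (Q :: real poly)"
proof (rule ccontr)
  assume "P \<noteq> Q"
  then have "finite {x. poly (P - Q) x = 0}" by (intro poly_roots_finite) simp
  moreover have "{0..1} \<subseteq> {x. poly (P - Q) x = 0}"
  proof
    fix x :: real assume "x \<in> {0..1}"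
    then have "cos (arccos (2 * x - 1)) = 2 * x - 1" by (intro cos_arccos) auto
    then show "x \<in> {x. poly (P - Q) x = 0}" using assms[of "arccos (2 * x - 1)"] by simp
  qed
  ultimately have "finite {0..1 :: real}" by (rule finite_subset[rotated])
  then show False using infinite_Icc[of 0 "1 :: real"] by simp
qed

text \<open>On the unit circle this is twice the real part of \<open>f\<close> times the conjugate
  of \<open>g\<close>, written in the variable \<open>(1 + cos t) / 2\<close>. Applying
  \<open>lfun\<close> to it evaluates the Toeplitz form at the coefficient vectors.\<close>

definition laurent_form :: "nat \<Rightarrow> real poly \<Rightarrow> real poly \<Rightarrow> real poly" where
  "laurent_form N f g = (\<Sum>b\<le>N. \<Sum>c\<le>N. smult (coeff f b * coeff g c) (cheb (nat \<bar>int b - int c\<bar>)))"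

lemma cos_nat_abs_diff:
  "cos (real (nat \<bar>b - c\<bar>) * t) = cos (real_of_int b * t - real_of_int c * t)"
proof (cases "b \<ge> c")
  case True
  then have "real (nat \<bar>b - c\<bar>) * t = real_of_int b * t - real_of_int c * t" by (simp add: algebra_simps)
  then show ?thesis by simp
next
  case False
  then have "real (nat \<bar>b - c\<bar>) * t = - (real_of_int b * t - real_of_int c * t)" by (simp add: algebra_simps)
  then show ?thesis by (simp only: cos_minus)
qed

lemma poly_laurent_form:
  assumes "degree f \<le> N" "degree g \<le> N"
  shows "poly (laurent_form N f g) ((1 + cos t) / 2) = 2 * Re (cev f (cis t) * cnj (cev g (cis t)))"
proof -
  have c: "cos (real (nat \<bar>int b - int c\<bar>) * t) = cos (real b * t - real c * t)" for b c
    using cos_nat_abs_diff[of "int b" "int c" t] by simp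
  have "poly (laurent_form N f g) ((1 + cos t) / 2) =
      (\<Sum>b\<le>N. \<Sum>c\<le>N. 2 * (coeff f b * coeff g c * cos (real b * t - real c * t)))"
    unfolding laurent_form_def poly_sum poly_smult poly_cheb c by (intro sum.cong refl) simp
  also have "\<dots> = 2 * (\<Sum>b\<le>N. \<Sum>c\<le>N. coeff f b * coeff g c * cos (real b * t - real c * t))"
    by (simp only: sum_distrib_left)
  also have "(\<Sum>b\<le>N. \<Sum>c\<le>N. coeff f b * coeff g c * cos (real b * t - real c * t)) =
     Re (cev f (cis t) * cnj (cev g (cis t)))"
    unfolding cev_cis[OF assms(1)] cev_cis[OF assms(2)] cnj_sum sum_product Re_sum
    by (intro sum.cong refl) (simp add: cos_diff algebra_simps)
  finally show ?thesis .
qed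

text \<open>The polynomial \<open>z\<^sup>m x\<^sup>j h(z)\<close> for \<open>4x = z + 2 + 1/z\<close>. It turns a Toeplitz form into a Hankel form
  with weight \<open>\<bar>h\<bar>\<^sup>2\<close>.\<close>
definition wfac :: "nat \<Rightarrow> real poly \<Rightarrow> nat \<Rightarrow> real poly" where
  "wfac m h j = monom 1 (m - j) * [:1/2, 1/2:] ^ (2 * j) * h"

lemma degree_wfac:
  assumes "j \<le> m" "degree h \<le> 1"
  shows "degree (wfac m h j) \<le> 2 * m + 1"
proof -
  have "degree (wfac m h j) \<le> (m - j + 2 * j) + 1"
    unfolding wfac_def
    by (intro order.trans[OF degree_mult_le] add_mono degree_monom_le assms(2))
       (rule order.trans[OF degree_power_le], simp)
  then show ?thesis using assms by simp
qed

text \<open>On the circle \<open>((1 + z) / 2)\<^sup>2 = z x\<close>, so every squared factor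
  contributes \<open>z x\<close> and the total power of \<open>z\<close> is \<open>m\<close> for
  each \<open>j\<close>.\<close>

lemma cev_wfac:
  assumes "j \<le> m"
  shows "cev (wfac m h j) (cis t) = cis t ^ m * complex_of_real (((1 + cos t) / 2) ^ j) * cev h (cis t)"
proof -
  have m: "cev (monom 1 k) z = z ^ k" for k z
    by (induction k) (auto simp: monom_0 monom_Suc cev_pCons cev_0)
  have sq: "(1 + cis t)\<^sup>2 = 4 * (cis t * complex_of_real ((1 + cos t) / 2))"
  proof -
    have "cis t * cnj (cis t) = 1" by (simp add: cis_cnj cis_mult)
    moreover have "complex_of_real (2 * cos t) = cis t + cnj (cis t)" by (simp add: complex_eq_iff)
    ultimately have c: "cis t * complex_of_real (2 * cos t) = cis t * cis t + 1" by (simp add: distrib_left)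
    have "4 * (cis t * complex_of_real ((1 + cos t) / 2)) = 2 * cis t + cis t * complex_of_real (2 * cos t)"
      by (simp add: algebra_simps)
    also have "\<dots> = (1 + cis t)\<^sup>2" unfolding c by (simp add: power2_eq_square algebra_simps)
    finally show ?thesis ..
  qed
  have e: "cev [:1/2, 1/2:] (cis t) = (1 + cis t) / 2" by (simp add: cev_pCons cev_0 add_divide_distrib)
  have q: "cev [:1/2, 1/2:] (cis t) ^ 2 = cis t * complex_of_real ((1 + cos t) / 2)"
    unfolding e power_divide sq by simp
  have "cev (wfac m h j) (cis t) = cis t ^ (m - j) * (cis t * complex_of_real ((1 + cos t) / 2)) ^ j * cev h (cis t)"
    unfolding wfac_def cev_mult m cev_power power_mult q ..
  also have "\<dots> = (cis t ^ (m - j) * cis t ^ j) * complex_of_real (((1 + cos t) / 2) ^ j) * cev h (cis t)"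
    by (simp only: power_mult_distrib of_real_power mult_ac)
  also have "cis t ^ (m - j) * cis t ^ j = cis t ^ m" using assms by (simp only: power_add[symmetric]) simp
  finally show ?thesis .
qed

text \<open>The common factor \<open>z ^ m\<close> has modulus 1 and cancels against its conjugate.
  What remains depends on \<open>j\<close> and \<open>l\<close> only through \<open>j + l\<close>,
  hence the Hankel structure.\<close>

lemma laurent_wfac:
  assumes "j \<le> m" "l \<le> m" "degree h \<le> 1"
    and g: "\<And>t. poly g ((1 + cos t) / 2) = (cmod (cev h (cis t)))\<^sup>2"
  shows "laurent_form (2 * m + 1) (wfac m h j) (wfac m h l) = smult 2 (monom 1 (j + l) * g)"
proof (rule poly_eq_cos)
  fix t :: real
  define x where "x = (1 + cos t) / 2"
  define z where "z = cis t ^ m"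
  have z: "z * cnj z = 1" unfolding z_def complex_norm_square[symmetric] by (simp add: norm_power)
  have "cev (wfac m h j) (cis t) * cnj (cev (wfac m h l) (cis t)) =
     (z * cnj z) * complex_of_real (x ^ j * x ^ l) * (cev h (cis t) * cnj (cev h (cis t)))"
    unfolding cev_wfac[OF assms(1)] cev_wfac[OF assms(2)] x_def[symmetric] z_def[symmetric] complex_cnj_mult complex_cnj_complex_of_real
      of_real_mult by (simp only: mult_ac)
  also have "\<dots> = complex_of_real (x ^ (j + l) * poly g x)"
    unfolding z unfolding x_def g[of t] complex_norm_square[symmetric] by (simp add: power_add)
  finally have "Re (cev (wfac m h j) (cis t) * cnj (cev (wfac m h l) (cis t))) = x ^ (j + l) * poly g x" by simp
  then show "poly (laurent_form (2 * m + 1) (wfac m h j) (wfac m h l)) ((1 + cos t) / 2) =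
      poly (smult 2 (monom 1 (j + l) * g)) ((1 + cos t) / 2)"
    unfolding poly_laurent_form[OF degree_wfac[OF assms(1,3)] degree_wfac[OF assms(2,3)]]
    by (simp add: x_def poly_monom)
qed

section \<open>From Toeplitz forms to Hankel forms\<close>

lemma qform_times:
  "qform (A \<times> P) T u = (\<Sum>i\<in>P. \<Sum>i'\<in>P. \<Sum>b\<in>A. \<Sum>c\<in>A. u (b, i) * T (b, i) (c, i') * u (c, i'))"
proof -
  have "qform (A \<times> P) T u = (\<Sum>b\<in>A. \<Sum>i\<in>P. \<Sum>c\<in>A. \<Sum>i'\<in>P. u (b, i) * T (b, i) (c, i') * u (c, i'))"
    unfolding qform_def by (simp only: sum.cartesian_product')
  also have "\<dots> = (\<Sum>i\<in>P. \<Sum>b\<in>A. \<Sum>c\<in>A. \<Sum>i'\<in>P. u (b, i) * T (b, i) (c, i') * u (c, i'))"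
    by (rule sum.swap)
  also have "\<dots> = (\<Sum>i\<in>P. \<Sum>b\<in>A. \<Sum>i'\<in>P. \<Sum>c\<in>A. u (b, i) * T (b, i) (c, i') * u (c, i'))"
    by (intro sum.cong refl sum.swap)
  also have "\<dots> = (\<Sum>i\<in>P. \<Sum>i'\<in>P. \<Sum>b\<in>A. \<Sum>c\<in>A. u (b, i) * T (b, i) (c, i') * u (c, i'))"
    by (intro sum.cong refl sum.swap)
  finally show ?thesis .
qed

lemma sum_bilinear:
  fixes F K :: "'a \<Rightarrow> 'b \<Rightarrow> real" and L :: "'b \<Rightarrow> 'b \<Rightarrow> real"
  shows "(\<Sum>b\<in>B. \<Sum>c\<in>B. (\<Sum>j\<in>A. \<alpha> j * F j b) * L b c * (\<Sum>l\<in>A. \<beta> l * F l c)) =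
    (\<Sum>j\<in>A. \<Sum>l\<in>A. \<alpha> j * (\<Sum>b\<in>B. \<Sum>c\<in>B. F j b * F l c * L b c) * \<beta> l)"
proof -
  have "(\<Sum>b\<in>B. \<Sum>c\<in>B. (\<Sum>j\<in>A. \<alpha> j * F j b) * L b c * (\<Sum>l\<in>A. \<beta> l * F l c)) =
     (\<Sum>b\<in>B. \<Sum>c\<in>B. \<Sum>j\<in>A. \<Sum>l\<in>A. \<alpha> j * F j b * L b c * (\<beta> l * F l c))"
    by (simp only: sum_distrib_right, simp only: sum_distrib_left)
  also have "\<dots> = (\<Sum>q\<in>B \<times> B. \<Sum>r\<in>A \<times> A. \<alpha> (fst r) * F (fst r) (fst q) * L (fst q) (snd q) * (\<beta> (snd r) * F (snd r) (snd q)))"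
    by (simp add: sum.cartesian_product')
  also have "\<dots> = (\<Sum>r\<in>A \<times> A. \<Sum>q\<in>B \<times> B. \<alpha> (fst r) * F (fst r) (fst q) * L (fst q) (snd q) * (\<beta> (snd r) * F (snd r) (snd q)))"
    by (rule sum.swap)
  also have "\<dots> = (\<Sum>j\<in>A. \<Sum>l\<in>A. \<Sum>b\<in>B. \<Sum>c\<in>B. \<alpha> j * F j b * L b c * (\<beta> l * F l c))"
    by (simp add: sum.cartesian_product')
  also have "\<dots> = (\<Sum>j\<in>A. \<Sum>l\<in>A. \<alpha> j * (\<Sum>b\<in>B. \<Sum>c\<in>B. F j b * F l c * L b c) * \<beta> l)"
    unfolding sum_distrib_left sum_distrib_right by (intro sum.cong refl) (simp only: mult_ac)
  finally show ?thesis .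
qed

text \<open>The coefficients, for each matrix index \<open>i\<close>, of the combination of the
  \<open>wfac m h j\<close> with scalars \<open>v (j, i)\<close>.\<close>

definition wvec :: "nat \<Rightarrow> real poly \<Rightarrow> (nat \<times> nat \<Rightarrow> real) \<Rightarrow> int \<times> nat \<Rightarrow> real" where
  "wvec m h v = (\<lambda>(b, i). \<Sum>j\<le>m. v (j, i) * coeff (wfac m h j) (nat b))"

abbreviation grid :: "nat \<Rightarrow> nat \<Rightarrow> (int \<times> nat) set" where
  "grid n p \<equiv> int ` {..n} \<times> {..<p}"

lemma set_tp: "set (tblocks p (Suc M)) = grid M p"
proof -
  have "{0..<Suc M} = {..M}" by auto
  then show ?thesis unfolding set_blocks set_map set_upt by simp
qed

text \<open>With \<open>h\<close> equal to 1, \<open>(1 + z) / 2\<close> and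
  \<open>(1 - z) / 2\<close> the weight \<open>g\<close> is 1, \<open>x\<close> and
  \<open>1 - x\<close>. So positivity of a single Toeplitz form controls the Hankel form, its shift
  and their difference.\<close>

lemma qform_toep_wvec:
  assumes "degree h \<le> 1" and g: "\<And>t. poly g ((1 + cos t) / 2) = (cmod (cev h (cis t)))\<^sup>2"
  shows "qform (grid (2 * m + 1) p) (toep y) (wvec m h v) =
    2 * qform ({..m} \<times> {..<p}) (\<lambda>a b. lfun y (snd a) (snd b) (monom 1 (fst a + fst b) * g)) v"
proof -
  let ?f = "wfac m h" and ?M = "2 * m + 1"
  have inj: "inj_on int {..?M}" by (simp add: inj_on_def)
  have core: "(\<Sum>b\<le>?M. \<Sum>c\<le>?M. coeff (?f j) b * coeff (?f l) c * cmom y (nat \<bar>int b - int c\<bar>) i i') =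
     2 * lfun y i i' (monom 1 (j + l) * g)" if "j \<le> m" "l \<le> m" for i i' j l
  proof -
    have "(\<Sum>b\<le>?M. \<Sum>c\<le>?M. coeff (?f j) b * coeff (?f l) c * cmom y (nat \<bar>int b - int c\<bar>) i i') =
      lfun y i i' (laurent_form ?M (?f j) (?f l))"
      unfolding laurent_form_def lfun_sum[OF finite_atMost] lfun_smult cmom_lfun ..
    then show ?thesis unfolding laurent_wfac[OF that assms(1) g] lfun_smult .
  qed
  have "qform (grid ?M p) (toep y) (wvec m h v) =
    (\<Sum>i<p. \<Sum>i'<p. \<Sum>b\<le>?M. \<Sum>c\<le>?M. (\<Sum>j\<le>m. v (j, i) * coeff (?f j) b) *
       cmom y (nat \<bar>int b - int c\<bar>) i i' * (\<Sum>l\<le>m. v (l, i') * coeff (?f l) c))"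
    unfolding qform_times sum.reindex[OF inj] by (simp add: wvec_def toep_def)
  also have "\<dots> = (\<Sum>i<p. \<Sum>i'<p. \<Sum>j\<le>m. \<Sum>l\<le>m. v (j, i) *
      (\<Sum>b\<le>?M. \<Sum>c\<le>?M. coeff (?f j) b * coeff (?f l) c * cmom y (nat \<bar>int b - int c\<bar>) i i') * v (l, i'))"
    by (simp only: sum_bilinear)
  also have "\<dots> = (\<Sum>i<p. \<Sum>i'<p. \<Sum>j\<le>m. \<Sum>l\<le>m. 2 * (v (j, i) * lfun y i i' (monom 1 (j + l) * g) * v (l, i')))"
    by (intro sum.cong refl, subst core) (simp_all only: atMost_iff mult_ac)
  also have "\<dots> = 2 * qform ({..m} \<times> {..<p}) (\<lambda>a b. lfun y (snd a) (snd b) (monom 1 (fst a + fst b) * g)) v"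
    unfolding qform_times by (simp add: sum_distrib_left)
  finally show ?thesis .
qed

lemma distinct_tp: "distinct (tblocks p N)"
proof -
  have "distinct (blocks p bs)" if "distinct bs" for bs
    using that
  proof (induction bs)
    case (Cons b bs)
    have "blocks p (b # bs) = map (Pair b) [0..<p] @ blocks p bs" by (simp add: blocks_def)
    then show ?case using Cons by (auto simp: distinct_map inj_on_def set_blocks)
  qed (simp add: blocks_def)
  then show ?thesis by (simp add: distinct_map)
qed

lemma toep_psd:
  assumes "tpos p (Suc M) y"
  shows "qform (grid M p) (toep y) u \<ge> 0"
    and "\<exists>a\<in>grid M p. u a \<noteq> 0 \<Longrightarrow> qform (grid M p) (toep y) u > 0"
proof -
  have p: "\<forall>v. (\<exists>i\<in>grid M p. v i \<noteq> (0::real)) \<longrightarrow> qform (grid M p) (toep y) v > 0"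
    using assms pd_iff_qform[OF distinct_tp symm_toep, of p "Suc M" y] unfolding tpos_def set_tp by blast
  then show 1: "\<exists>a\<in>grid M p. u a \<noteq> 0 \<Longrightarrow> qform (grid M p) (toep y) u > 0" by blast
  show "qform (grid M p) (toep y) u \<ge> 0"
  proof (cases "\<exists>a\<in>grid M p. u a \<noteq> 0")
    case True
    then show ?thesis using 1 by force
  next
    case False
    then have "qform (grid M p) (toep y) u = 0" unfolding qform_def by (intro sum.neutral ballI) auto
    then show ?thesis by simp
  qed
qed

text \<open>If the image vanished, then, after removal of \<open>z ^ m\<close>, the polynomial with
  coefficients \<open>v (j, i)\<close> would vanish on \<open>[0, 1]\<close>.\<close>

lemma wvec_nonzero:
  assumes "a \<in> {..m} \<times> {..<p}" "v a \<noteq> 0"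
  shows "\<exists>b\<in>grid (2 * m + 1) p. wvec m 1 v b \<noteq> 0"
proof (rule ccontr)
  assume "\<not> ?thesis"
  then have z: "wvec m 1 v (int b, i) = 0" if "b \<le> 2 * m + 1" "i < p" for b i
    using that by auto
  obtain j i where a: "a = (j, i)" "j \<le> m" "i < p" using assms(1) by auto
  define Q where "Q = (\<Sum>j\<le>m. smult (v (j, i)) (wfac m 1 j))"
  have dw: "degree (wfac m 1 j) \<le> 2 * m + 1" if "j \<le> m" for j
    using that by (intro degree_wfac) auto
  have "degree Q \<le> 2 * m + 1" unfolding Q_def
    by (intro degree_sum_le order.trans[OF degree_smult_le dw]) auto
  moreover have "coeff Q b = 0" if "b \<le> 2 * m + 1" for b
    using z[OF that a(3)] by (simp add: Q_def wvec_def coeff_sum)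
  ultimately have Q0: "Q = 0" by (intro poly_eqI) (metis coeff_0 coeff_eq_0 leI order.strict_trans1)
  define R where "R = (\<Sum>j\<le>m. monom (v (j, i)) j)"
  have "poly R ((1 + cos t) / 2) = poly 0 ((1 + cos t) / 2)" for t
  proof -
    have "cev Q (cis t) = (\<Sum>j\<le>m. complex_of_real (v (j, i)) * (cis t ^ m * complex_of_real (((1 + cos t) / 2) ^ j)))"
      unfolding Q_def by (simp add: cev_sum cev_smult cev_wfac cev_1)
    also have "\<dots> = cis t ^ m * complex_of_real (poly R ((1 + cos t) / 2))"
      unfolding R_def poly_sum poly_monom of_real_sum sum_distrib_left by (intro sum.cong refl) simp
    finally show ?thesis unfolding Q0 cev_0 by simp
  qed
  then have "R = 0" by (rule poly_eq_cos)
  moreover have "coeff R j = v (j, i)"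
  proof -
    have "coeff R j = (\<Sum>k\<le>m. if k = j then v (k, i) else 0)" unfolding R_def coeff_sum by (intro sum.cong) auto
    then show ?thesis using a(2) by simp
  qed
  ultimately show False using assms(2) a by simp
qed

lemma cmod_cev_linear: "(cmod (cev [:1/2, c:] (cis t)))\<^sup>2 = 1/4 + c * cos t + c\<^sup>2"
proof -
  have "cev [:1/2, c:] (cis t) = Complex (1/2 + c * cos t) (c * sin t)"
    by (simp add: complex_eq_iff cev_pCons cev_0)
  then have "(cmod (cev [:1/2, c:] (cis t)))\<^sup>2 = (1/2 + c * cos t)\<^sup>2 + (c * sin t)\<^sup>2"
    by (simp add: cmod_power2)
  also have "(1/2 + c * cos t)\<^sup>2 = 1/4 + c * cos t + (c * cos t)\<^sup>2"
    by (simp add: power2_eq_square algebra_simps)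
  also have "\<dots> + (c * sin t)\<^sup>2 = 1/4 + c * cos t + c\<^sup>2 * ((cos t)\<^sup>2 + (sin t)\<^sup>2)"
    unfolding power_mult_distrib distrib_left by (simp only: add.assoc)
  finally show ?thesis by simp
qed

text \<open>Nodes \<open>l r\<close> with rank-one matrix weights built from the vectors
  \<open>a r\<close>. The number of atoms does not depend on \<open>x\<close>, which makes limits of
  representations possible.\<close>

definition represents ::
  "nat \<Rightarrow> nat \<Rightarrow> (nat \<Rightarrow> real) \<Rightarrow> (nat \<Rightarrow> nat \<Rightarrow> real) \<Rightarrow> moments \<Rightarrow> bool" where
  "represents p n l a x \<longleftrightarrow> (\<forall>r<Suc n * p. 0 \<le> l r \<and> l r \<le> (1)) \<and>
    (\<forall>k\<le>n. \<forall>i<p. \<forall>j<p. mom x k i j = (\<Sum>r<Suc n * p. l r ^ k * (a r i * a r j)))"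

text \<open>The Hankel form \<open>H\<close> and its shift \<open>B\<close> satisfy
  \<open>0 \<le> B \<le> H\<close> and are diagonalized together. Their overlap
  \<open>H a (Suc k, j) = B a (k, j)\<close> forces the diagonalizing vectors to be geometric in
  \<open>k\<close>, so the relative eigenvalues become nodes in \<open>[0, 1]\<close>.\<close>

lemma atomic_representation:
  assumes "tpos p (Suc n) x"
  shows "\<exists>l a. represents p n l a x"
proof -
  \<comment> \<open>\<open>H\<close> and \<open>B\<close> involve moments up to order
    \<open>2 * n + 1\<close>, hence the extension by \<open>n + 1\<close> orders.\<close>
  obtain y where y: "\<And>k i j. k \<le> n \<Longrightarrow> y (k, i, j) = x (k, i, j)" and ty: "tpos p (Suc (2 * n + 1)) y"
    using extend_moments[OF assms, of "n + 1"] by (auto simp: mult_2 add.assoc)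
  define J where "J = {..n} \<times> {..<p}"
  define H where "H = (\<lambda>a b :: nat \<times> nat. mom y (fst a + fst b) (snd a) (snd b))"
  define B where "B = (\<lambda>a b :: nat \<times> nat. mom y (Suc (fst a + fst b)) (snd a) (snd b))"
  have fJ: "finite J" and cJ: "card J = Suc n * p" by (simp_all add: J_def)
  have symH: "symm H" and symB: "symm B"
    unfolding symm_def H_def B_def by (metis add.commute symm_mom)+
  have mX: "monom 1 k * [:0, 1:] = (monom 1 (Suc k) :: real poly)" for k
    by (simp add: monom_Suc)
  have Hform: "qform (grid (2 * n + 1) p) (toep y) (wvec n 1 v) = 2 * qform J H v" for v
    using qform_toep_wvec[of 1 1 n p y v] by (simp add: cev_1 lfun_monom J_def H_def)
  have Bform: "qform (grid (2 * n + 1) p) (toep y) (wvec n [:1/2, 1/2:] v) = 2 * qform J B v" for v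
  proof -
    have "poly [:0, 1:] ((1 + cos t) / 2) = (cmod (cev [:1/2, 1/2:] (cis t)))\<^sup>2" for t
      unfolding cmod_cev_linear by (simp add: power2_eq_square add_divide_distrib)
    then show ?thesis using qform_toep_wvec[of "[:1/2, 1/2:]" "[:0, 1:]" n p y v] unfolding mX lfun_monom J_def B_def by simp
  qed
  have HBform: "qform (grid (2 * n + 1) p) (toep y) (wvec n [:1/2, -1/2:] v) = 2 * (qform J H v - qform J B v)" for v
  proof -
    have "poly [:1, -1:] ((1 + cos t) / 2) = (cmod (cev [:1/2, -1/2:] (cis t)))\<^sup>2" for t
      unfolding cmod_cev_linear by (simp add: power2_eq_square add_divide_distrib)
    moreover have "lfun y i i' (monom 1 k * [:1, -1:]) = 1 * mom y k i i' - mom y (Suc k) i i'" for k i i'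
    proof -
      have "monom 1 k * [:1, -1:] = monom 1 k + smult (-1) (monom 1 (Suc k) :: real poly)"
        by (simp add: monom_Suc)
      then show ?thesis by (simp only: lfun_add lfun_smult lfun_monom)
    qed
    ultimately have "qform (grid (2 * n + 1) p) (toep y) (wvec n [:1/2, -1/2:] v) =
      2 * qform J (\<lambda>a b. 1 * H a b - B a b) v"
      using qform_toep_wvec[of "[:1/2, -1/2:]" "[:1, -1:]" n p y v] by (simp add: J_def H_def B_def)
    then show ?thesis unfolding qform_diff by simp
  qed
  have Hpos: "qform J H v > 0" if "\<exists>i\<in>J. v i \<noteq> 0" for v
  proof -
    have "qform (grid (2 * n + 1) p) (toep y) (wvec n 1 v) > 0"
      using that wvec_nonzero[of _ n p v] unfolding J_def by (intro toep_psd(2)[OF ty]) blast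
    then show ?thesis unfolding Hform by simp
  qed
  have B0: "0 \<le> qform J B v" for v
    using toep_psd(1)[OF ty, of "wvec n [:1/2, 1/2:] v"] unfolding Bform by simp
  have BH: "qform J B v \<le> qform J H v" for v
    using toep_psd(1)[OF ty, of "wvec n [:1/2, -1/2:] v"] unfolding HBform by simp
  note SD = simultaneous_diagonalization[OF fJ cJ symH symB Hpos B0 BH]
  obtain l w u where D: "(\<forall>r<Suc n * p. 0 \<le> l r \<and> l r \<le> (1 :: real)) \<and>
    (\<forall>i\<in>J. \<forall>j\<in>J. H i j = (\<Sum>r<Suc n * p. w r i * w r j)) \<and>
    (\<forall>i\<in>J. \<forall>j\<in>J. B i j = (\<Sum>r<Suc n * p. l r * (w r i * w r j))) \<and>
    (\<forall>r<Suc n * p. \<forall>s<Suc n * p. (\<Sum>i\<in>J. w r i * u s i) = (if r = s then 1 else 0))"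
    by (rule SD[THEN exE], assumption, elim exE, rule that)
  note l = D[THEN conjunct1] and Hw = D[THEN conjunct2, THEN conjunct1]
    and Bw = D[THEN conjunct2, THEN conjunct2, THEN conjunct1]
    and du = D[THEN conjunct2, THEN conjunct2, THEN conjunct2]
  define N where "N = Suc n * p"
  have step: "w s (Suc k, j) = l s * w s (k, j)" if k: "Suc k \<le> n" and j: "j < p" and s: "s < N" for s k j
  proof -
    define e where "e = (\<lambda>r. w r (Suc k, j) - l r * w r (k, j))"
    have z: "(\<Sum>r<N. w r a * e r) = 0" if a: "a \<in> J" for a
    proof -
      have kj: "(Suc k, j) \<in> J" "(k, j) \<in> J" using k j by (auto simp: J_def)
      have "w r a * e r = w r a * w r (Suc k, j) - l r * (w r a * w r (k, j))" for r
        unfolding e_def right_diff_distrib by (simp only: mult_ac)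
      then have "(\<Sum>r<N. w r a * e r) = H a (Suc k, j) - B a (k, j)"
        unfolding Hw[rule_format, OF a kj(1)] Bw[rule_format, OF a kj(2)] N_def
        by (simp only: sum_subtractf)
      then show ?thesis by (simp add: H_def B_def)
    qed
    \<comment> \<open>Pairing with the dual vector \<open>u s\<close> extracts \<open>e s\<close>
      from the vanishing combination.\<close>
    have "0 = (\<Sum>a\<in>J. u s a * (\<Sum>r<N. w r a * e r))"
      by (intro sum.neutral[symmetric] ballI) (simp only: z mult_zero_right)
    also have "\<dots> = (\<Sum>a\<in>J. \<Sum>r<N. w r a * u s a * e r)"
      unfolding sum_distrib_left by (intro sum.cong refl) (simp only: mult_ac)
    also have "\<dots> = (\<Sum>r<N. \<Sum>a\<in>J. w r a * u s a * e r)" by (rule sum.swap)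
    also have "\<dots> = (\<Sum>r<N. (if r = s then 1 else 0) * e r)"
      unfolding sum_distrib_right[symmetric]
    proof (intro sum.cong refl arg_cong2[where f = "(*)"])
      fix r assume "r \<in> {..<N}"
      then show "(\<Sum>a\<in>J. w r a * u s a) = (if r = s then 1 else 0)"
        using du[rule_format, of r s] s unfolding N_def by simp
    qed
    also have "\<dots> = (\<Sum>r<N. if r = s then e r else 0)" by (intro sum.cong) auto
    also have "\<dots> = e s" using s by simp
    finally show ?thesis by (simp add: e_def)
  qed
  have pow: "w s (k, j) = l s ^ k * w s (0, j)" if "k \<le> n" "j < p" "s < N" for s k j
    using that(1)
  proof (induction k)
    case (Suc k)
    then show ?case using step[OF Suc.prems that(2,3)] by (simp add: mult.assoc)
  qed simp
  have "mom x k i j = (\<Sum>r<N. l r ^ k * (w r (0, i) * w r (0, j)))" if k: "k \<le> n" and i: "i < p" and j: "j < p" for k i j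
  proof -
    have "mom x k i j = mom y k i j" by (rule mom_cong) (simp add: y[OF k])
    also have "\<dots> = H (0, i) (k, j)" by (simp add: H_def)
    also have "\<dots> = (\<Sum>r<N. w r (0, i) * w r (k, j))"
      unfolding N_def by (rule Hw[rule_format]) (use i j k in \<open>auto simp: J_def\<close>)
    also have "\<dots> = (\<Sum>r<N. l r ^ k * (w r (0, i) * w r (0, j)))"
    proof (intro sum.cong refl)
      fix r assume "r \<in> {..<N}"
      then have "w r (k, j) = l r ^ k * w r (0, j)" using pow[OF k j] by simp
      then show "w r (0, i) * w r (k, j) = l r ^ k * (w r (0, i) * w r (0, j))" by (simp only: mult_ac)
    qed
    finally show ?thesis .
  qed
  then have "\<forall>k\<le>n. \<forall>i<p. \<forall>j<p. mom x k i j = (\<Sum>r<Suc n * p. l r ^ k * (w r (0, i) * w r (0, j)))"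
    unfolding N_def by (intro allI impI)
  then show ?thesis
    unfolding represents_def by (intro exI[where x = l] exI[where x = "\<lambda>r i. w r (0, i)"] conjI l)
qed

section \<open>Necessity and closedness\<close>

text \<open>For positive \<open>N\<close> the cell with \<open>r = N\<close> is the single point 1,
  so a partition of \<open>[0, 1]\<close> needs \<open>r\<close> up to and including
  \<open>N\<close>.\<close>

definition cell :: "nat \<Rightarrow> nat \<Rightarrow> real set" where
  "cell N r = {x \<in> {0..1}. \<lfloor>real N * x\<rfloor> = int r}"

lemma cell_sets: "cell N r \<in> sets (restrict_space borel {0..1})"
proof -
  have "{x. \<lfloor>real N * x\<rfloor> = int r} \<in> sets borel" by measurable
  then show ?thesis unfolding sets_restrict_space cell_def
    by (intro image_eqI[of _ _ "{x. \<lfloor>real N * x\<rfloor> = int r}"]) auto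
qed

text \<open>Positivity of a matrix measure is given only for its values on sets, so moments are
  written as limits of sums over cells; dominated convergence applies to the step functions.\<close>

lemma riemann_moment:
  fixes \<nu> :: "real measure"
  assumes "finite_measure \<nu>" and sets: "sets \<nu> = sets (restrict_space borel {0..1})"
  shows "(\<lambda>N. \<Sum>r\<le>Suc N. (real r / real (Suc N)) ^ k * measure \<nu> (cell (Suc N) r)) \<longlonglongrightarrow> (\<integral>x. x ^ k \<partial>\<nu>)"
proof -
  interpret finite_measure \<nu> by fact
  have space: "space \<nu> = {0..1}" using sets_eq_imp_space_eq[OF sets] by (simp add: space_restrict_space)
  have cs: "cell N r \<in> sets \<nu>" for N r unfolding sets by (rule cell_sets)
  have idm: "(\<lambda>x. x) \<in> borel_measurable \<nu>"
    unfolding measurable_cong_sets[OF sets refl] by (intro measurable_restrict_space1) simp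
  let ?y = "\<lambda>N x. of_int \<lfloor>real (Suc N) * x\<rfloor> / real (Suc N) :: real"
  define g where "g = (\<lambda>N x. \<Sum>r\<le>Suc N. (real r / real (Suc N)) ^ k * indicator (cell (Suc N) r) x :: real)"
  have g: "g N x = (?y N x) ^ k" if "x \<in> space \<nu>" for N x
  proof -
    have x: "0 \<le> x" "x \<le> 1" using that space by auto
    define q where "q = nat \<lfloor>real (Suc N) * x\<rfloor>"
    have q0: "\<lfloor>real (Suc N) * x\<rfloor> = int q" unfolding q_def using x by simp
    have "real (Suc N) * x \<le> real (Suc N)" using x by (simp add: mult_left_le)
    then have "\<lfloor>real (Suc N) * x\<rfloor> \<le> int (Suc N)" by (metis floor_mono floor_of_nat)
    then have q1: "q \<le> Suc N" using q0 by simp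
    have "g N x = (\<Sum>r\<le>Suc N. if r = q then (real r / real (Suc N)) ^ k else 0)"
      unfolding g_def by (intro sum.cong refl) (use x q0 in \<open>auto simp: cell_def indicator_def\<close>)
    also have "\<dots> = (real q / real (Suc N)) ^ k"
      using q1 by (simp only: sum.delta finite_atMost atMost_iff if_True)
    finally show ?thesis using q0 by simp
  qed
  have lim: "(\<lambda>N. g N x) \<longlonglongrightarrow> x ^ k" if "x \<in> space \<nu>" for x
  proof -
    have "(\<lambda>N. ?y N x) \<longlonglongrightarrow> x"
    proof (rule real_tendsto_sandwich)
      show "\<forall>\<^sub>F N in sequentially. x - inverse (real (Suc N)) \<le> ?y N x"
      proof (intro always_eventually allI)
        fix N
        have "real (Suc N) * x - 1 \<le> of_int \<lfloor>real (Suc N) * x\<rfloor>" by linarith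
        then have "(real (Suc N) * x - 1) / real (Suc N) \<le> ?y N x"
          by (rule divide_right_mono) simp
        then show "x - inverse (real (Suc N)) \<le> ?y N x"
          by (simp add: diff_divide_distrib inverse_eq_divide del: of_nat_Suc)
      qed
      show "\<forall>\<^sub>F N in sequentially. ?y N x \<le> x"
      proof (intro always_eventually allI)
        fix N
        have "of_int \<lfloor>real (Suc N) * x\<rfloor> \<le> real (Suc N) * x" by linarith
        then have "?y N x \<le> (real (Suc N) * x) / real (Suc N)"
          by (rule divide_right_mono) simp
        then show "?y N x \<le> x" by (simp del: of_nat_Suc)
      qed
      show "(\<lambda>N. x - inverse (real (Suc N))) \<longlonglongrightarrow> x"
        using tendsto_diff[OF tendsto_const LIMSEQ_inverse_real_of_nat, of x] by simp
    qed simp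
    then show ?thesis unfolding g[OF that] by (rule tendsto_power)
  qed
  have gm: "g N \<in> borel_measurable \<nu>" for N
    unfolding g_def using cs by measurable
  have "(\<lambda>N. integral\<^sup>L \<nu> (g N)) \<longlonglongrightarrow> (\<integral>x. x ^ k \<partial>\<nu>)"
  proof (rule integral_dominated_convergence[where w = "\<lambda>_. 1"])
    show "(\<lambda>x. x ^ k) \<in> borel_measurable \<nu>" using idm by measurable
    show "AE x in \<nu>. (\<lambda>N. g N x) \<longlonglongrightarrow> x ^ k" using lim by (intro AE_I2)
    show "AE x in \<nu>. norm (g N x) \<le> 1" for N
    proof (intro AE_I2)
      fix x assume x: "x \<in> space \<nu>"
      then have x': "0 \<le> x" "x \<le> 1" using space by auto
      define y where "y = ?y N x"
      have "0 \<le> y" using x' unfolding y_def by simp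
      moreover have "y \<le> 1"
      proof -
        have "of_int \<lfloor>real (Suc N) * x\<rfloor> \<le> real (Suc N) * x" by linarith
        also have "\<dots> \<le> real (Suc N)" using x' by (simp add: mult_left_le)
        finally show ?thesis unfolding y_def by simp
      qed
      ultimately show "norm (g N x) \<le> 1" unfolding g[OF x] y_def[symmetric]
        by (simp add: power_le_one)
    qed
  qed (use gm in auto)
  moreover have "integral\<^sup>L \<nu> (g N) = (\<Sum>r\<le>Suc N. (real r / real (Suc N)) ^ k * measure \<nu> (cell (Suc N) r))" for N
  proof -
    have ci: "integrable \<nu> (indicator (cell (Suc N) r) :: real \<Rightarrow> real)" for r
      using cs emeasure_finite by (intro integrable_real_indicator) (auto simp: less_top[symmetric])
    have "integral\<^sup>L \<nu> (g N) = (\<Sum>r\<le>Suc N. (\<integral>x. (real r / real (Suc N)) ^ k * indicator (cell (Suc N) r) x \<partial>\<nu>))"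
      unfolding g_def by (intro Bochner_Integration.integral_sum integrable_mult_right ci)
    also have "\<dots> = (\<Sum>r\<le>Suc N. (real r / real (Suc N)) ^ k * measure \<nu> (cell (Suc N) r))"
      using cs sets.sets_into_space[OF cs] by (intro sum.cong refl) (simp add: Int_absorb2 del: of_nat_Suc)
    finally show ?thesis .
  qed
  ultimately show ?thesis by simp
qed

lemma riemann_sbm:
  assumes "signed_borel_measure01 m"
  shows "(\<lambda>N. \<Sum>r\<le>Suc N. (real r / real (Suc N)) ^ k * sbm_val m (cell (Suc N) r)) \<longlonglongrightarrow> sbm_integral m (\<lambda>x. x ^ k)"
proof -
  have "(\<lambda>N. (\<Sum>r\<le>Suc N. (real r / real (Suc N)) ^ k * measure (fst m) (cell (Suc N) r)) -
     (\<Sum>r\<le>Suc N. (real r / real (Suc N)) ^ k * measure (snd m) (cell (Suc N) r))) \<longlonglongrightarrow>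
     (\<integral>x. x ^ k \<partial>fst m) - (\<integral>x. x ^ k \<partial>snd m)"
    using assms unfolding signed_borel_measure01_def by (intro tendsto_diff riemann_moment) auto
  then show ?thesis unfolding sbm_integral_def sbm_val_def sum_subtractf[symmetric] right_diff_distrib .
qed

lemma sbm_integral_one:
  assumes "signed_borel_measure01 m"
  shows "sbm_integral m (\<lambda>x. x ^ 0) = sbm_val m {0..1}"
proof -
  have "space (fst m) = {0..1}" "space (snd m) = {0..1}"
    using assms sets_eq_imp_space_eq[of _ "restrict_space borel {0..1::real}"]
    unfolding signed_borel_measure01_def by (auto simp: space_restrict_space)
  then show ?thesis unfolding sbm_integral_def sbm_val_def by simp
qed

text \<open>\<open>cos ((b - c) t)\<close> is
  \<open>cos (b t) cos (c t) + sin (b t) sin (c t)\<close>, so the block form is twice the sum of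
  two values of the form of \<open>V\<close>.\<close>

lemma cheb_psd:
  assumes V: "\<And>w :: nat \<Rightarrow> real. (\<Sum>i<p. \<Sum>j<p. w i * V i j * w j) \<ge> 0" and x: "0 \<le> x" "x \<le> 1"
  shows "qform (grid n p) (\<lambda>a b. poly (cheb (nat \<bar>fst a - fst b\<bar>)) x * V (snd a) (snd b)) v \<ge> 0"
proof -
  define t where "t = arccos (2 * x - 1)"
  have "cos t = 2 * x - 1" unfolding t_def using x by (intro cos_arccos) auto
  then have xt: "x = (1 + cos t) / 2" by simp
  have c: "poly (cheb (nat \<bar>b - c\<bar>)) x = 2 * (cos (real_of_int b * t) * cos (real_of_int c * t) + sin (real_of_int b * t) * sin (real_of_int c * t))" for b c
    unfolding xt poly_cheb cos_nat_abs_diff cos_diff by simp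
  define A where "A = int ` {..n}"
  define C where "C = (\<lambda>i. \<Sum>b\<in>A. v (b, i) * cos (real_of_int b * t))"
  define S where "S = (\<lambda>i. \<Sum>b\<in>A. v (b, i) * sin (real_of_int b * t))"
  have "qform (A \<times> {..<p}) (\<lambda>a b. poly (cheb (nat \<bar>fst a - fst b\<bar>)) x * V (snd a) (snd b)) v =
    (\<Sum>i<p. \<Sum>j<p. 2 * (C i * V i j * C j + S i * V i j * S j))"
    unfolding qform_times
  proof (intro sum.cong refl)
    fix i j
    have "C i * V i j * C j = (\<Sum>b\<in>A. \<Sum>c\<in>A. v (b, i) * cos (real_of_int b * t) * V i j * (v (c, j) * cos (real_of_int c * t)))"
      unfolding C_def by (simp only: sum_distrib_right, simp only: sum_distrib_left)
    moreover have "S i * V i j * S j = (\<Sum>b\<in>A. \<Sum>c\<in>A. v (b, i) * sin (real_of_int b * t) * V i j * (v (c, j) * sin (real_of_int c * t)))"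
      unfolding S_def by (simp only: sum_distrib_right, simp only: sum_distrib_left)
    ultimately have "2 * (C i * V i j * C j + S i * V i j * S j) =
      (\<Sum>b\<in>A. \<Sum>c\<in>A. 2 * (v (b, i) * cos (real_of_int b * t) * V i j * (v (c, j) * cos (real_of_int c * t)) +
         v (b, i) * sin (real_of_int b * t) * V i j * (v (c, j) * sin (real_of_int c * t))))"
      by (simp only: distrib_left sum.distrib sum_distrib_left)
    also have "\<dots> = (\<Sum>b\<in>A. \<Sum>c\<in>A. v (b, i) * (poly (cheb (nat \<bar>fst (b, i) - fst (c, j)\<bar>)) x * V (snd (b, i)) (snd (c, j))) * v (c, j))"
      by (intro sum.cong refl) (simp add: c algebra_simps)
    finally show "(\<Sum>b\<in>A. \<Sum>c\<in>A. v (b, i) * (poly (cheb (nat \<bar>fst (b, i) - fst (c, j)\<bar>)) x * V (snd (b, i)) (snd (c, j))) * v (c, j)) =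
       2 * (C i * V i j * C j + S i * V i j * S j)" ..
  qed
  also have "\<dots> = 2 * ((\<Sum>i<p. \<Sum>j<p. C i * V i j * C j) + (\<Sum>i<p. \<Sum>j<p. S i * V i j * S j))"
    by (simp only: distrib_left sum.distrib sum_distrib_left)
  also have "\<dots> \<ge> 0" using V[of C] V[of S] by simp
  finally show ?thesis unfolding A_def .
qed

text \<open>Each cell contributes a form that is nonnegative by \<open>cheb_psd\<close>, with node
  \<open>X N r\<close> in \<open>[0, 1]\<close>; the sums over cells tend to the Toeplitz
  form.\<close>

lemma moment_space_psd:
  assumes s: "s \<in> moment_space p n"
  shows "qform (grid n p) (toep s) v \<ge> 0"
proof -
  obtain \<mu> where \<mu>: "real_matrix_measure p \<mu>"
    and sk: "\<And>k i j. (k, i, j) \<in> moment_index p n \<Longrightarrow> s (k, i, j) = sbm_integral (\<mu> i j) (\<lambda>x. x ^ k)"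
    using s unfolding moment_space_def by blast
  define V where "V = (\<lambda>N r i j. sbm_val (\<mu> i j) (cell (Suc N) r))"
  have sb: "signed_borel_measure01 (\<mu> i j)" if "i < p" "j < p" for i j
    using \<mu> that unfolding real_matrix_measure_def by blast
  have nn: "sym_nonneg_def p (V N r)" for N r
    using \<mu> cell_sets[of "Suc N" r] unfolding real_matrix_measure_def V_def by blast
  then have Vsym: "V N r i j = V N r j i" if "i < p" "j < p" for N r i j
    using that unfolding sym_nonneg_def_def by blast
  have Vpsd: "(\<Sum>i<p. \<Sum>j<p. w i * V N r i j * w j) \<ge> 0" for N r w
    using nn unfolding sym_nonneg_def_def by blast
  define X where "X = (\<lambda>N r. real r / real (Suc N))"
  have R: "(\<lambda>N. \<Sum>r\<le>Suc N. X N r ^ k * V N r i j) \<longlonglongrightarrow> mom s k i j" if k: "k \<le> n" and ij: "i < p" "j < p" for k i j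
  proof (cases "k = 0")
    case True
    have "sbm_integral (\<mu> i j) (\<lambda>x. x ^ k) = mom s k i j"
      unfolding True sbm_integral_one[OF sb[OF ij]] using \<mu> ij unfolding real_matrix_measure_def mom_def by simp
    then show ?thesis using riemann_sbm[OF sb[OF ij], of k] unfolding X_def V_def by simp
  next
    case False
    \<comment> \<open>Moments are recorded for ordered index pairs only; symmetry on cells carries
      the limit over to the other triangle.\<close>
    have mm: "min i j < p" "max i j < p" using ij by auto
    have "mom s k i j = s (k, min i j, max i j)" using False by (simp add: mom_def symm_coord_def)
    also have "\<dots> = sbm_integral (\<mu> (min i j) (max i j)) (\<lambda>x. x ^ k)"
      by (rule sk) (use k False mm in \<open>auto simp: moment_index_def\<close>)
    finally have e: "mom s k i j = sbm_integral (\<mu> (min i j) (max i j)) (\<lambda>x. x ^ k)" .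
    have "V N r (min i j) (max i j) = V N r i j" for N r
      using Vsym[OF ij] by (cases "i \<le> j") (auto simp: min_def max_def)
    then show ?thesis using riemann_sbm[OF sb[OF mm], of k] unfolding e X_def V_def by simp
  qed
  have cm: "(\<lambda>N. \<Sum>r\<le>Suc N. poly (cheb d) (X N r) * V N r i j) \<longlonglongrightarrow> cmom s d i j" if d: "d \<le> n" and ij: "i < p" "j < p" for d i j
  proof -
    have "(\<lambda>N. \<Sum>k\<le>d. coeff (cheb d) k * (\<Sum>r\<le>Suc N. X N r ^ k * V N r i j)) \<longlonglongrightarrow> cmom s d i j"
      unfolding cmom_def using d ij by (intro tendsto_sum tendsto_mult tendsto_const R) auto
    moreover have "(\<Sum>k\<le>d. coeff (cheb d) k * (\<Sum>r\<le>Suc N. X N r ^ k * V N r i j)) =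
      (\<Sum>r\<le>Suc N. poly (cheb d) (X N r) * V N r i j)" for N
    proof -
      have "poly (cheb d) y = (\<Sum>k\<le>d. coeff (cheb d) k * y ^ k)" for y
        unfolding poly_altdef using degree_cheb[of d] by (intro sum.mono_neutral_left) (auto simp: coeff_eq_0)
      then have "(\<Sum>r\<le>Suc N. poly (cheb d) (X N r) * V N r i j) = (\<Sum>r\<le>Suc N. \<Sum>k\<le>d. coeff (cheb d) k * X N r ^ k * V N r i j)"
        by (simp only: sum_distrib_right)
      also have "\<dots> = (\<Sum>k\<le>d. \<Sum>r\<le>Suc N. coeff (cheb d) k * X N r ^ k * V N r i j)" by (rule sum.swap)
      finally show ?thesis by (simp only: sum_distrib_left mult.assoc)
    qed
    ultimately show ?thesis by simp
  qed
  define J where "J = grid n p"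
  let ?K = "\<lambda>N r a b. poly (cheb (nat \<bar>fst a - fst b\<bar>)) (X N r) * V N r (snd a) (snd b)"
  have "(\<lambda>N. \<Sum>a\<in>J. \<Sum>b\<in>J. v a * (\<Sum>r\<le>Suc N. ?K N r a b) * v b)
     \<longlonglongrightarrow> qform J (toep s) v"
    unfolding qform_def toep_def
    by (intro tendsto_sum tendsto_mult tendsto_const cm) (auto simp: J_def)
  moreover have "0 \<le> (\<Sum>a\<in>J. \<Sum>b\<in>J. v a * (\<Sum>r\<le>Suc N. ?K N r a b) * v b)" for N
  proof -
    have "(\<Sum>a\<in>J. \<Sum>b\<in>J. v a * (\<Sum>r\<le>Suc N. ?K N r a b) * v b)
      = (\<Sum>a\<in>J. \<Sum>b\<in>J. \<Sum>r\<le>Suc N. v a * (?K N r a b) * v b)"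
      by (simp only: sum_distrib_left sum_distrib_right)
    also have "\<dots> = (\<Sum>a\<in>J. \<Sum>r\<le>Suc N. \<Sum>b\<in>J. v a * (?K N r a b) * v b)"
      by (intro sum.cong refl sum.swap)
    also have "\<dots> = (\<Sum>r\<le>Suc N. qform J (\<lambda>a b. ?K N r a b) v)"
      unfolding qform_def by (rule sum.swap)
    also have "\<dots> \<ge> 0"
      unfolding J_def by (intro sum_nonneg cheb_psd Vpsd) (auto simp: X_def)
    finally show ?thesis .
  qed
  ultimately show ?thesis unfolding J_def[symmetric] by (intro LIMSEQ_le_const[of _ _ 0]) auto
qed

section \<open>Finitely atomic matrix measures\<close>

definition atomic_measure :: "nat \<Rightarrow> (nat \<Rightarrow> real) \<Rightarrow> (nat \<Rightarrow> real) \<Rightarrow> real measure" where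
  "atomic_measure N w l = distr (point_measure {..<N} (\<lambda>r. ennreal (w r))) (restrict_space borel {0..1}) l"

lemma sets_atomic_measure: "sets (atomic_measure N w l) = sets (restrict_space borel {0..1})"
  by (simp add: atomic_measure_def)

context
  fixes N :: nat and l w :: "nat \<Rightarrow> real"
  assumes l: "\<And>r. r < N \<Longrightarrow> 0 \<le> l r \<and> l r \<le> 1" and w: "\<And>r. 0 \<le> w r"
begin

lemma measurable_atoms: "l \<in> measurable (point_measure {..<N} (\<lambda>r. ennreal (w r))) (restrict_space borel {0..1})"
  unfolding measurable_point_measure_eq1 using l by (auto simp: space_restrict_space)

lemma finite_atomic_measure: "finite_measure (atomic_measure N w l)"
proof -
  have "finite_measure (point_measure {..<N} (\<lambda>r. ennreal (w r)))"
    by (rule finite_measureI) (simp add: space_point_measure emeasure_point_measure_finite)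
  then show ?thesis unfolding atomic_measure_def
    by (rule finite_measure.finite_measure_distr[OF _ measurable_atoms])
qed

lemma integral_atomic_measure:
  assumes "f \<in> borel_measurable (restrict_space borel {0..1})"
  shows "integral\<^sup>L (atomic_measure N w l) f = (\<Sum>r<N. w r * f (l r))"
  unfolding atomic_measure_def integral_distr[OF measurable_atoms assms]
  by (subst lebesgue_integral_point_measure_finite) (use w in auto)

lemma measure_atomic_measure:
  assumes "A \<in> sets (restrict_space borel {0..1})"
  shows "measure (atomic_measure N w l) A = (\<Sum>r<N. w r * indicator A (l r))"
proof -
  have sp: "A \<subseteq> space (atomic_measure N w l)"
    using assms sets.sets_into_space[of A "atomic_measure N w l"] by (simp add: sets_atomic_measure)
  have "measure (atomic_measure N w l) A = integral\<^sup>L (atomic_measure N w l) (indicator A :: real \<Rightarrow> real)"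
    using sp by (simp add: Int_absorb2)
  also have "\<dots> = (\<Sum>r<N. w r * indicator A (l r))"
    using assms by (intro integral_atomic_measure) simp
  finally show ?thesis .
qed

end

lemma moment_space_atomic:
  fixes N :: nat and l :: "nat \<Rightarrow> real" and a :: "nat \<Rightarrow> nat \<Rightarrow> real"
  assumes s: "s \<in> PiE (moment_index p n) (\<lambda>_. UNIV)"
    and l: "\<And>r. r < N \<Longrightarrow> 0 \<le> l r \<and> l r \<le> 1"
    and rep: "\<And>k i j. k \<le> n \<Longrightarrow> i < p \<Longrightarrow> j < p \<Longrightarrow> mom s k i j = (\<Sum>r<N. l r ^ k * (a r i * a r j))"
  shows "s \<in> moment_space p n"
proof -
  \<comment> \<open>The weights \<open>a r i * a r j\<close> may be negative off the diagonal; their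
    positive and negative parts give the two measures of the pair.\<close>
  define \<mu> where "\<mu> = (\<lambda>i j :: nat. (atomic_measure N (\<lambda>r. max 0 (a r i * a r j)) l, atomic_measure N (\<lambda>r. max 0 (- (a r i * a r j))) l))"
  have mx1: "max 0 x - max 0 (- x) = x" for x :: real
    by (auto simp: max_def)
  have mx: "max 0 x * y - max 0 (- x) * y = x * y" for x y :: real
    by (auto simp: max_def)
  have val: "sbm_val (\<mu> i j) A = (\<Sum>r<N. a r i * a r j * indicator A (l r))"
    if "A \<in> sets (restrict_space borel {0..1})" for A i j
    unfolding sbm_val_def \<mu>_def fst_conv snd_conv
    by (subst (1 2) measure_atomic_measure[OF l _ that]) (auto simp: sum_subtractf[symmetric] mx mx1)
  have int: "sbm_integral (\<mu> i j) (\<lambda>x. x ^ k) = (\<Sum>r<N. a r i * a r j * l r ^ k)" for i j k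
  proof -
    have "(\<lambda>x :: real. x ^ k) \<in> borel_measurable (restrict_space borel {0..1})"
      by (intro measurable_restrict_space1) measurable
    from integral_atomic_measure[OF l _ this]
    show ?thesis unfolding sbm_integral_def \<mu>_def fst_conv snd_conv
      by (simp add: sum_subtractf[symmetric] mx)
  qed
  have UA: "{0..1 :: real} \<in> sets (restrict_space borel {0..1})"
    using sets.top[of "restrict_space borel {0..1 :: real}"] by (simp add: space_restrict_space)
  have "real_matrix_measure p \<mu>" unfolding real_matrix_measure_def
  proof (intro conjI allI impI ballI)
    fix i j
    show "signed_borel_measure01 (\<mu> i j)"
      unfolding signed_borel_measure01_def \<mu>_def
      using finite_atomic_measure[OF l] by (simp add: sets_atomic_measure)
  next
    fix A :: "real set" assume A: "A \<in> sets (restrict_space borel {0..1})"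
    show "sym_nonneg_def p (\<lambda>i j. sbm_val (\<mu> i j) A)" unfolding sym_nonneg_def_def val[OF A]
    proof (intro conjI allI impI)
      fix v :: "nat \<Rightarrow> real"
      have "(\<Sum>i<p. \<Sum>j<p. v i * (\<Sum>r<N. a r i * a r j * indicator A (l r)) * v j) =
        (\<Sum>i<p. \<Sum>j<p. \<Sum>r<N. v i * (a r i * a r j * indicator A (l r)) * v j)"
        by (simp only: sum_distrib_left sum_distrib_right)
      also have "\<dots> = (\<Sum>i<p. \<Sum>r<N. \<Sum>j<p. v i * (a r i * a r j * indicator A (l r)) * v j)"
        by (intro sum.cong refl sum.swap)
      also have "\<dots> = (\<Sum>r<N. \<Sum>i<p. \<Sum>j<p. v i * (a r i * a r j * indicator A (l r)) * v j)"
        by (rule sum.swap)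
      also have "\<dots> = (\<Sum>r<N. indicator A (l r) * (\<Sum>i<p. v i * a r i)\<^sup>2)"
      proof (intro sum.cong refl)
        fix r
        have "(\<Sum>i<p. v i * a r i)\<^sup>2 = (\<Sum>i<p. \<Sum>j<p. (v i * a r i) * (v j * a r j))"
          unfolding power2_eq_square by (rule sum_product)
        then have "indicator A (l r) * (\<Sum>i<p. v i * a r i)\<^sup>2 = (\<Sum>i<p. \<Sum>j<p. indicator A (l r) * ((v i * a r i) * (v j * a r j)))"
          by (simp only: sum_distrib_left)
        also have "\<dots> = (\<Sum>i<p. \<Sum>j<p. v i * (a r i * a r j * indicator A (l r)) * v j)"
          by (intro sum.cong refl) (simp only: mult_ac)
        finally show "(\<Sum>i<p. \<Sum>j<p. v i * (a r i * a r j * indicator A (l r)) * v j) = indicator A (l r) * (\<Sum>i<p. v i * a r i)\<^sup>2" ..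
      qed
      also have "\<dots> \<ge> 0" by (intro sum_nonneg mult_nonneg_nonneg) auto
      finally show "(\<Sum>i<p. \<Sum>j<p. v i * (\<Sum>r<N. a r i * a r j * indicator A (l r)) * v j) \<ge> 0" .
    qed (simp only: mult_ac)
  next
    fix i j assume ij: "i < p" "j < p"
    have "sbm_val (\<mu> i j) {0..1} = mom s 0 i j"
      unfolding val[OF UA] rep[OF le0 ij] using l by (intro sum.cong refl) auto
    then show "sbm_val (\<mu> i j) {0..1} = (if i = j then 1 else 0)" by (simp add: mom_def)
  qed
  moreover have "s (k, i, j) = sbm_integral (\<mu> i j) (\<lambda>x. x ^ k)" if "(k, i, j) \<in> moment_index p n" for k i j
  proof -
    have k: "1 \<le> k" "k \<le> n" "i \<le> j" "j < p" "i < p" using that by (auto simp: moment_index_def)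
    then have "s (k, i, j) = mom s k i j" by (simp add: mom_def symm_coord_def min_absorb1 max_absorb2)
    then show ?thesis unfolding int rep[OF k(2,5,4)] by (simp add: mult_ac)
  qed
  ultimately show ?thesis unfolding moment_space_def using s by blast
qed

section \<open>Contraction towards an interior point\<close>

definition mix :: "real \<Rightarrow> ('i \<Rightarrow> real) \<Rightarrow> ('i \<Rightarrow> real) \<Rightarrow> 'i \<Rightarrow> real" where
  "mix e z s = (\<lambda>i. (1 - e) * s i + e * z i)"

lemma mom_mix: "mom (mix e z s) k i j = (1 - e) * mom s k i j + e * mom z k i j"
  by (auto simp: mom_def symm_coord_def mix_def)

lemma toep_mix: "toep (mix e z s) u w = (1 - e) * toep s u w + e * toep z u w"
  unfolding toep_def cmom_def mom_mix
  by (simp add: distrib_left sum.distrib sum_distrib_left mult_ac)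

lemma qform_lincomb: "qform I (\<lambda>u w. c * A u w + d * B u w) v = c * qform I A v + d * qform I B v"
  unfolding qform_def by (simp add: algebra_simps sum.distrib sum_distrib_left)

lemma tpos_mix:
  assumes "\<And>v. qform (grid n p) (toep s) v \<ge> 0" "tpos p (Suc n) z" "0 < e" "e \<le> 1"
  shows "tpos p (Suc n) (mix e z s)"
proof -
  have "toep (mix e z s) = (\<lambda>u w. (1 - e) * toep s u w + e * toep z u w)"
    by (simp add: fun_eq_iff toep_mix)
  then have q: "qform (grid n p) (toep (mix e z s)) v =
      (1 - e) * qform (grid n p) (toep s) v + e * qform (grid n p) (toep z) v" for v
    by (simp only: qform_lincomb)
  have "qform (grid n p) (toep (mix e z s)) v > 0"
    if "\<exists>a\<in>grid n p. v a \<noteq> 0" for v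
    unfolding q using toep_psd(2)[OF assms(2) that] assms(1)[of v] assms(3,4)
    by (intro add_nonneg_pos mult_pos_pos mult_nonneg_nonneg) auto
  then show ?thesis
    unfolding tpos_def pd_iff_qform[OF distinct_tp symm_toep] set_tp by blast
qed

text \<open>The contracted sequences have atomic representations with a fixed number of atoms and
  bounded data, so a subsequence of these converges to a representation of \<open>s\<close>.\<close>

lemma atomic_limit:
  assumes t: "\<And>t :: nat. tpos p (Suc n) (mix (1 / (real t + 2)) z s)"
  shows "\<exists>l a. represents p n l a s"
proof -
  define N where "N = Suc n * p"
  define e where "e = (\<lambda>t :: nat. 1 / (real t + 2))"
  have "\<forall>t. \<exists>l a. represents p n l a (mix (e t) z s)"
    unfolding e_def by (intro allI atomic_representation[OF t])
  from choice[OF this] obtain l where "\<forall>t. \<exists>a. represents p n (l t) a (mix (e t) z s)" ..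
  from choice[OF this] obtain a where Q: "\<forall>t. represents p n (l t) (a t) (mix (e t) z s)" ..
  have l: "0 \<le> l t r \<and> l t r \<le> (1 :: real)" if "r < N" for t r
    using Q[rule_format, of t] that unfolding represents_def N_def by blast
  have a: "mom (mix (e t) z s) k i j = (\<Sum>r<N. l t r ^ k * (a t r i * a t r j))"
    if "k \<le> n" "i < p" "j < p" for t k i j
    using Q[rule_format, of t] that unfolding represents_def N_def by blast
  \<comment> \<open>The normalization of order 0 makes the sum of the squares equal to 1, which
    bounds the weight vectors.\<close>
  have abnd: "\<bar>a t r i\<bar> \<le> 1" if "r < N" "i < p" for t r i
  proof -
    have "(\<Sum>r<N. a t r i * a t r i) = 1"
      using a[of 0 i i t] that(2) by (simp add: mom_def)
    moreover have "a t r i * a t r i \<le> (\<Sum>r<N. a t r i * a t r i)"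
      by (rule member_le_sum) (use that in auto)
    ultimately have "(a t r i)\<^sup>2 \<le> 1" by (simp add: power2_eq_square)
    then show ?thesis by (simp add: abs_square_le_1)
  qed
  \<comment> \<open>Nodes (second index 0) and weight entries (second index \<open>Suc i\<close>)
    are packed into one point of a cube, so that one compactness argument yields a common
    subsequence.\<close>
  define F where "F = (\<lambda>t (r, i). if r < N then (case i of 0 \<Rightarrow> l t r | Suc i \<Rightarrow> if i < p then a t r i else 0) else 0)"
  define K where "K = PiE UNIV (\<lambda>_ :: nat \<times> nat. {-1..1 :: real})"
  have "F t (r, i) \<in> {-1..1}" for t r i
  proof (cases i)
    case 0
    then show ?thesis using l[of r t] by (auto simp: F_def intro: order_trans[of _ 0])
  next
    case (Suc j)
    then show ?thesis using abnd[of r j t] by (simp add: F_def abs_le_iff)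
  qed
  then have FK: "\<forall>t. F t \<in> K" by (auto simp: K_def)
  have "compact K" unfolding K_def by (rule compact_PiE_UNIV) simp
  then have "seq_compact K" by (rule compact_imp_seq_compact)
  from seq_compactE[OF this FK] obtain G \<rho> where \<rho>: "strict_mono \<rho>" and lim: "(F \<circ> \<rho>) \<longlonglongrightarrow> G" by blast
  have co: "(\<lambda>t. F (\<rho> t) q) \<longlonglongrightarrow> G q" for q
  proof -
    have "isCont (\<lambda>x :: nat \<times> nat \<Rightarrow> real. x q) G"
    proof -
      have "continuous_on UNIV (\<lambda>x :: nat \<times> nat \<Rightarrow> real. x q)" by (rule continuous_on_product_coordinates)
      then show ?thesis unfolding continuous_on_eq_continuous_at[OF open_UNIV] by blast
    qed
    from isCont_tendsto_compose[OF this lim] show ?thesis by (simp add: o_def)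
  qed
  define l' where "l' = (\<lambda>r. G (r, 0))"
  define a' where "a' = (\<lambda>r i. G (r, Suc i))"
  have l': "(\<lambda>t. l (\<rho> t) r) \<longlonglongrightarrow> l' r" if "r < N" for r
    using co[of "(r, 0)"] that by (simp add: F_def l'_def)
  have a': "(\<lambda>t. a (\<rho> t) r i) \<longlonglongrightarrow> a' r i" if "r < N" "i < p" for r i
    using co[of "(r, Suc i)"] that by (simp add: F_def a'_def)
  have "0 \<le> l' r \<and> l' r \<le> 1" if "r < N" for r
    using l[OF that] by (intro conjI LIMSEQ_le_const[OF l'[OF that]] LIMSEQ_le_const2[OF l'[OF that]]) auto
  moreover have "mom s k i j = (\<Sum>r<N. l' r ^ k * (a' r i * a' r j))" if kij: "k \<le> n" "i < p" "j < p" for k i j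
  proof -
    have "(\<lambda>t. 1 / real t) \<longlonglongrightarrow> 0" by (rule lim_1_over_n)
    then have "(\<lambda>t. 1 / real (t + 2)) \<longlonglongrightarrow> 0" by (rule LIMSEQ_ignore_initial_segment)
    then have "e \<longlonglongrightarrow> 0" by (simp add: e_def add.commute)
    then have "(\<lambda>t. e (\<rho> t)) \<longlonglongrightarrow> 0" using LIMSEQ_subseq_LIMSEQ[OF _ \<rho>] by (simp add: o_def)
    then have "(\<lambda>t. (1 - e (\<rho> t)) * mom s k i j + e (\<rho> t) * mom z k i j) \<longlonglongrightarrow> (1 - 0) * mom s k i j + 0 * mom z k i j"
      by (intro tendsto_add tendsto_mult tendsto_diff tendsto_const)
    then have "(\<lambda>t. mom (mix (e (\<rho> t)) z s) k i j) \<longlonglongrightarrow> mom s k i j" by (simp add: mom_mix)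
    moreover have "(\<lambda>t. mom (mix (e (\<rho> t)) z s) k i j) \<longlonglongrightarrow> (\<Sum>r<N. l' r ^ k * (a' r i * a' r j))"
      unfolding a[OF kij] using kij by (intro tendsto_sum tendsto_mult tendsto_power l' a') auto
    ultimately show ?thesis by (rule LIMSEQ_unique)
  qed
  ultimately have "(\<forall>r<N. 0 \<le> l' r \<and> l' r \<le> 1) \<and>
    (\<forall>k\<le>n. \<forall>i<p. \<forall>j<p. mom s k i j = (\<Sum>r<N. l' r ^ k * (a' r i * a' r j)))" by (intro conjI allI impI) blast+
  then show ?thesis unfolding represents_def N_def by (intro exI)
qed

section \<open>The volume of the moment space\<close>

text \<open>Mixing a positive definite form into a nonnegative one makes it positive definite; the
  converse is \<open>atomic_limit\<close>. Only countably many conditions occur, which gives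
  measurability, and \<open>t + 2\<close> keeps the mixing parameter below 1, so that the homothety
  is invertible.\<close>

lemma moment_space_iff:
  assumes z: "tpos p (Suc n) z"
  shows "s \<in> moment_space p n \<longleftrightarrow>
    s \<in> PiE (moment_index p n) (\<lambda>_. UNIV) \<and> (\<forall>t :: nat. tpos p (Suc n) (mix (1 / (real t + 2)) z s))"
proof
  assume s: "s \<in> moment_space p n"
  then have "s \<in> PiE (moment_index p n) (\<lambda>_. UNIV)" by (simp add: moment_space_def)
  moreover have "tpos p (Suc n) (mix (1 / (real t + 2)) z s)" for t
    by (rule tpos_mix[OF moment_space_psd[OF s] z]) (auto simp: divide_simps)
  ultimately show "s \<in> PiE (moment_index p n) (\<lambda>_. UNIV) \<and> (\<forall>t :: nat. tpos p (Suc n) (mix (1 / (real t + 2)) z s))"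
    by blast
next
  assume s: "s \<in> PiE (moment_index p n) (\<lambda>_. UNIV) \<and> (\<forall>t :: nat. tpos p (Suc n) (mix (1 / (real t + 2)) z s))"
  then obtain l a where la: "represents p n l a s"
    using atomic_limit[of p n z s] by blast
  show "s \<in> moment_space p n"
    by (rule moment_space_atomic[where N = "Suc n * p" and l = l and a = a]) (use s la in \<open>unfold represents_def, blast\<close>)+
qed

section \<open>Coordinates, measurability and scaling\<close>

lemma set_tri_upt: "set (tri (\<lambda>i j. (k, i, j)) [a..<p]) = {(k, i, j) | i j. a \<le> i \<and> i \<le> j \<and> j < p}"
proof (induction "p - a" arbitrary: a)
  case 0
  then show ?case by auto
next
  case (Suc d)
  then have "[a..<p] = a # [Suc a..<p]" by (simp add: upt_conv_Cons)
  moreover have "set (tri (\<lambda>i j. (k, i, j)) [Suc a..<p]) = {(k, i, j) | i j. Suc a \<le> i \<and> i \<le> j \<and> j < p}"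
    using Suc by (intro Suc.hyps(1)) auto
  moreover have "a < p" using Suc.hyps(2) by simp
  ultimately show ?case by (auto simp: le_Suc_eq Suc_le_eq)
qed

lemma distinct_tri_upt: "distinct (tri (\<lambda>i j. (k, i, j)) [a..<p])"
proof (induction "p - a" arbitrary: a)
  case 0
  then show ?case by simp
next
  case (Suc d)
  then have e: "[a..<p] = a # [Suc a..<p]" by (simp add: upt_conv_Cons)
  have "distinct (tri (\<lambda>i j. (k, i, j)) [Suc a..<p])" using Suc by (intro Suc.hyps(1)) auto
  then show ?case unfolding e tri.simps distinct_append set_tri_upt
    by (auto simp: distinct_map inj_on_def)
qed

lemma set_mom_coords: "set (mom_coords p n) = moment_index p n"
proof (induction n)
  case 0
  then show ?case by (auto simp: mom_coords_def moment_index_def)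
next
  case (Suc n)
  show ?case unfolding mom_coords_Suc set_append Suc.IH set_tri_upt
    by (auto simp: moment_index_def le_Suc_eq)
qed

lemma distinct_mom_coords: "distinct (mom_coords p n)"
proof (induction n)
  case 0
  then show ?case by (simp add: mom_coords_def)
next
  case (Suc n)
  show ?case unfolding mom_coords_Suc distinct_append set_mom_coords set_tri_upt
    using Suc.IH distinct_tri_upt by (auto simp: moment_index_def)
qed

abbreviation coord_measure :: "nat \<Rightarrow> nat \<Rightarrow> moments measure" where
  "coord_measure p n \<equiv> PiM (moment_index p n) (\<lambda>_. lborel)"

lemma measurable_mix: "mix e z \<in> measurable fun_space fun_space"
proof -
  have "(\<lambda>s. mix e z s i) \<in> measurable fun_space lborel" for i
    unfolding mix_def using measurable_coord[of i] by measurable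
  then show ?thesis by (intro measurable_PiM_single') (auto simp: space_PiM)
qed

text \<open>Points of the finite product are \<open>undefined\<close> outside the index set, hence
  constant in those coordinates.\<close>

lemma measurable_embed: "(\<lambda>s. s) \<in> measurable (coord_measure p n) fun_space"
proof (rule measurable_PiM_single')
  fix i :: "nat \<times> nat \<times> nat"
  show "(\<lambda>s. s i) \<in> measurable (coord_measure p n) lborel"
  proof (cases "i \<in> moment_index p n")
    case True
    then show ?thesis by measurable
  next
    case False
    then have "s i = undefined" if "s \<in> space (coord_measure p n)" for s
      using that PiE_arb[OF _ False, of s] by (simp add: space_PiM)
    then show ?thesis by (subst measurable_cong[where g = "\<lambda>_. undefined"]) auto
  qed
qed (auto simp: space_PiM)

definition shrunk :: "nat \<Rightarrow> nat \<Rightarrow> real \<Rightarrow> moments \<Rightarrow> moments set" where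
  "shrunk p n e z = {s \<in> space (coord_measure p n). tpos p (Suc n) (mix e z s)}"

lemma sets_shrunk: "shrunk p n e z \<in> sets (coord_measure p n)"
proof -
  have "Measurable.pred (coord_measure p n) (\<lambda>s. tpos p (Suc n) (mix e z s))"
    using measurable_compose[OF measurable_embed measurable_compose[OF measurable_mix measurable_tpos]] .
  then show ?thesis unfolding shrunk_def by measurable
qed

text \<open>In the listed coordinates a homothety of ratio \<open>1 - e\<close> maps this set onto
  the positive definite region, whose volume \<open>iterint_wgt\<close> gives with
  \<open>s = 0\<close> at every base point.\<close>

lemma emeasure_shrunk:
  assumes "e < 1"
  shows "ennreal (1 - e) ^ card (moment_index p n) * emeasure (coord_measure p n) (shrunk p n e z) =
    ennreal (\<Prod>k=1..n. multi_beta p (real k * (real p + 1) / 2) (real k * (real p + 1) / 2))"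
proof -
  define f where "f = (\<lambda>x. if tpos p (Suc n) x then 1 else 0 :: ennreal)"
  note [measurable] = measurable_tpos[of p "Suc n"]
  have fm: "f \<in> borel_measurable fun_space" unfolding f_def by measurable
  have fm': "(\<lambda>x. f (mix e z x)) \<in> borel_measurable fun_space"
    by (rule measurable_compose[OF measurable_mix fm])
  have "emeasure (coord_measure p n) (shrunk p n e z) = (\<integral>\<^sup>+s. indicator (shrunk p n e z) s \<partial>coord_measure p n)"
    by (simp add: sets_shrunk)
  also have "\<dots> = (\<integral>\<^sup>+s. f (mix e z (\<lambda>i. if i \<in> set (mom_coords p n) then s i else undefined)) \<partial>PiM (set (mom_coords p n)) (\<lambda>_. lborel))"
    unfolding set_mom_coords
  proof (rule nn_integral_cong)
    fix s assume s: "s \<in> space (coord_measure p n)"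
    then have "(\<lambda>i. if i \<in> moment_index p n then s i else undefined) = s"
      by (auto simp: space_PiM PiE_def extensional_def)
    then show "indicator (shrunk p n e z) s = f (mix e z (\<lambda>i. if i \<in> moment_index p n then s i else undefined))"
      using s by (simp add: shrunk_def f_def indicator_def)
  qed
  also have "\<dots> = iterint (mom_coords p n) (\<lambda>x. f (mix e z x)) (\<lambda>_. undefined)"
    by (rule nn_integral_PiM_iterint[OF distinct_mom_coords fm'])
  finally have E: "emeasure (coord_measure p n) (shrunk p n e z) = iterint (mom_coords p n) (\<lambda>x. f (mix e z x)) (\<lambda>_. undefined)" .
  have "card (moment_index p n) = length (mom_coords p n)"
    using distinct_card[OF distinct_mom_coords[of p n]] by (simp add: set_mom_coords)
  then have "ennreal (1 - e) ^ card (moment_index p n) * emeasure (coord_measure p n) (shrunk p n e z) =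
     iterint (mom_coords p n) f (\<lambda>i. (1 - e) * undefined + e * z i)"
    unfolding E mix_def using iterint_affine[OF fm, of "1 - e" "mom_coords p n" "\<lambda>i. e * z i" "\<lambda>_. undefined"] assms by simp
  \<comment> \<open>At exponent 0 the integrands agree because \<open>wgt\<close> is positive;
    \<open>0 powr 0\<close> would be 0.\<close>
  also have "f = wgt_integrand p n 0"
    using wgt_pos[of p n] by (force simp: f_def wgt_integrand_def fun_eq_iff)
  finally show ?thesis unfolding iterint_wgt[OF order_refl] by simp
qed

theorem theorem2p1:
  fixes p n :: nat
  assumes "p \<ge> 1" and "n \<ge> 1"
  shows "emeasure (PiM (moment_index p n) (\<lambda>_. lborel)) (moment_space p n) =
         ennreal (\<Prod>k=1..n. multi_beta p (real k * (real p + 1) / 2) (real k * (real p + 1) / 2))"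
proof -
  let ?L = "coord_measure p n" and ?M = "moment_space p n"
  define V where "V = (\<Prod>k=1..n. multi_beta p (real k * (real p + 1) / 2) (real k * (real p + 1) / 2))"
  define D where "D = card (moment_index p n)"
  obtain z where z: "tpos p (Suc n) z"
    using extend_moments[OF tpos_1(1)[of p "\<lambda>_. 0"], where m = n] by auto
  define c where "c = (\<lambda>t :: nat. 1 - 1 / (real t + 2))"
  have c: "0 < c t" "1 / (real t + 2) < 1" for t by (auto simp: c_def divide_simps)
  have Mint: "?M = (\<Inter>t. shrunk p n (1 / (real t + 2)) z)"
    unfolding shrunk_def by (auto simp: moment_space_iff[OF z] space_PiM)
  then have sM: "?M \<in> sets ?L" by (auto intro: sets_shrunk)
  \<comment> \<open>With \<open>e = 0\<close> the set is the positive definite region itself, which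
    lies in the moment space.\<close>
  have lower: "ennreal V \<le> emeasure ?L ?M"
  proof -
    have "shrunk p n 0 z \<subseteq> ?M"
    proof
      fix s assume s: "s \<in> shrunk p n 0 z"
      then have ts: "tpos p (Suc n) s" by (simp add: shrunk_def mix_def)
      have "tpos p (Suc n) (mix (1 / (real t + 2)) z s)" for t :: nat
        by (rule tpos_mix[OF toep_psd(1)[OF ts] z]) (auto simp: divide_simps)
      then show "s \<in> ?M" using s by (auto simp: moment_space_iff[OF z] shrunk_def space_PiM)
    qed
    then have "emeasure ?L (shrunk p n 0 z) \<le> emeasure ?L ?M" by (rule emeasure_mono[OF _ sM])
    then show ?thesis using emeasure_shrunk[of 0 p n z] by (simp add: V_def)
  qed
  \<comment> \<open>Every contraction maps the moment space into the positive definite region; this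
    bounds its volume up to the factor \<open>c t ^ D\<close>, and \<open>c t\<close> tends to
    1.\<close>
  have upper: "ennreal (c t ^ D) * emeasure ?L ?M \<le> ennreal V" for t
  proof -
    have "emeasure ?L ?M \<le> emeasure ?L (shrunk p n (1 / (real t + 2)) z)"
      unfolding Mint by (intro emeasure_mono sets_shrunk) auto
    then have "ennreal (c t ^ D) * emeasure ?L ?M \<le> ennreal (c t ^ D) * emeasure ?L (shrunk p n (1 / (real t + 2)) z)"
      by (rule mult_left_mono) simp
    also have "\<dots> = ennreal V"
      using emeasure_shrunk[OF c(2)[of t], of p n z] c(1)[of t] unfolding V_def D_def c_def by (simp add: ennreal_power)
    finally show ?thesis .
  qed
  have "emeasure ?L ?M \<noteq> top"
  proof
    assume "emeasure ?L ?M = top"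
    then show False using upper[of 0] c(1)[of 0] by (simp add: ennreal_mult_top top_unique)
  qed
  then obtain e where e: "emeasure ?L ?M = ennreal e" "e \<ge> 0" by (cases "emeasure ?L ?M") auto
  have V0: "V \<ge> 0" unfolding V_def
  proof (rule prod_nonneg)
    fix k assume k: "k \<in> {1..n}"
    define a where "a = real k * (real p + 1)"
    have "1 * (real p + 1) \<le> a" unfolding a_def using k by (intro mult_right_mono) auto
    then have "a / 2 > (real p - 1) / 2" "a / 2 + a / 2 > (real p - 1) / 2" by auto
    from this[THEN multi_gamma_pos]
    show "multi_beta p (real k * (real p + 1) / 2) (real k * (real p + 1) / 2) \<ge> 0"
      unfolding a_def[symmetric] multi_beta_def by (intro divide_nonneg_nonneg mult_nonneg_nonneg) (rule less_imp_le, assumption)+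
  qed
  have "c t ^ D * e \<le> V" for t
    using upper[of t] V0 c(1)[of t] e(2) unfolding e(1) by (simp add: ennreal_mult[symmetric] less_imp_le)
  moreover have "(\<lambda>t. c t ^ D * e) \<longlonglongrightarrow> (1 - 0) ^ D * e"
  proof -
    have "(\<lambda>t. 1 / real t) \<longlonglongrightarrow> 0" by (rule lim_1_over_n)
    then have "(\<lambda>t. 1 / real (t + 2)) \<longlonglongrightarrow> 0" by (rule LIMSEQ_ignore_initial_segment)
    then have "(\<lambda>t. 1 / (real t + 2)) \<longlonglongrightarrow> 0" by (simp add: add.commute)
    then show ?thesis unfolding c_def by (intro tendsto_intros)
  qed
  ultimately have "e \<le> V" by (intro LIMSEQ_le_const2[where x = e]) auto
  then have "emeasure ?L ?M \<le> ennreal V" unfolding e(1) by (rule ennreal_leI)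
  with lower show ?thesis unfolding V_def by (rule antisym[rotated])
qed

end
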